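(* Let $s\in(0,1]$. Let $\varphi\in\mathcal{L}_2(\mathbb{R}^d)\cap\mathcal{L}_\infty(\mathbb{R}^d)\cap\mathcal{P}$ and suppose there are constants $c,C,\beta>0$ such that $|\widehat{\varphi}(\xi)|\le C\exp(-c\|\xi\|_2^\beta)$ for all $\xi\in\mathbb{R}^d$. Assume that $\int_{\mathbb{R}^d}\|x\|_2^s\varphi(x)\,dx\le K_1$ for a finite constant $K_1$, and let $f_0\in\mathcal{W}^{s,2}(\mathbb{R}^d)\cap\mathcal{L}_\infty(\mathbb{R}^d)\cap\mathcal{P}$. Let the observations $X_1,X_2,\dots$ be i.i.d. with density $f_0$. For each $n\ge3$, let $m_n\in\mathbb{N}$, $\nu_n>0$, $\epsilon_n\ge0$, and let $\hat f_n\in\mathcal{G}_{m_n,\nu_n}$ be an $\epsilon_n$-minimizer of the least-squares criterion over $\mathcal{G}_{m_n,\nu_n}$, i.e. $$\int_{\mathbb{R}^d}\hat f_n^2(x)\,dx-2P_n\hat f_n\le\inf_{f\in\mathcal{G}_{m_n,\nu_n}}\left[\int_{\mathbb{R}^d}f^2(x)\,dx-2P_nf\right]+\epsilon_n .$$ Then $$\mathrm{E}\|\hat f_n-f_0\|_2^2\lesssim\frac{\nu_n^d}{m_n}+\nu_n^{-2s}+M_{\nu_n}\frac{(1+\log n)^{d/\beta}}{n}+\epsilon_n .$$ In particular, fix $M,N>0$ and define, for all $n\ge3$, $$m_n=\left\lceil M\frac{n}{(1+\log n)^{d/\beta}}\right\rceil\qquad\text{and}\qquad\nu_n=N\left(\frac{n}{(1+\log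 n)^{d/\beta}}\right)^{1/(2s+d)} .$$ If $\epsilon_n\lesssim\left(\frac{(1+\log n)^{d/\beta}}{n}\right)^{\frac{2s}{2s+d}}$, then $$\mathrm{E}\|\hat f_n-f_0\|_2^2\lesssim\left(\frac{(1+\log n)^{d/\beta}}{n}\right)^{\frac{2s}{2s+d}} .$$ If, in addition, $\operatorname{supp}(\widehat\varphi)\subseteq B(0,R_0)$ for some $R_0>0$, then (for general $m_n,\nu_n,\epsilon_n$) $$\mathrm{E}\|\hat f_n-f_0\|_2^2\lesssim\frac{\nu_n^d}{m_n}+\nu_n^{-2s}+M_{\nu_n}\frac1n+\epsilon_n .$$ In particular, under this additional assumption, for fixed $M,N>0$, if $m_n=\lceil Mn\rceil$ and $\nu_n=Nn^{1/(2s+d)}$ for all $n\ge3$, then the condition $\epsilon_n\lesssim n^{-\frac{2s}{2s+d}}$ implies $$\mathrm{E}\|\hat f_n-f_0\|_2^2\lesssim n^{-\frac{2s}{2s+d}} .$$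
   Context: $\mathcal{P}$ is the set of all probability density functions on $\mathbb{R}^d$. The Fourier transform is $\widehat g(\xi)=(2\pi)^{-d/2}\int_{\mathbb{R}^d}e^{-i\langle x,\xi\rangle}g(x)\,dx$. Under the Fourier decay assumption $\widehat\varphi\in\mathcal{L}_1$, and $\varphi$ always denotes its continuous version given by Fourier inversion. $B(0,R)$ is the closed Euclidean ball. For $\nu>0$, $\varphi_\nu(x)=\nu^d\varphi(\nu x)$, and for $m\in\mathbb{N}$, $$\mathcal{G}_{m,\nu}=\left\{\sum_{j=1}^m\pi_j\varphi_\nu(\cdot-\mu_j) : \mu_j\in\mathbb{R}^d,\ \pi_j\ge0,\ \sum_{j=1}^m\pi_j=1\right\}.$$ $M_\nu=\|f_0\|_\infty\vee\|\varphi_\nu\|_\infty=\|f_0\|_\infty\vee\nu^d\|\varphi\|_\infty$. $P_nf=n^{-1}\sum_{i=1}^nf(X_i)$. Estimators $\hat f_n$ are understood to be measurable with respect to the sample $X_1,\dots,X_n$. $\mathcal{W}^{1,2}$ is the space of $f\in\mathcal{L}_2$ with first-order weak derivatives in $\mathcal{L}_2$; for $s\in(0,1)$, $\mathcal{W}^{s,2}$ is the space of $f\in\mathcal{L}_2$ with $\int_{\mathbb{R}^d}\int_{\mathbb{R}^d}|f(x)-f(y)|^2\|x-y\|_2^{-d-2s}\,dx\,dy<\infty$; for $s=1$, $\mathcal{W}^{s,2}$ means $\mathcal{W}^{1,2}$. $a\lesssim b$ means $a\le C'b$ for a finite constant $C'>0$ independent of the principal asymptotic variables: in the general bounds, $C'$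 does not depend on $n,m_n,\nu_n,\epsilon_n$; in the tuned bounds, $C'$ does not depend on $n$ (it may depend on the fixed objects $d,s,\varphi,K_1,f_0,M,N,R_0$ and on the constant in the condition on $\epsilon_n$). All bounds hold for all $n\ge3$. *)

theory Defs
  imports "HOL-Probability.Probability"
begin

definition prob_density :: "('a::euclidean_space \<Rightarrow> real) \<Rightarrow> bool" where
  "prob_density f \<longleftrightarrow>
     f \<in> borel_measurable borel \<and> (\<forall>x. 0 \<le> f x) \<and>
     integrable lborel f \<and> integral\<^sup>L lborel f = 1"

definition L2_fun :: "('a::euclidean_space \<Rightarrow> real) \<Rightarrow> bool" where
  "L2_fun f \<longleftrightarrow> f \<in> borel_measurable borel \<and> integrable lborel (\<lambda>x. (f x)\<^sup>2)"

definition Linf_fun :: "('a::euclidean_space \<Rightarrow> real) \<Rightarrow> bool" where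
  "Linf_fun f \<longleftrightarrow>
     f \<in> borel_measurable borel \<and> esssup lborel (\<lambda>x. ereal \<bar>f x\<bar>) < \<infinity>"

definition Linf_norm :: "('a::euclidean_space \<Rightarrow> real) \<Rightarrow> real" where
  "Linf_norm f = real_of_ereal (esssup lborel (\<lambda>x. ereal \<bar>f x\<bar>))"

definition L2_dist_sq :: "('a::euclidean_space \<Rightarrow> real) \<Rightarrow> ('a \<Rightarrow> real) \<Rightarrow> ennreal" where
  "L2_dist_sq f g = (\<integral>\<^sup>+ x. ennreal ((f x - g x)\<^sup>2) \<partial>lborel)"

definition fourier :: "('a::euclidean_space \<Rightarrow> real) \<Rightarrow> 'a \<Rightarrow> complex" where
  "fourier g \<xi> =
     complex_of_real ((2 * pi) powr (- real DIM('a) / 2)) *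
     (\<integral>x. exp (- (\<i> * complex_of_real (x \<bullet> \<xi>))) * complex_of_real (g x) \<partial>lborel)"

(* A function is of class C^(k+1) iff it is differentiable everywhere and all its
   partial derivatives are of class C^k. *)
primrec Ck_fun :: "nat \<Rightarrow> ('a::euclidean_space \<Rightarrow> real) \<Rightarrow> bool" where
  "Ck_fun 0 f \<longleftrightarrow> continuous_on UNIV f"
| "Ck_fun (Suc k) f \<longleftrightarrow>
     (\<forall>x. f differentiable (at x)) \<and>
     (\<forall>b\<in>Basis. Ck_fun k (\<lambda>x. frechet_derivative f (at x) b))"

definition test_fun :: "('a::euclidean_space \<Rightarrow> real) \<Rightarrow> bool" where
  "test_fun \<psi> \<longleftrightarrow> (\<forall>k. Ck_fun k \<psi>) \<and> compact (closure {x. \<psi> x \<noteq> 0})"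

definition weak_partial_deriv ::
  "('a::euclidean_space \<Rightarrow> real) \<Rightarrow> 'a \<Rightarrow> ('a \<Rightarrow> real) \<Rightarrow> bool" where
  "weak_partial_deriv f b g \<longleftrightarrow>
     (\<forall>\<psi>. test_fun \<psi> \<longrightarrow>
        (\<integral>x. f x * frechet_derivative \<psi> (at x) b \<partial>lborel) = - (\<integral>x. g x * \<psi> x \<partial>lborel))"

(* Only meaningful for exponents 0 < s \<le> 1. *)
definition sobolev :: "real \<Rightarrow> ('a::euclidean_space \<Rightarrow> real) \<Rightarrow> bool" where
  "sobolev s f \<longleftrightarrow>
     L2_fun f \<and>
     (if s = 1 then \<forall>b\<in>Basis. \<exists>g. L2_fun g \<and> weak_partial_deriv f b g
      else (\<integral>\<^sup>+ x. (\<integral>\<^sup>+ y. ennreal (\<bar>f x - f y\<bar>\<^sup>2 *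
              norm (x - y) powr (- real DIM('a) - 2 * s)) \<partial>lborel) \<partial>lborel) < \<infinity>)"

definition dilate :: "real \<Rightarrow> ('a::euclidean_space \<Rightarrow> real) \<Rightarrow> 'a \<Rightarrow> real" where
  "dilate \<nu> \<phi> x = \<nu> ^ DIM('a) * \<phi> (\<nu> *\<^sub>R x)"

definition mixtures :: "('a::euclidean_space \<Rightarrow> real) \<Rightarrow> nat \<Rightarrow> real \<Rightarrow> ('a \<Rightarrow> real) set" where
  "mixtures \<phi> m \<nu> =
     {(\<lambda>x. \<Sum>j=1..m. w j * dilate \<nu> \<phi> (x - \<mu> j)) | w \<mu>.
        (\<forall>j\<in>{1..m}. 0 \<le> w j) \<and> (\<Sum>j=1..m. w j) = 1}"

definition sup_bound :: "('a::euclidean_space \<Rightarrow> real) \<Rightarrow> ('a \<Rightarrow> real) \<Rightarrow> real \<Rightarrow> real" where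
  "sup_bound f0 \<phi> \<nu> = max (Linf_norm f0) (Linf_norm (dilate \<nu> \<phi>))"

definition empirical_mean :: "nat \<Rightarrow> (nat \<Rightarrow> 'a) \<Rightarrow> ('a \<Rightarrow> real) \<Rightarrow> real" where
  "empirical_mean n x f = (\<Sum>i=1..n. f (x i)) / real n"

definition ls_criterion ::
  "nat \<Rightarrow> (nat \<Rightarrow> 'a::euclidean_space) \<Rightarrow> ('a \<Rightarrow> real) \<Rightarrow> real" where
  "ls_criterion n x f = (\<integral>y. (f y)\<^sup>2 \<partial>lborel) - 2 * empirical_mean n x f"

definition iid_sample ::
  "'w measure \<Rightarrow> (nat \<Rightarrow> 'w \<Rightarrow> 'a::euclidean_space) \<Rightarrow> ('a \<Rightarrow> real) \<Rightarrow> bool" where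
  "iid_sample \<Omega> X f0 \<longleftrightarrow>
     prob_space \<Omega> \<and>
     prob_space.indep_vars \<Omega> (\<lambda>_. borel) X {1..} \<and>
     (\<forall>i\<ge>1. distributed \<Omega> lborel (X i) (\<lambda>x. ennreal (f0 x)))"

definition sample_algebra ::
  "'w measure \<Rightarrow> (nat \<Rightarrow> 'w \<Rightarrow> 'a::euclidean_space) \<Rightarrow> nat \<Rightarrow> 'w measure" where
  "sample_algebra \<Omega> X n =
     vimage_algebra (space \<Omega>) (\<lambda>\<omega>. \<lambda>i\<in>{1..n}. X i \<omega>) (Pi\<^sub>M {1..n} (\<lambda>_. borel))"

(* Measurability of the function-valued estimator is required pointwise in x. When phi is
   continuous, every mixture is continuous, so this is the same as joint measurability in
   the outcome and x. For bounded continuous phi, the criterion is bounded below on the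
   mixtures, so that the infimum is a genuine one. *)
definition ls_estimator ::
  "('a::euclidean_space \<Rightarrow> real) \<Rightarrow> 'w measure \<Rightarrow> (nat \<Rightarrow> 'w \<Rightarrow> 'a) \<Rightarrow>
   nat \<Rightarrow> nat \<Rightarrow> real \<Rightarrow> real \<Rightarrow> ('w \<Rightarrow> 'a \<Rightarrow> real) \<Rightarrow> bool" where
  "ls_estimator \<phi> \<Omega> X n m \<nu> \<epsilon> fhat \<longleftrightarrow>
     (\<forall>x. (\<lambda>\<omega>. fhat \<omega> x) \<in> borel_measurable (sample_algebra \<Omega> X n)) \<and>
     (\<forall>\<omega>\<in>space \<Omega>.
        fhat \<omega> \<in> mixtures \<phi> m \<nu> \<and>
        ls_criterion n (\<lambda>i. X i \<omega>) (fhat \<omega>)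
          \<le> (INF f\<in>mixtures \<phi> m \<nu>. ls_criterion n (\<lambda>i. X i \<omega>) f) + \<epsilon>)"

definition ls_setup ::
  "('a::euclidean_space \<Rightarrow> real) \<Rightarrow> ('a \<Rightarrow> real) \<Rightarrow> 'w measure \<Rightarrow> (nat \<Rightarrow> 'w \<Rightarrow> 'a) \<Rightarrow>
   (nat \<Rightarrow> nat) \<Rightarrow> (nat \<Rightarrow> real) \<Rightarrow> (nat \<Rightarrow> real) \<Rightarrow> (nat \<Rightarrow> 'w \<Rightarrow> 'a \<Rightarrow> real) \<Rightarrow> bool" where
  "ls_setup \<phi> f0 \<Omega> X m \<nu> \<epsilon> fhat \<longleftrightarrow>
     iid_sample \<Omega> X f0 \<and>
     (\<forall>n\<ge>3. 1 \<le> m n \<and> 0 < \<nu> n \<and> 0 \<le> \<epsilon> n \<and>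
        ls_estimator \<phi> \<Omega> X n (m n) (\<nu> n) (\<epsilon> n) (fhat n))"

definition risk ::
  "'w measure \<Rightarrow> ('w \<Rightarrow> 'a::euclidean_space \<Rightarrow> real) \<Rightarrow> ('a \<Rightarrow> real) \<Rightarrow> ennreal" where
  "risk \<Omega> fhat f0 = (\<integral>\<^sup>+ \<omega>. L2_dist_sq (fhat \<omega>) f0 \<partial>\<Omega>)"

end

theory Submission
  imports Defs "HOL-Real_Asymp.Real_Asymp"
begin

text \<open>
  Let \<open>k\<close> be the dilated kernel, \<open>P\<close> the true mean and \<open>P\<^sub>n\<close> the empirical one. Comparing the near-minimizer
  \<open>fh\<close> with any mixture \<open>f\<close> gives
  \<open>|fh - f0|\<^sup>2 \<le> |f - f0|\<^sup>2 + 2 (P\<^sub>n - P) (fh - f) + \<epsilon>\<close>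
  in squared \<open>L\<^sup>2\<close> norms, so that an approximation error and an empirical process have to be bounded.

  \<^bold>\<open>Empirical process.\<close> By Fourier inversion, \<open>(P\<^sub>n - P) g\<close> is the pairing of the transform of
  \<open>g = fh - f\<close> with the difference \<open>D\<close> of the empirical and the true characteristic function, and
  \<open>E |D \<xi>|\<^sup>2 \<le> 1 / n\<close> for every \<open>\<xi>\<close>. For frequencies up to \<open>\<nu> T\<close>, the Plancherel identity bounds the
  contribution by \<open>|g|\<^sup>2 / 4\<close>, which the left-hand side absorbs, plus four times the integral of \<open>|D|\<^sup>2\<close>
  over a ball, whose expectation is of order \<open>(\<nu> T) ^ d / n\<close>. Beyond \<open>\<nu> T\<close> the transform of \<open>g\<close> is at most
  twice that of \<open>k\<close>, and \<open>E |D \<xi>| \<le> 1 / sqrt n\<close>, so the contribution is \<open>\<nu> ^ d / sqrt n\<close> times the tail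
  integral of the transform of \<open>\<phi>\<close> beyond \<open>T\<close>. If \<open>T powr \<beta>\<close> is of order \<open>1 + ln n\<close>, that tail is of order
  \<open>1 / sqrt n\<close>; for a band-limited kernel it vanishes at a constant \<open>T\<close>. This is the source of the fast rate
  and of the logarithm (\<open>empirical_process_split\<close>, \<open>pathwise_risk_inequality\<close>, \<open>fourier_tail_log_cutoff\<close>).

  \<^bold>\<open>Approximation.\<close> These bounds are uniform in \<open>f\<close>, so \<open>f\<close> may depend on the sample: it is the
  equally weighted mixture centred at the first \<open>m\<close> observations. It is an unbiased estimate of
  the convolution \<open>f0 * k\<close> with integrated variance at most \<open>(\<integral>k\<^sup>2) / m\<close>, which is of order \<open>\<nu> ^ d / m\<close>
  (\<open>random_mixture_bound\<close>). The bias \<open>f0 * k - f0\<close> is an average of increments of \<open>f0\<close>. Sobolev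
  regularity enters through \<open>sobolev_translation_gap\<close>: the \<open>L\<^sup>2\<close> norm of \<open>f0 (x - y) - f0 x\<close> is of
  order \<open>|y| powr s\<close>. A weighted Cauchy-Schwarz inequality then bounds the squared bias by the square of
  the moment of order \<open>s\<close> of \<open>k\<close>, which is of order \<open>\<nu> powr (- 2 s)\<close> (\<open>bias_bound\<close>).

  The bounds come out with \<open>\<nu> ^ d\<close> in place of the larger \<open>sup_bound\<close>, up to a constant. The tuned
  rates follow from this sharper form by balancing the terms (\<open>risk_rates\<close>).
\<close>

section \<open>Integration on Euclidean space\<close>

lemma nn_integral_lborel_affine:
  fixes f :: "'a::euclidean_space \<Rightarrow> ennreal"
  assumes [measurable]: "f \<in> borel_measurable borel" and c: "c \<noteq> 0"
  shows "(\<integral>\<^sup>+x. f x \<partial>lborel) = ennreal (\<bar>c\<bar> ^ DIM('a)) * (\<integral>\<^sup>+x. f (t + c *\<^sub>R x) \<partial>lborel)"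
  by (subst lborel_affine[OF c, of t])
    (simp add: nn_integral_density nn_integral_distr nn_integral_cmult ennreal_power)

lemma nn_integral_lborel_reflect:
  fixes f :: "'a::euclidean_space \<Rightarrow> ennreal"
  assumes "f \<in> borel_measurable borel"
  shows "(\<integral>\<^sup>+x. f (t - x) \<partial>lborel) = (\<integral>\<^sup>+x. f x \<partial>lborel)"
  using nn_integral_lborel_affine[OF assms, of "-1" t] by simp

lemma nn_integral_lborel_translate:
  fixes f :: "'a::euclidean_space \<Rightarrow> ennreal"
  assumes "f \<in> borel_measurable borel"
  shows "(\<integral>\<^sup>+x. f (t + x) \<partial>lborel) = (\<integral>\<^sup>+x. f x \<partial>lborel)"
  using nn_integral_lborel_affine[OF assms, of "1" t] by simp

lemma integrable_lborel_affine_iff: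
  fixes f :: "'a::euclidean_space \<Rightarrow> 'b::{banach, second_countable_topology}"
  assumes [measurable]: "f \<in> borel_measurable borel" and c: "c \<noteq> 0"
  shows "integrable lborel (\<lambda>x. f (t + c *\<^sub>R x)) \<longleftrightarrow> integrable lborel f"
proof -
  have "(\<integral>\<^sup>+x. ennreal (norm (f x)) \<partial>lborel) < \<infinity> \<longleftrightarrow>
        (\<integral>\<^sup>+x. ennreal (norm (f (t + c *\<^sub>R x))) \<partial>lborel) < \<infinity>"
    by (subst nn_integral_lborel_affine[OF _ c, of _ t])
      (use c in \<open>auto simp: ennreal_mult_less_top ennreal_mult_eq_top_iff top_unique less_top\<close>)
  thus ?thesis by (simp add: integrable_iff_bounded)
qed

lemma integral_lborel_affine:
  fixes f :: "'a::euclidean_space \<Rightarrow> 'b::{banach, second_countable_topology}"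
  assumes [measurable]: "f \<in> borel_measurable borel" and c: "c \<noteq> 0"
  shows "integral\<^sup>L lborel f = (\<bar>c\<bar> ^ DIM('a)) *\<^sub>R (\<integral>x. f (t + c *\<^sub>R x) \<partial>lborel)"
  by (subst lborel_affine[OF c, of t])
    (simp add: integral_density integral_distr)

lemma integral_lborel_reflect:
  fixes f :: "'a::euclidean_space \<Rightarrow> 'b::{banach, second_countable_topology}"
  assumes "f \<in> borel_measurable borel"
  shows "(\<integral>x. f (t - x) \<partial>lborel) = integral\<^sup>L lborel f"
  using integral_lborel_affine[OF assms, of "-1" t] by simp

lemma integral_lborel_translate:
  fixes f :: "'a::euclidean_space \<Rightarrow> 'b::{banach, second_countable_topology}"
  assumes "f \<in> borel_measurable borel"
  shows "(\<integral>x. f (t + x) \<partial>lborel) = integral\<^sup>L lborel f"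
  using integral_lborel_affine[OF assms, of "1" t] by simp

text \<open>Suited to the Fourier arguments, where the exponential factors have modulus 1, so that an integrand
  is bounded by a product of two integrable functions of one variable each.\<close>

lemma (in pair_sigma_finite) Fubini_dominated:
  fixes k :: "'a \<Rightarrow> 'b \<Rightarrow> 'c::{banach, second_countable_topology}"
  assumes [measurable]: "case_prod k \<in> borel_measurable (M1 \<Otimes>\<^sub>M M2)"
    and f: "integrable M1 (f::'a \<Rightarrow> real)" and g: "integrable M2 (g::'b \<Rightarrow> real)"
    and bound: "\<And>x y. norm (k x y) \<le> f x * g y"
  shows "integrable (M1 \<Otimes>\<^sub>M M2) (case_prod k)"
    and "(\<integral>y. (\<integral>x. k x y \<partial>M1) \<partial>M2) = (\<integral>x. (\<integral>y. k x y \<partial>M2) \<partial>M1)"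
proof -
  have [measurable]: "f \<in> borel_measurable M1" "g \<in> borel_measurable M2"
    using f g by auto
  have "integrable (M1 \<Otimes>\<^sub>M M2) (\<lambda>(x, y). f x * g y)"
    by (intro Fubini_integrable) (use f g in \<open>auto simp: abs_mult\<close>)
  thus int: "integrable (M1 \<Otimes>\<^sub>M M2) (case_prod k)"
    by (rule Bochner_Integration.integrable_bound)
      (use bound in \<open>auto intro!: AE_I2 order_trans[OF bound]\<close>)
  show "(\<integral>y. (\<integral>x. k x y \<partial>M1) \<partial>M2) = (\<integral>x. (\<integral>y. k x y \<partial>M2) \<partial>M1)"
    by (rule Fubini_integral[OF int])
qed

lemma borel_measurable_cis [measurable]: "cis \<in> borel_measurable borel"
  by (intro borel_measurable_continuous_onI continuous_intros)

lemma integrable_cis_mult: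
  fixes h :: "'a \<Rightarrow> complex"
  assumes "integrable M h" "g \<in> borel_measurable M"
  shows "integrable M (\<lambda>x. cis (g x) * h x)"
proof (rule Bochner_Integration.integrable_bound[OF assms(1)])
  have [measurable]: "h \<in> borel_measurable M" "g \<in> borel_measurable M" using assms by auto
  show "(\<lambda>x. cis (g x) * h x) \<in> borel_measurable M" by measurable
qed (auto simp: norm_mult)

section \<open>Fourier inversion and the Plancherel identity\<close>

text \<open>The standard Gaussian density is written as a product over coordinates, so that its Fourier
  transform reduces to the characteristic function of the standard normal distribution.\<close>

definition gauss :: "'a::euclidean_space \<Rightarrow> real" where
  "gauss x = (\<Prod>b\<in>Basis. std_normal_density (x \<bullet> b))"

lemma gauss_eq: "gauss (x::'a::euclidean_space) =
    (2 * pi) powr (- real DIM('a) / 2) * exp (- (norm x)\<^sup>2 / 2)"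
proof -
  have "gauss x = (\<Prod>b\<in>(Basis::'a set). (2 * pi) powr (-1/2)) * (\<Prod>b\<in>Basis. exp (- (x \<bullet> b)\<^sup>2 / 2))"
    unfolding gauss_def prod.distrib[symmetric]
    by (intro prod.cong) (auto simp: std_normal_density_def powr_minus powr_half_sqrt divide_simps)
  also have "(\<Prod>b\<in>(Basis::'a set). (2 * pi) powr (-1/2)) = (2 * pi) powr (- real DIM('a) / 2)"
    by (simp add: powr_realpow[symmetric] powr_powr)
  also have "(\<Prod>b\<in>Basis. exp (- (x \<bullet> b)\<^sup>2 / 2)) = exp (- (norm x)\<^sup>2 / 2)"
    unfolding exp_sum[symmetric, OF finite_Basis] power2_norm_eq_inner
    by (subst euclidean_inner) (simp add: sum_divide_distrib sum_negf power2_eq_square)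
  finally show ?thesis .
qed

lemma gauss_nonneg: "0 \<le> gauss x"
  by (simp add: gauss_eq)

lemma borel_measurable_gauss [measurable]: "gauss \<in> borel_measurable borel"
  unfolding gauss_def[abs_def] by measurable

lemma
  fixes h :: "'a::euclidean_space \<Rightarrow> real \<Rightarrow> complex"
  assumes h: "\<And>b. b \<in> Basis \<Longrightarrow> integrable lborel (h b)"
  shows integrable_lborel_prod: "integrable lborel (\<lambda>x. \<Prod>b\<in>Basis. h b (x \<bullet> b))"
    and integral_lborel_prod: "(\<integral>x. (\<Prod>b\<in>Basis. h b (x \<bullet> b)) \<partial>lborel) = (\<Prod>b\<in>Basis. integral\<^sup>L lborel (h b))"
proof -
  interpret product_sigma_finite "\<lambda>_::'a. lborel :: real measure" ..
  have [measurable]: "h b \<in> borel_measurable borel" if "b \<in> Basis" for b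
    using h[OF that] by auto
  have *: "(\<lambda>x. \<Prod>b\<in>Basis. h b ((\<Sum>b\<in>Basis. x b *\<^sub>R b) \<bullet> b)) = (\<lambda>x. \<Prod>b\<in>(Basis::'a set). h b (x b))"
    by (intro ext prod.cong) auto
  show "integrable lborel (\<lambda>x. \<Prod>b\<in>Basis. h b (x \<bullet> b))"
    by (subst lborel_eq) (use product_integrable_prod[of "Basis::'a set" h] h in \<open>simp add: integrable_distr_eq\<close>)
  show "(\<integral>x. (\<Prod>b\<in>Basis. h b (x \<bullet> b)) \<partial>lborel) = (\<Prod>b\<in>Basis. integral\<^sup>L lborel (h b))"
    by (subst lborel_eq) (use product_integral_prod[of "Basis::'a set" h] h in \<open>simp add: integral_distr\<close>)
qed

lemma gauss_transform:
  fixes \<xi> :: "'a::euclidean_space"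
  shows "integrable lborel (\<lambda>x. cis (x \<bullet> \<xi>) * complex_of_real (gauss x))" (is ?A)
    and "(\<integral>x. cis (x \<bullet> \<xi>) * complex_of_real (gauss x) \<partial>lborel) = exp (- (norm \<xi>)\<^sup>2 / 2)" (is ?B)
proof -
  define h :: "'a \<Rightarrow> real \<Rightarrow> complex" where
    "h b x = cis (x * (\<xi> \<bullet> b)) * complex_of_real (std_normal_density x)" for b x
  have int: "integrable lborel (h b)" for b
    unfolding h_def by (intro integrable_cis_mult integrable_of_real) auto
  have val: "integral\<^sup>L lborel (h b) = exp (- (\<xi> \<bullet> b)\<^sup>2 / 2)" for b
  proof -
    have "char std_normal_distribution (\<xi> \<bullet> b) = integral\<^sup>L lborel (h b)"
      unfolding char_def h_def
      by (subst integral_density) (auto simp: cis_conv_exp scaleR_conv_of_real mult_ac)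
    thus ?thesis by (simp add: char_std_normal_distribution)
  qed
  have eq: "(\<lambda>x. cis (x \<bullet> \<xi>) * complex_of_real (gauss x)) = (\<lambda>x. \<Prod>b\<in>Basis. h b (x \<bullet> b))"
    by (intro ext) (simp add: h_def gauss_def prod.distrib cis_conv_exp euclidean_inner[of _ \<xi>]
        sum_distrib_left exp_sum)
  show ?A unfolding eq by (intro integrable_lborel_prod int)
  have "exp (- (norm \<xi>)\<^sup>2 / 2) = (\<Prod>b\<in>Basis. exp (- (\<xi> \<bullet> b)\<^sup>2 / 2))"
    unfolding exp_sum[symmetric, OF finite_Basis] power2_norm_eq_inner
    by (subst euclidean_inner) (simp add: sum_divide_distrib sum_negf power2_eq_square)
  thus ?B unfolding eq
    by (subst integral_lborel_prod[OF int]) (simp add: val flip: of_real_prod)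
qed

lemma integrable_gauss: "integrable lborel (gauss :: 'a::euclidean_space \<Rightarrow> real)"
  using gauss_transform(1)[of 0] by (simp add: complex_of_real_integrable_eq)

lemma integral_gauss: "integral\<^sup>L lborel (gauss :: 'a::euclidean_space \<Rightarrow> real) = 1"
proof -
  have "complex_of_real (integral\<^sup>L lborel (gauss :: 'a \<Rightarrow> real)) = 1"
    using gauss_transform(2)[of "0::'a"] by simp
  thus ?thesis using of_real_eq_1_iff by blast
qed

lemma fourier_cis:
  "fourier g \<xi> = complex_of_real ((2 * pi) powr (- real DIM('a) / 2)) *
     (\<integral>x. cis (- (x \<bullet> \<xi>)) * complex_of_real (g (x::'a::euclidean_space)) \<partial>lborel)"
  by (simp add: fourier_def cis_conv_exp)

lemma borel_measurable_fourier [measurable]: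
  fixes g :: "'a::euclidean_space \<Rightarrow> real"
  assumes [measurable]: "g \<in> borel_measurable borel"
  shows "fourier g \<in> borel_measurable borel"
  unfolding fourier_cis[abs_def] by measurable

lemma gauss_scaled_transform:
  fixes u :: "'a::euclidean_space"
  assumes \<sigma>: "\<sigma> > 0"
  shows "(\<integral>\<xi>. cis (u \<bullet> \<xi>) * complex_of_real (exp (- (norm (\<sigma> *\<^sub>R \<xi>))\<^sup>2 / 2)) \<partial>lborel) =
    complex_of_real ((2 * pi) powr (real DIM('a) / 2) * ((2 * pi) powr (real DIM('a) / 2) * gauss (u /\<^sub>R \<sigma>) / \<sigma> ^ DIM('a)))"
proof -
  let ?p = "(2 * pi) powr (real DIM('a) / 2)"
  have e: "exp (- (norm (x::'a))\<^sup>2 / 2) = ?p * gauss x" for x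
    by (simp add: gauss_eq powr_minus powr_add[symmetric])
  have dil: "(\<sigma> *\<^sub>R \<xi>) \<bullet> (u /\<^sub>R \<sigma>) = u \<bullet> \<xi>" for \<xi>
    using \<sigma> by (simp add: inner_commute[of \<xi>])
  have "(\<integral>\<xi>. cis (u \<bullet> \<xi>) * complex_of_real (exp (- (norm (\<sigma> *\<^sub>R \<xi>))\<^sup>2 / 2)) \<partial>lborel) =
     (\<integral>\<xi>. complex_of_real ?p * (cis ((\<sigma> *\<^sub>R \<xi>) \<bullet> (u /\<^sub>R \<sigma>)) * complex_of_real (gauss (\<sigma> *\<^sub>R \<xi>))) \<partial>lborel)"
    unfolding e dil by (simp only: of_real_mult mult_ac)
  also have "\<dots> = complex_of_real ?p * (\<integral>\<xi>. cis ((\<sigma> *\<^sub>R \<xi>) \<bullet> (u /\<^sub>R \<sigma>)) * complex_of_real (gauss (\<sigma> *\<^sub>R \<xi>)) \<partial>lborel)"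
    by (rule integral_mult_right_zero)
  also have "(\<integral>\<xi>. cis ((\<sigma> *\<^sub>R \<xi>) \<bullet> (u /\<^sub>R \<sigma>)) * complex_of_real (gauss (\<sigma> *\<^sub>R \<xi>)) \<partial>lborel) =
     (\<integral>\<xi>. cis (\<xi> \<bullet> (u /\<^sub>R \<sigma>)) * complex_of_real (gauss \<xi>) \<partial>lborel) / \<sigma> ^ DIM('a)"
    by (subst integral_lborel_affine[of _ \<sigma> 0])
      (use \<sigma> in \<open>auto simp: scaleR_conv_of_real\<close>)
  also have "\<dots> = complex_of_real (?p * gauss (u /\<^sub>R \<sigma>) / \<sigma> ^ DIM('a))"
    unfolding gauss_transform(2) e by simp
  finally show ?thesis by (simp add: of_real_mult)
qed

text \<open>Multiplying the transform by \<open>exp (- \<sigma>\<^sup>2 |\<xi>|\<^sup>2 / 2)\<close> makes the double integral absolutely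
  convergent. Exchanging the order of integration turns the damped inverse transform into the average
  of \<open>g (x - \<sigma> z)\<close> over a Gaussian \<open>z\<close>. Both sides converge as \<open>\<sigma> \<rightarrow> 0\<close>, one by integrability
  of the transform, the other by continuity and boundedness of \<open>g\<close>.\<close>

theorem fourier_inversion:
  fixes g :: "'a::euclidean_space \<Rightarrow> real"
  assumes cont: "continuous_on UNIV g" and bdd: "\<And>x. \<bar>g x\<bar> \<le> B"
    and g: "integrable lborel g" and Fg: "integrable lborel (fourier g)"
  shows "complex_of_real (g x) = complex_of_real ((2 * pi) powr (- real DIM('a) / 2)) *
           (\<integral>\<xi>. cis (x \<bullet> \<xi>) * fourier g \<xi> \<partial>lborel)"
proof -
  let ?p = "(2 * pi) powr (real DIM('a) / 2)"
  let ?q = "(2 * pi) powr (- real DIM('a) / 2)"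
  have pq: "?q * ?p = 1" by (simp add: powr_add[symmetric])
  have [measurable]: "g \<in> borel_measurable borel"
    using cont by (rule borel_measurable_continuous_onI)
  define E where "E \<sigma> \<xi> = complex_of_real (exp (- (norm (\<sigma> *\<^sub>R \<xi>))\<^sup>2 / 2))" for \<sigma> and \<xi> :: 'a
  have [measurable]: "E \<sigma> \<in> borel_measurable borel" for \<sigma> unfolding E_def[abs_def] by measurable
  have E_le: "norm (E \<sigma> \<xi>) \<le> 1" for \<sigma> \<xi> by (simp add: E_def)
  have intE: "integrable lborel (\<lambda>\<xi>. norm (E \<sigma> \<xi>))" if "\<sigma> > 0" for \<sigma>
  proof -
    have "integrable lborel (\<lambda>\<xi>::'a. gauss (0 + \<sigma> *\<^sub>R \<xi>))"
      using that integrable_gauss by (subst integrable_lborel_affine_iff) auto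
    hence "integrable lborel (\<lambda>\<xi>::'a. ?p * gauss (\<sigma> *\<^sub>R \<xi>))" by simp
    thus ?thesis unfolding E_def gauss_eq by (simp add: powr_minus)
  qed
  define J where "J \<sigma> = (\<integral>\<xi>. cis (x \<bullet> \<xi>) * fourier g \<xi> * E \<sigma> \<xi> \<partial>lborel)" for \<sigma>
  have J: "J \<sigma> = complex_of_real (?p * (\<integral>z. g (x - \<sigma> *\<^sub>R z) * gauss z \<partial>lborel))" if \<sigma>: "\<sigma> > 0" for \<sigma>
  proof -
    let ?k = "\<lambda>y \<xi>. cis (x \<bullet> \<xi>) * (cis (- (y \<bullet> \<xi>)) * complex_of_real (g y)) * E \<sigma> \<xi>"
    have "J \<sigma> = (\<integral>\<xi>. ?q * (\<integral>y. ?k y \<xi> \<partial>lborel) \<partial>lborel)"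
      unfolding J_def fourier_cis by (intro Bochner_Integration.integral_cong) simp_all
    also have "\<dots> = ?q * (\<integral>\<xi>. (\<integral>y. ?k y \<xi> \<partial>lborel) \<partial>lborel)"
      by (rule integral_mult_right_zero)
    also have "(\<integral>\<xi>. (\<integral>y. ?k y \<xi> \<partial>lborel) \<partial>lborel) =
       (\<integral>y. (\<integral>\<xi>. ?k y \<xi> \<partial>lborel) \<partial>lborel)"
      by (rule lborel_pair.Fubini_dominated(2)[where f="\<lambda>y. \<bar>g y\<bar>" and g="\<lambda>\<xi>. norm (E \<sigma> \<xi>)"])
        (use g intE[OF \<sigma>] in \<open>auto simp: norm_mult\<close>)
    also have "\<dots> = (\<integral>y. complex_of_real (g y) * (\<integral>\<xi>. cis ((x - y) \<bullet> \<xi>) * E \<sigma> \<xi> \<partial>lborel) \<partial>lborel)"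
      by (subst integral_mult_right_zero[symmetric])
        (auto simp: mult_ac inner_diff_left cis_mult[symmetric] cis_divide[symmetric] divide_inverse intro!: Bochner_Integration.integral_cong)
    also have "\<dots> = complex_of_real (\<integral>y. g y * (?p * (?p * gauss ((x - y) /\<^sub>R \<sigma>) / \<sigma> ^ DIM('a))) \<partial>lborel)"
      unfolding E_def gauss_scaled_transform[OF \<sigma>] by (simp flip: of_real_mult)
    also have "(\<integral>y. g y * (?p * (?p * gauss ((x - y) /\<^sub>R \<sigma>) / \<sigma> ^ DIM('a))) \<partial>lborel) =
       (\<integral>z. g (x - \<sigma> *\<^sub>R z) * (?p * (?p * gauss z)) \<partial>lborel)"
      using \<sigma> by (subst integral_lborel_affine[of _ "-\<sigma>" x])
        simp_all
    also have "\<dots> = (\<integral>z. ?p * (?p * (g (x - \<sigma> *\<^sub>R z) * gauss z)) \<partial>lborel)"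
      by (simp only: mult_ac)
    also have "\<dots> = ?p * (?p * (\<integral>z. g (x - \<sigma> *\<^sub>R z) * gauss z \<partial>lborel))"
      by (simp only: integral_mult_right_zero)
    finally have "J \<sigma> = complex_of_real ((?q * ?p) * (?p * (\<integral>z. g (x - \<sigma> *\<^sub>R z) * gauss z \<partial>lborel)))"
      by (simp only: of_real_mult mult.assoc)
    thus ?thesis by (simp only: pq mult_1)
  qed
  define s :: "nat \<Rightarrow> real" where "s k = 1 / Suc k" for k
  have s: "s k > 0" for k by (simp add: s_def)
  have s0: "s \<longlonglongrightarrow> 0" unfolding s_def[abs_def] by (rule LIMSEQ_Suc[OF lim_1_over_n])
  have lim1: "(\<lambda>k. J (s k)) \<longlonglongrightarrow> (\<integral>\<xi>. cis (x \<bullet> \<xi>) * fourier g \<xi> \<partial>lborel)"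
    unfolding J_def
  proof (rule integral_dominated_convergence[where w="\<lambda>\<xi>. norm (fourier g \<xi>)"])
    show "AE \<xi> in lborel. (\<lambda>k. cis (x \<bullet> \<xi>) * fourier g \<xi> * E (s k) \<xi>) \<longlonglongrightarrow> cis (x \<bullet> \<xi>) * fourier g \<xi>"
    proof (intro AE_I2)
      fix \<xi>
      have "(\<lambda>k. E (s k) \<xi>) \<longlonglongrightarrow> complex_of_real (exp (- (norm (0 *\<^sub>R \<xi>))\<^sup>2 / 2))"
        unfolding E_def by (intro tendsto_intros s0) simp
      hence "(\<lambda>k. cis (x \<bullet> \<xi>) * fourier g \<xi> * E (s k) \<xi>) \<longlonglongrightarrow> cis (x \<bullet> \<xi>) * fourier g \<xi> * 1"
        by (intro tendsto_mult tendsto_const) simp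
      thus "(\<lambda>k. cis (x \<bullet> \<xi>) * fourier g \<xi> * E (s k) \<xi>) \<longlonglongrightarrow> cis (x \<bullet> \<xi>) * fourier g \<xi>" by simp
    qed
  qed (use Fg E_le in \<open>auto simp: norm_mult mult_left_le\<close>)
  have lim2: "(\<lambda>k. \<integral>z. g (x - s k *\<^sub>R z) * gauss z \<partial>lborel) \<longlonglongrightarrow> (\<integral>z. g x * gauss (z::'a) \<partial>lborel)"
  proof (rule integral_dominated_convergence[where w="\<lambda>z::'a. B * gauss z"])
    show "AE z in lborel. (\<lambda>k. g (x - s k *\<^sub>R z) * gauss z) \<longlonglongrightarrow> g x * gauss z"
    proof (intro AE_I2 tendsto_intros)
      fix z
      have "(\<lambda>k. x - s k *\<^sub>R z) \<longlonglongrightarrow> x - 0 *\<^sub>R z" by (intro tendsto_intros s0)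
      hence "(\<lambda>k. g (x - s k *\<^sub>R z)) \<longlonglongrightarrow> g (x - 0 *\<^sub>R z)"
        using cont by (intro isCont_tendsto_compose[of _ g]) (auto simp: continuous_on_eq_continuous_at)
      thus "(\<lambda>k. g (x - s k *\<^sub>R z)) \<longlonglongrightarrow> g x" by simp
    qed
  qed (use integrable_gauss bdd in \<open>auto simp: abs_mult gauss_nonneg mult_right_mono\<close>)
  hence "(\<lambda>k. J (s k)) \<longlonglongrightarrow> complex_of_real (?p * g x)"
    unfolding J[OF s] by (intro tendsto_of_real tendsto_mult) (simp_all add: integral_gauss)
  from LIMSEQ_unique[OF this lim1]
  have "complex_of_real ?q * complex_of_real (?p * g x) = complex_of_real ?q * (\<integral>\<xi>. cis (x \<bullet> \<xi>) * fourier g \<xi> \<partial>lborel)"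
    by simp
  moreover have "?q * (?p * g x) = g x"
    by (simp only: pq mult_1 flip: mult.assoc)
  ultimately show ?thesis by (simp only: flip: of_real_mult)
qed

text \<open>Parseval's formula, from inserting the inversion formula for \<open>g\<close>. With \<open>h = g\<close> it becomes the
  Plancherel identity; with \<open>h = f0\<close> it gives the mean of \<open>g\<close> under the true density.\<close>

lemma integral_times_eq_fourier:
  fixes g h :: "'a::euclidean_space \<Rightarrow> real"
  assumes cont: "continuous_on UNIV g" and bdd: "\<And>x. \<bar>g x\<bar> \<le> B"
    and g: "integrable lborel g" and Fg: "integrable lborel (fourier g)"
    and h: "integrable lborel h"
  shows "complex_of_real (\<integral>x. g x * h x \<partial>lborel) = complex_of_real ((2 * pi) powr (- real DIM('a) / 2)) *
           (\<integral>\<xi>. fourier g \<xi> * (\<integral>x. cis (x \<bullet> \<xi>) * complex_of_real (h x) \<partial>lborel) \<partial>lborel)"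
proof -
  let ?q = "(2 * pi) powr (- real DIM('a) / 2)"
  have [measurable]: "g \<in> borel_measurable borel" "h \<in> borel_measurable borel" using g h by auto
  have "complex_of_real (\<integral>x. g x * h x \<partial>lborel) = (\<integral>x. complex_of_real (g x) * complex_of_real (h x) \<partial>lborel)"
    by (simp flip: of_real_mult)
  also have "\<dots> = (\<integral>x. ?q * (\<integral>\<xi>. cis (x \<bullet> \<xi>) * fourier g \<xi> * complex_of_real (h x) \<partial>lborel) \<partial>lborel)"
    unfolding fourier_inversion[OF cont bdd g Fg] integral_mult_left_zero by (simp only: mult.assoc)
  also have "\<dots> = ?q * (\<integral>x. (\<integral>\<xi>. cis (x \<bullet> \<xi>) * fourier g \<xi> * complex_of_real (h x) \<partial>lborel) \<partial>lborel)"
    by (rule integral_mult_right_zero)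
  also have "(\<integral>x. (\<integral>\<xi>. cis (x \<bullet> \<xi>) * fourier g \<xi> * complex_of_real (h x) \<partial>lborel) \<partial>lborel) =
     (\<integral>\<xi>. (\<integral>x. cis (x \<bullet> \<xi>) * fourier g \<xi> * complex_of_real (h x) \<partial>lborel) \<partial>lborel)"
    by (rule lborel_pair.Fubini_dominated(2)[where g="\<lambda>x. \<bar>h x\<bar>" and f="\<lambda>\<xi>. norm (fourier g \<xi>)"])
      (use h Fg in \<open>auto simp: norm_mult\<close>)
  also have "\<dots> = (\<integral>\<xi>. fourier g \<xi> * (\<integral>x. cis (x \<bullet> \<xi>) * complex_of_real (h x) \<partial>lborel) \<partial>lborel)"
    by (subst integral_mult_right_zero[symmetric]) (simp add: mult_ac)
  finally show ?thesis .
qed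

theorem plancherel:
  fixes g :: "'a::euclidean_space \<Rightarrow> real"
  assumes cont: "continuous_on UNIV g" and bdd: "\<And>x. \<bar>g x\<bar> \<le> B"
    and g: "integrable lborel g" and Fg: "integrable lborel (fourier g)"
  shows "(\<integral>x. (g x)\<^sup>2 \<partial>lborel) = (\<integral>\<xi>. (norm (fourier g \<xi>))\<^sup>2 \<partial>lborel)"
proof -
  let ?q = "(2 * pi) powr (- real DIM('a) / 2)"
  have "cnj (\<integral>x. cis (- (x \<bullet> \<xi>)) * complex_of_real (g x) \<partial>lborel) =
      (\<integral>x. cnj (cis (- (x \<bullet> \<xi>)) * complex_of_real (g x)) \<partial>lborel)" for \<xi>
    by (rule Bochner_Integration.integral_cnj[symmetric])
  hence "cnj (fourier g \<xi>) = complex_of_real ?q * (\<integral>x. cis (x \<bullet> \<xi>) * complex_of_real (g x) \<partial>lborel)" for \<xi>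
    unfolding fourier_cis by (simp add: cis_cnj)
  hence *: "complex_of_real ?q * (fourier g \<xi> * (\<integral>x. cis (x \<bullet> \<xi>) * complex_of_real (g x) \<partial>lborel)) =
      complex_of_real ((norm (fourier g \<xi>))\<^sup>2)" for \<xi>
    unfolding complex_norm_square by (simp only: mult.left_commute)
  have "complex_of_real (\<integral>x. (g x)\<^sup>2 \<partial>lborel) = complex_of_real (\<integral>x. g x * g x \<partial>lborel)"
    by (simp only: power2_eq_square)
  also have "\<dots> = complex_of_real ?q * (\<integral>\<xi>. fourier g \<xi> * (\<integral>x. cis (x \<bullet> \<xi>) * complex_of_real (g x) \<partial>lborel) \<partial>lborel)"
    by (rule integral_times_eq_fourier[OF cont bdd g Fg g])
  also have "\<dots> = (\<integral>\<xi>. complex_of_real ?q * (fourier g \<xi> * (\<integral>x. cis (x \<bullet> \<xi>) * complex_of_real (g x) \<partial>lborel)) \<partial>lborel)"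
    by (rule integral_mult_right_zero[symmetric])
  also have "\<dots> = (\<integral>\<xi>. complex_of_real ((norm (fourier g \<xi>))\<^sup>2) \<partial>lborel)"
    by (simp only: *)
  finally have "complex_of_real (\<integral>x. (g x)\<^sup>2 \<partial>lborel) = complex_of_real (\<integral>\<xi>. (norm (fourier g \<xi>))\<^sup>2 \<partial>lborel)"
    by (simp only: integral_complex_of_real)
  thus ?thesis by (simp only: of_real_eq_iff)
qed

lemma integrable_norm_fourier_sq:
  fixes g :: "'a::euclidean_space \<Rightarrow> real"
  assumes g: "integrable lborel g" and Fg: "integrable lborel (fourier g)"
  shows "integrable lborel (\<lambda>\<xi>. (norm (fourier g \<xi>))\<^sup>2)"
proof -
  let ?q = "(2 * pi) powr (- real DIM('a) / 2)"
  define K where "K = ?q * (\<integral>x. \<bar>g x\<bar> \<partial>lborel)"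
  have "norm (\<integral>x. cis (- (x \<bullet> \<xi>)) * complex_of_real (g x) \<partial>lborel) \<le> (\<integral>x. \<bar>g x\<bar> \<partial>lborel)" for \<xi>
    by (rule order_trans[OF integral_norm_bound]) (simp add: norm_mult)
  hence K: "norm (fourier g \<xi>) \<le> K" for \<xi>
    unfolding fourier_cis K_def by (simp add: norm_mult mult_left_mono)
  have [measurable]: "g \<in> borel_measurable borel" using g by auto
  show ?thesis
  proof (rule Bochner_Integration.integrable_bound)
    show "integrable lborel (\<lambda>\<xi>. K * norm (fourier g \<xi>))" using Fg by auto
    show "AE x in lborel. norm ((cmod (fourier g x))\<^sup>2) \<le> norm (K * cmod (fourier g x))"
    proof (intro AE_I2)
      fix \<xi>
      have "(cmod (fourier g \<xi>))\<^sup>2 \<le> K * cmod (fourier g \<xi>)"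
        unfolding power2_eq_square by (intro mult_right_mono K) simp
      thus "norm ((cmod (fourier g \<xi>))\<^sup>2) \<le> norm (K * cmod (fourier g \<xi>))" by simp
    qed
  qed measurable
qed

section \<open>Translations of square-integrable functions\<close>

definition translation_gap :: "('a::euclidean_space \<Rightarrow> real) \<Rightarrow> 'a \<Rightarrow> ennreal" where
  "translation_gap f y = (\<integral>\<^sup>+x. ennreal ((f (x - y) - f x)\<^sup>2) \<partial>lborel)"

lemma translation_gap_0 [simp]: "translation_gap f 0 = 0"
  by (simp add: translation_gap_def)

lemma borel_measurable_translation_gap [measurable]:
  assumes [measurable]: "f \<in> borel_measurable borel"
  shows "translation_gap f \<in> borel_measurable borel"
  unfolding translation_gap_def[abs_def] by measurable

lemma square_sum_le: "(a + b)\<^sup>2 \<le> 2 * a\<^sup>2 + 2 * (b::real)\<^sup>2"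
  using sum_squares_bound[of a b] by (simp add: power2_sum)

lemma translation_gap_add:
  fixes f :: "'a::euclidean_space \<Rightarrow> real"
  assumes [measurable]: "f \<in> borel_measurable borel"
  shows "translation_gap f (y + z) \<le> 2 * translation_gap f y + 2 * translation_gap f z"
proof -
  have "translation_gap f (y + z) \<le>
    (\<integral>\<^sup>+x. 2 * ennreal ((f (x - z - y) - f (x - z))\<^sup>2) + 2 * ennreal ((f (x - z) - f x)\<^sup>2) \<partial>lborel)"
    unfolding translation_gap_def
  proof (intro nn_integral_mono)
    fix x :: 'a
    have "(f (x - (y + z)) - f x)\<^sup>2 \<le> 2 * (f (x - z - y) - f (x - z))\<^sup>2 + 2 * (f (x - z) - f x)\<^sup>2"
      using square_sum_le[of "f (x - z - y) - f (x - z)" "f (x - z) - f x"] by (simp add: algebra_simps)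
    hence "ennreal ((f (x - (y + z)) - f x)\<^sup>2) \<le> ennreal (2 * (f (x - z - y) - f (x - z))\<^sup>2 + 2 * (f (x - z) - f x)\<^sup>2)"
      by (rule ennreal_leI)
    thus "ennreal ((f (x - (y + z)) - f x)\<^sup>2) \<le>
       2 * ennreal ((f (x - z - y) - f (x - z))\<^sup>2) + 2 * ennreal ((f (x - z) - f x)\<^sup>2)"
      by (simp add: ennreal_plus ennreal_mult)
  qed
  also have "\<dots> = 2 * (\<integral>\<^sup>+x. ennreal ((f (- z + x - y) - f (- z + x))\<^sup>2) \<partial>lborel) + 2 * translation_gap f z"
    by (simp add: nn_integral_add nn_integral_cmult translation_gap_def)
  also have "(\<integral>\<^sup>+x. ennreal ((f (- z + x - y) - f (- z + x))\<^sup>2) \<partial>lborel) = translation_gap f y"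
    unfolding translation_gap_def
    by (rule nn_integral_lborel_translate[of "\<lambda>x. ennreal ((f (x - y) - f x)\<^sup>2)" "- z"]) measurable
  finally show ?thesis .
qed

text \<open>Substituting \<open>y = x - z\<close> shows that the Gagliardo seminorm is a weighted integral of the
  translation gap.\<close>

lemma gagliardo_eq_translation_gap:
  fixes f :: "'a::euclidean_space \<Rightarrow> real"
  assumes [measurable]: "f \<in> borel_measurable borel"
  shows "(\<integral>\<^sup>+x. (\<integral>\<^sup>+y. ennreal (\<bar>f x - f y\<bar>\<^sup>2 * norm (x - y) powr a) \<partial>lborel) \<partial>lborel) =
    (\<integral>\<^sup>+z. translation_gap f z * ennreal (norm z powr a) \<partial>lborel)"
proof -
  have "(\<integral>\<^sup>+y. ennreal (\<bar>f x - f y\<bar>\<^sup>2 * norm (x - y) powr a) \<partial>lborel) =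
        (\<integral>\<^sup>+z. ennreal ((f (x - z) - f x)\<^sup>2) * ennreal (norm z powr a) \<partial>lborel)" for x
    by (subst nn_integral_lborel_reflect[of _ x, symmetric])
      (auto simp: ennreal_mult power2_commute)
  hence "(\<integral>\<^sup>+x. (\<integral>\<^sup>+y. ennreal (\<bar>f x - f y\<bar>\<^sup>2 * norm (x - y) powr a) \<partial>lborel) \<partial>lborel) =
        (\<integral>\<^sup>+x. (\<integral>\<^sup>+z. ennreal ((f (x - z) - f x)\<^sup>2) * ennreal (norm z powr a) \<partial>lborel) \<partial>lborel)" by simp
  also have "\<dots> = (\<integral>\<^sup>+z. (\<integral>\<^sup>+x. ennreal ((f (x - z) - f x)\<^sup>2) * ennreal (norm z powr a) \<partial>lborel) \<partial>lborel)"
    by (rule lborel_pair.Fubini') measurable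
  finally show ?thesis by (simp add: translation_gap_def nn_integral_multc)
qed

text \<open>The gap is subadditive up to the factor 2, so for \<open>|z| \<le> |y| = r\<close> the gap at \<open>y\<close> is at most twice
  the sum of the gaps at \<open>z\<close> and \<open>y - z\<close>, both of which lie in the ball of radius \<open>2 r\<close>. Averaging over
  \<open>z\<close> bounds \<open>r ^ d\<close> times the gap at \<open>y\<close>, up to a constant, by its integral over that ball, where the Gagliardo weight is at
  least \<open>(2 r) powr (- d - 2 s)\<close>.\<close>

lemma translation_gap_gagliardo:
  fixes f :: "'a::euclidean_space \<Rightarrow> real"
  assumes [measurable]: "f \<in> borel_measurable borel" and s: "0 < s"
    and fin: "(\<integral>\<^sup>+x. (\<integral>\<^sup>+y. ennreal (\<bar>f x - f y\<bar>\<^sup>2 * norm (x - y) powr (- real DIM('a) - 2 * s)) \<partial>lborel) \<partial>lborel) < \<infinity>"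
  shows "\<exists>L\<ge>0. \<forall>y. translation_gap f y \<le> ennreal (L * norm y powr (2 * s))"
proof -
  let ?a = "- real DIM('a) - 2 * s"
  define G where "G = (\<integral>\<^sup>+z. translation_gap f z * ennreal (norm z powr ?a) \<partial>lborel)"
  have "G < \<infinity>" using fin unfolding G_def gagliardo_eq_translation_gap[OF assms(1)] .
  then obtain g where g: "g \<ge> 0" "G = ennreal g" by (cases G) auto
  define \<kappa> where "\<kappa> = unit_ball_vol (real DIM('a))"
  have \<kappa>: "\<kappa> > 0" by (simp add: \<kappa>_def)
  have near: "(\<integral>\<^sup>+z. translation_gap f z * indicator (cball 0 R) z \<partial>lborel) \<le> ennreal (R powr (real DIM('a) + 2 * s)) * G"
    if R: "R > 0" for R :: real
    unfolding G_def
  proof (subst nn_integral_cmult[symmetric], measurable, intro nn_integral_mono)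
    fix z :: 'a
    show "translation_gap f z * indicator (cball 0 R) z \<le>
      ennreal (R powr (real DIM('a) + 2 * s)) * (translation_gap f z * ennreal (norm z powr ?a))"
    proof (cases "z = 0 \<or> norm z > R")
      case True thus ?thesis by (auto simp: indicator_def)
    next
      case False
      have "1 \<le> (R / norm z) powr (real DIM('a) + 2 * s)"
        using False s by (intro ge_one_powr_ge_zero) (auto simp: divide_simps)
      also have "\<dots> = R powr (real DIM('a) + 2 * s) * norm z powr ?a"
        using False R by (simp add: powr_divide powr_minus_divide powr_diff powr_add)
      finally have "ennreal 1 \<le> ennreal (R powr (real DIM('a) + 2 * s) * norm z powr ?a)" by (rule ennreal_leI)
      hence "translation_gap f z * 1 \<le> translation_gap f z * (ennreal (R powr (real DIM('a) + 2 * s)) * ennreal (norm z powr ?a))"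
        by (intro mult_left_mono) (auto simp: ennreal_mult)
      thus ?thesis using False by (simp add: mult_ac)
    qed
  qed
  define L where "L = 4 * 2 powr (real DIM('a) + 2 * s) * g / \<kappa>"
  have "translation_gap f y \<le> ennreal (L * norm y powr (2 * s))" for y
  proof (cases "y = 0")
    case False
    define r where "r = norm y"
    have r: "r > 0" using False by (simp add: r_def)
    have [measurable]: "cball (0::'a) (2 * r) \<in> sets borel" by (simp add: borel_closed)
    have vol: "emeasure lborel (cball (0::'a) r) = ennreal (\<kappa> * r ^ DIM('a))"
      using r by (simp add: emeasure_cball \<kappa>_def)
    have "translation_gap f y * ennreal (\<kappa> * r ^ DIM('a)) = (\<integral>\<^sup>+z. translation_gap f y * indicator (cball 0 r) (z::'a) \<partial>lborel)"
      by (simp add: nn_integral_cmult_indicator vol)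
    also have "\<dots> \<le> (\<integral>\<^sup>+z. 2 * (translation_gap f z * indicator (cball 0 (2 * r)) z) +
                 2 * (translation_gap f (y - z) * indicator (cball 0 (2 * r)) (y - z)) \<partial>lborel)"
    proof (intro nn_integral_mono)
      fix z :: 'a
      have "translation_gap f y \<le> 2 * translation_gap f z + 2 * translation_gap f (y - z)"
        using translation_gap_add[of f z "y - z"] by simp
      moreover have "norm (y - z) \<le> 2 * r" if "norm z \<le> r"
        using norm_triangle_ineq4[of y z] that r_def by simp
      ultimately show "translation_gap f y * indicator (cball 0 r) z \<le> 2 * (translation_gap f z * indicator (cball 0 (2 * r)) z) +
                 2 * (translation_gap f (y - z) * indicator (cball 0 (2 * r)) (y - z))"
        using r by (auto simp: indicator_def)
    qed
    also have "\<dots> = 2 * (\<integral>\<^sup>+z. translation_gap f z * indicator (cball 0 (2 * r)) z \<partial>lborel) +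
               2 * (\<integral>\<^sup>+z. translation_gap f (y - z) * indicator (cball 0 (2 * r)) (y - z) \<partial>lborel)"
    proof -
      have [measurable]: "(\<lambda>z. translation_gap f z * indicator (cball 0 (2 * r)) z) \<in> borel_measurable borel"
        by measurable
      have [measurable]: "(\<lambda>z. translation_gap f (y - z) * indicator (cball 0 (2 * r)) (y - z)) \<in> borel_measurable borel"
        by (rule measurable_compose[where g="\<lambda>z. translation_gap f z * indicator (cball 0 (2 * r)) z"]) measurable
      show ?thesis
        by (subst nn_integral_add) (auto simp: nn_integral_cmult)
    qed
    also have "(\<integral>\<^sup>+z. translation_gap f (y - z) * indicator (cball 0 (2 * r)) (y - z) \<partial>lborel) =
               (\<integral>\<^sup>+z. translation_gap f z * indicator (cball 0 (2 * r)) z \<partial>lborel)"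
      by (rule nn_integral_lborel_reflect[of "\<lambda>z. translation_gap f z * indicator (cball 0 (2 * r)) z"]) measurable
    also have "2 * (\<integral>\<^sup>+z. translation_gap f z * indicator (cball 0 (2 * r)) z \<partial>lborel) +
       2 * (\<integral>\<^sup>+z. translation_gap f z * indicator (cball 0 (2 * r)) z \<partial>lborel) =
       4 * (\<integral>\<^sup>+z. translation_gap f z * indicator (cball 0 (2 * r)) z \<partial>lborel)"
      by (simp flip: distrib_right)
    also have "\<dots> \<le> 4 * (ennreal ((2 * r) powr (real DIM('a) + 2 * s)) * G)"
      using r by (intro mult_left_mono near) auto
    also have "\<dots> = ennreal (4 * ((2 * r) powr (real DIM('a) + 2 * s) * g))"
      using g by (simp add: ennreal_mult)
    also have "4 * ((2 * r) powr (real DIM('a) + 2 * s) * g) = L * r powr (2 * s) * (\<kappa> * r ^ DIM('a))"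
      using r \<kappa> by (simp add: L_def powr_mult powr_add powr_realpow)
    finally have *: "translation_gap f y * ennreal (\<kappa> * r ^ DIM('a)) \<le> ennreal (L * r powr (2 * s) * (\<kappa> * r ^ DIM('a)))" .
    have pos: "\<kappa> * r ^ DIM('a) > 0" using r \<kappa> by simp
    have "translation_gap f y = translation_gap f y * ennreal (\<kappa> * r ^ DIM('a)) * ennreal (1 / (\<kappa> * r ^ DIM('a)))"
      using r \<kappa> by (simp add: mult.assoc flip: ennreal_mult)
    also have "\<dots> \<le> ennreal (L * r powr (2 * s) * (\<kappa> * r ^ DIM('a))) * ennreal (1 / (\<kappa> * r ^ DIM('a)))"
      by (intro mult_right_mono *) auto
    also have "\<dots> = ennreal (L * r powr (2 * s))"
      using r pos g \<kappa> by (subst ennreal_mult[symmetric]) (auto simp: L_def)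
    finally show ?thesis by (simp add: r_def)
  qed simp
  moreover have "L \<ge> 0" using g \<kappa> by (simp add: L_def)
  ultimately show ?thesis by blast
qed

section \<open>Test functions\<close>

subsection \<open>Closure properties of smooth functions\<close>

lemma frechet_derivative_eq:
  "(f has_derivative f') (at x) \<Longrightarrow> frechet_derivative f (at x) = f'"
  by (rule frechet_derivative_at[symmetric])

lemma Ck_fun_Suc_imp: "Ck_fun (Suc k) f \<Longrightarrow> Ck_fun k f"
proof (induction k arbitrary: f)
  case 0
  thus ?case by (auto simp: continuous_on_eq_continuous_at intro: differentiable_imp_continuous_within)
next
  case (Suc k)
  thus ?case by (metis Ck_fun.simps(2))
qed

lemma Ck_fun_const: "Ck_fun k (\<lambda>_. c)"
  by (induction k arbitrary: c) auto

lemma Ck_fun_add: "Ck_fun k f \<Longrightarrow> Ck_fun k g \<Longrightarrow> Ck_fun k (\<lambda>x. f x + g x)"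
proof (induction k arbitrary: f g)
  case 0 thus ?case by (auto intro: continuous_intros)
next
  case (Suc k)
  have d: "((\<lambda>x. f x + g x) has_derivative (\<lambda>h. frechet_derivative f (at x) h + frechet_derivative g (at x) h)) (at x)" for x
    using Suc.prems by (intro has_derivative_add) (auto simp: frechet_derivative_works)
  thus ?case using Suc by (auto simp: differentiable_def frechet_derivative_eq[OF d])
qed

lemma Ck_fun_mult: "Ck_fun k f \<Longrightarrow> Ck_fun k g \<Longrightarrow> Ck_fun k (\<lambda>x. f x * g x)"
proof (induction k arbitrary: f g)
  case 0 thus ?case by (auto intro: continuous_intros)
next
  case (Suc k)
  have d: "((\<lambda>x. f x * g x) has_derivative (\<lambda>h. f x * frechet_derivative g (at x) h + frechet_derivative f (at x) h * g x)) (at x)" for x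
    using Suc.prems by (intro has_derivative_mult) (auto simp: frechet_derivative_works)
  have "Ck_fun k f" "Ck_fun k g" using Suc.prems by (auto intro: Ck_fun_Suc_imp)
  thus ?case using Suc.prems d
    by (auto simp: differentiable_def frechet_derivative_eq[OF d] intro!: Ck_fun_add Suc.IH)
qed

lemma Ck_fun_prod: "finite A \<Longrightarrow> (\<And>a. a \<in> A \<Longrightarrow> Ck_fun k (f a)) \<Longrightarrow> Ck_fun k (\<lambda>x. \<Prod>a\<in>A. f a x)"
  by (induction rule: finite_induct) (auto intro: Ck_fun_const Ck_fun_mult)

lemma frechet_derivative_translate:
  assumes "\<And>x. f differentiable (at x)"
  shows "((\<lambda>x. f (x - y)) has_derivative frechet_derivative f (at (x - y))) (at x)"
proof -
  have "((\<lambda>x. x - y) has_derivative (\<lambda>h. h)) (at x)"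
    by (auto intro!: derivative_eq_intros)
  from has_derivative_compose[OF this, of f "frechet_derivative f (at (x - y))"] assms
  show ?thesis by (simp add: frechet_derivative_works)
qed

lemma Ck_fun_translate: "Ck_fun k f \<Longrightarrow> Ck_fun k (\<lambda>x. f (x - y))"
proof (induction k arbitrary: f)
  case 0 thus ?case by (auto intro!: continuous_intros continuous_on_compose2[of UNIV f])
next
  case (Suc k)
  hence d: "((\<lambda>x. f (x - y)) has_derivative frechet_derivative f (at (x - y))) (at x)" for x
    by (intro frechet_derivative_translate) auto
  show ?case using Suc.prems Suc.IH[of "\<lambda>x. frechet_derivative f (at x) b" for b] d
    by (auto simp: differentiable_def frechet_derivative_eq[OF d])
qed

subsection \<open>A smooth approximation of the indicator of a box\<close>

text \<open>The case \<open>P = 1\<close> is the classical smooth function that is flat at 0. Admitting a polynomial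
  factor in \<open>1 / t\<close> makes the family closed under differentiation. For \<open>P = 1\<close> the functions
  increase to the indicator of \<open>t > 0\<close> as \<open>e \<rightarrow> 0\<close>.\<close>

definition flat_exp :: "real poly \<Rightarrow> real \<Rightarrow> real \<Rightarrow> real" where
  "flat_exp P e t = (if t > 0 then poly P (1 / t) * exp (- e / t) else 0)"

lemma poly_times_exp_tendsto_0:
  fixes e :: real
  assumes e: "e > 0"
  shows "((\<lambda>u. poly P u * exp (- e * u)) \<longlongrightarrow> 0) at_top"
proof -
  have "((\<lambda>u. (\<Sum>i\<le>degree P. coeff P i * (u ^ i * exp (- e * u)))) \<longlongrightarrow> (\<Sum>i\<le>degree P. coeff P i * 0)) at_top"
  proof (intro tendsto_sum tendsto_mult tendsto_const)
    show "((\<lambda>u::real. u ^ i * exp (- e * u)) \<longlongrightarrow> 0) at_top" for i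
      using e by real_asymp
  qed
  thus ?thesis by (simp add: poly_altdef sum_distrib_right mult.assoc)
qed

lemma flat_exp_deriv:
  assumes e: "e > 0"
  shows "(flat_exp P e has_real_derivative flat_exp ([:0, 0, 1:] * (smult e P - pderiv P)) e t) (at t)"
proof -
  consider "t > 0" | "t < 0" | "t = 0" by linarith
  thus ?thesis
  proof cases
    case 1
    have "((\<lambda>t. poly P (1 / t) * exp (- e / t)) has_real_derivative
       flat_exp ([:0, 0, 1:] * (smult e P - pderiv P)) e t) (at t)"
      using 1 by (auto intro!: derivative_eq_intros DERIV_chain2[OF poly_DERIV] simp: flat_exp_def field_simps power2_eq_square)
    thus ?thesis
      by (rule has_field_derivative_transform_within_open[of _ _ _ "{0<..}"])
        (use 1 in \<open>auto simp: flat_exp_def\<close>)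
  next
    case 2
    have "((\<lambda>_. 0) has_real_derivative 0) (at t)" by simp
    hence "(flat_exp P e has_real_derivative 0) (at t)"
      by (rule has_field_derivative_transform_within_open[of _ _ _ "{..<0}"])
        (use 2 in \<open>auto simp: flat_exp_def\<close>)
    thus ?thesis using 2 by (simp add: flat_exp_def)
  next
    case 3
    have "((\<lambda>h. flat_exp P e h / h) \<longlongrightarrow> 0) (at 0)"
      unfolding filterlim_at_split
    proof
      show "((\<lambda>h. flat_exp P e h / h) \<longlongrightarrow> 0) (at_left 0)"
        by (rule tendsto_eventually) (auto simp: eventually_at_filter flat_exp_def)
      have "((\<lambda>u. poly (pCons 0 P) u * exp (- e * u)) \<longlongrightarrow> 0) at_top"
        by (rule poly_times_exp_tendsto_0[OF e])
      hence "((\<lambda>h. poly (pCons 0 P) (inverse h) * exp (- e * inverse h)) \<longlongrightarrow> 0) (at_right 0)"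
        by (rule filterlim_compose[OF _ filterlim_inverse_at_top_right])
      thus "((\<lambda>h. flat_exp P e h / h) \<longlongrightarrow> 0) (at_right 0)"
        by (rule tendsto_cong[THEN iffD1, rotated])
          (auto simp: eventually_at_filter flat_exp_def field_simps)
    qed
    thus ?thesis using 3 by (simp add: DERIV_def flat_exp_def)
  qed
qed

lemma Ck_fun_flat_exp:
  fixes v :: "'a::euclidean_space"
  assumes e: "e > 0"
  shows "Ck_fun k (\<lambda>x. flat_exp P e (v \<bullet> x + a))"
proof (induction k arbitrary: P)
  have d: "((\<lambda>x. flat_exp P e (v \<bullet> x + a)) has_derivative
      (\<lambda>h. (v \<bullet> h) * flat_exp ([:0, 0, 1:] * (smult e P - pderiv P)) e (v \<bullet> x + a))) (at x)" for P x
    by (rule has_derivative_eq_rhs[OF has_derivative_compose[OF _ flat_exp_deriv[OF e, unfolded has_field_derivative_def]]])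
      (auto intro!: derivative_eq_intros)
  {
    case 0
    have "continuous (at x) (\<lambda>x. flat_exp P e (v \<bullet> x + a))" for x
      using d has_derivative_continuous by blast
    thus ?case by (simp add: continuous_on_eq_continuous_at)
  next
    case (Suc k)
    have scale: "c * flat_exp P e t = flat_exp (smult c P) e t" for c P t
      by (simp add: flat_exp_def)
    have "(\<lambda>x. flat_exp P e (v \<bullet> x + a)) differentiable (at x)" for x
      using d differentiable_def by blast
    thus ?case
      unfolding Ck_fun.simps frechet_derivative_eq[OF d] scale using Suc.IH by blast
  }
qed

definition box_bump :: "'a::euclidean_space \<Rightarrow> 'a \<Rightarrow> real \<Rightarrow> 'a \<Rightarrow> real" where
  "box_bump l u e x = (\<Prod>b\<in>Basis. flat_exp 1 e (b \<bullet> x + - (l \<bullet> b)) * flat_exp 1 e ((- b) \<bullet> x + u \<bullet> b))"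

lemma box_bump_eq:
  "box_bump l u e x = indicator (box l u) x * (\<Prod>b\<in>Basis. exp (- e / (x \<bullet> b - l \<bullet> b)) * exp (- e / (u \<bullet> b - x \<bullet> b)))"
proof (cases "x \<in> box l u")
  case True
  thus ?thesis
    by (auto simp: box_bump_def flat_exp_def mem_box inner_commute intro!: prod.cong)
next
  case False
  then obtain b where "b \<in> Basis" "x \<bullet> b \<le> l \<bullet> b \<or> u \<bullet> b \<le> x \<bullet> b"
    by (auto simp: mem_box not_less)
  thus ?thesis using False
    by (auto simp: box_bump_def flat_exp_def inner_commute intro!: bexI[of _ b])
qed

lemma test_fun_box_bump:
  assumes "e > 0"
  shows "test_fun (box_bump l u e)"
proof -
  have "{x. box_bump l u e x \<noteq> 0} \<subseteq> cbox l u"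
    using box_subset_cbox by (auto simp: box_bump_eq indicator_def split: if_splits)
  hence "compact (closure {x. box_bump l u e x \<noteq> 0})"
    by (metis bounded_cbox bounded_subset compact_closure)
  thus ?thesis unfolding test_fun_def box_bump_def[abs_def]
    by (intro conjI allI Ck_fun_prod Ck_fun_mult Ck_fun_flat_exp assms finite_Basis)
qed

lemma box_bump_bounds: 
  assumes "e > 0"
  shows "0 \<le> box_bump l u e x" "box_bump l u e x \<le> indicator (box l u) x"
proof -
  show "0 \<le> box_bump l u e x" by (simp add: box_bump_eq prod_nonneg)
  show "box_bump l u e x \<le> indicator (box l u) x"
    using assms by (auto simp: box_bump_eq indicator_def mem_box intro!: prod_le_1 mult_le_one)
qed

lemma box_bump_tendsto:
  fixes l u x :: "'a::euclidean_space"
  shows "(\<lambda>n. box_bump l u (1 / Suc n) x) \<longlonglongrightarrow> indicator (box l u) x"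
proof -
  have lim: "(\<lambda>n. - (1 / real (Suc n)) / c) \<longlonglongrightarrow> 0" for c
    using tendsto_mult[OF tendsto_minus[OF LIMSEQ_Suc[OF lim_1_over_n]] tendsto_const[of "inverse c"]]
    by (simp add: divide_inverse)
  have "(\<lambda>n. indicator (box l u) x * (\<Prod>b\<in>Basis. exp (- (1 / real (Suc n)) / (x \<bullet> b - l \<bullet> b)) * exp (- (1 / real (Suc n)) / (u \<bullet> b - x \<bullet> b))))
     \<longlonglongrightarrow> indicator (box l u) x * (\<Prod>b\<in>(Basis::'a set). exp (0::real) * exp 0)"
    by (intro tendsto_mult tendsto_const tendsto_prod tendsto_exp lim)
  thus ?thesis unfolding box_bump_eq by simp
qed

lemma borel_measurable_test_fun:
  "test_fun \<psi> \<Longrightarrow> \<psi> \<in> borel_measurable borel"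
  by (metis Ck_fun.simps(1) borel_measurable_continuous_onI test_fun_def)

lemma continuous_vanishing_outside_compact_bounded:
  fixes h :: "'a::euclidean_space \<Rightarrow> real"
  assumes "continuous_on UNIV h" "compact K" "\<And>x. x \<notin> K \<Longrightarrow> h x = 0"
  obtains B where "B \<ge> 0" "\<And>x. \<bar>h x\<bar> \<le> B * indicator K x"
proof -
  have "compact (h ` K)" using assms by (intro compact_continuous_image continuous_on_subset[OF assms(1)]) auto
  then obtain B where "\<And>x. x \<in> K \<Longrightarrow> \<bar>h x\<bar> \<le> B"
    by (metis bounded_iff compact_imp_bounded imageI real_norm_def)
  hence "\<bar>h x\<bar> \<le> max B 0 * indicator K x" for x
    using assms(3) by (cases "x \<in> K") (fastforce simp: indicator_def)+
  thus ?thesis using that[of "max B 0"] by simp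
qed

lemma test_fun_bounded:
  assumes "test_fun \<psi>" and b: "b \<in> Basis"
  obtains B K where "B \<ge> 0" "compact K" "\<And>x. \<bar>\<psi> x\<bar> \<le> B * indicator K x"
    "\<And>x. \<bar>frechet_derivative \<psi> (at x) b\<bar> \<le> B"
    "continuous_on UNIV (\<lambda>x. frechet_derivative \<psi> (at x) b)"
proof -
  define K where "K = closure {x. \<psi> x \<noteq> 0}"
  have K: "compact K" using assms by (simp add: test_fun_def K_def)
  have C: "Ck_fun 0 \<psi>" "Ck_fun (Suc 0) \<psi>" using assms(1) by (auto simp: test_fun_def)
  have cont: "continuous_on UNIV \<psi>" "continuous_on UNIV (\<lambda>x. frechet_derivative \<psi> (at x) b)"
    using C b by auto
  have out: "\<psi> x = 0" if "x \<notin> K" for x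
    using that closure_subset[of "{x. \<psi> x \<noteq> 0}"] by (auto simp: K_def)
  have "frechet_derivative \<psi> (at x) b = 0" if x: "x \<notin> K" for x
  proof -
    have "((\<lambda>_. 0) has_derivative (\<lambda>_. 0)) (at x)" by simp
    hence "(\<psi> has_derivative (\<lambda>_. 0)) (at x)"
      by (rule has_derivative_transform_within_open[of _ _ _ _ "- K"])
        (use x out compact_imp_closed[OF K] in \<open>auto simp: open_Compl\<close>)
    thus ?thesis by (simp add: frechet_derivative_eq)
  qed
  then obtain B2 where B2: "B2 \<ge> 0" "\<And>x. \<bar>frechet_derivative \<psi> (at x) b\<bar> \<le> B2 * indicator K x"
    using continuous_vanishing_outside_compact_bounded[OF cont(2) K] by blast
  obtain B1 where B1: "B1 \<ge> 0" "\<And>x. \<bar>\<psi> x\<bar> \<le> B1 * indicator K x"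
    using continuous_vanishing_outside_compact_bounded[OF cont(1) K out] by blast
  show ?thesis
  proof (rule that[of "max B1 B2" K])
    show "\<bar>\<psi> x\<bar> \<le> max B1 B2 * indicator K x" for x
      by (rule order_trans[OF B1(2)]) (auto intro: mult_right_mono)
    show "\<bar>frechet_derivative \<psi> (at x) b\<bar> \<le> max B1 B2" for x
      by (rule order_trans[OF B2(2)]) (use B2(1) in \<open>auto simp: indicator_def\<close>)
  qed (use B1 K cont in auto)
qed

subsection \<open>Test functions determine square-integrable functions\<close>

lemma integrable_mult_of_sq:
  fixes f g :: "'a \<Rightarrow> real"
  assumes [measurable]: "f \<in> borel_measurable M" "g \<in> borel_measurable M"
    and "integrable M (\<lambda>x. (f x)\<^sup>2)" "integrable M (\<lambda>x. (g x)\<^sup>2)"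
  shows "integrable M (\<lambda>x. f x * g x)"
proof (rule Bochner_Integration.integrable_bound)
  show "integrable M (\<lambda>x. (f x)\<^sup>2 + (g x)\<^sup>2)" using assms by auto
  have "norm (f x * g x) \<le> norm ((f x)\<^sup>2 + (g x)\<^sup>2)" for x
  proof -
    have "2 * (\<bar>f x\<bar> * \<bar>g x\<bar>) \<le> (f x)\<^sup>2 + (g x)\<^sup>2"
      using sum_squares_bound[of "\<bar>f x\<bar>" "\<bar>g x\<bar>"] by simp
    moreover have "0 \<le> \<bar>f x\<bar> * \<bar>g x\<bar>" by simp
    ultimately show ?thesis unfolding real_norm_def abs_mult by linarith
  qed
  thus "AE x in M. norm (f x * g x) \<le> norm ((f x)\<^sup>2 + (g x)\<^sup>2)" by simp
qed measurable

text \<open>The positive and the negative part of \<open>v\<close> are densities of two measures that agree on boxes.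
  Boxes form an intersection-stable generator of the Borel sets, so the measures are equal and the
  two parts agree almost everywhere.\<close>

lemma AE_0_if_box_integrals_0:
  fixes v :: "'a::euclidean_space \<Rightarrow> real"
  assumes [measurable]: "v \<in> borel_measurable borel"
    and int: "\<And>l u. integrable lborel (\<lambda>x. v x * indicator (box l u) x)"
    and zero: "\<And>l u. (\<integral>x. v x * indicator (box l u) x \<partial>lborel) = 0"
  shows "AE x in lborel. v x = 0"
proof -
  have box_eq: "(\<integral>\<^sup>+x. ennreal (v x) * indicator (box l u) x \<partial>lborel) =
      (\<integral>\<^sup>+x. ennreal (- v x) * indicator (box l u) x \<partial>lborel)" (is "?P = ?N")
    and box_fin: "(\<integral>\<^sup>+x. ennreal (v x) * indicator (box l u) x \<partial>lborel) \<noteq> \<infinity>" for l u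
  proof -
    have P: "?P = (\<integral>\<^sup>+x. ennreal (v x * indicator (box l u) x) \<partial>lborel)"
      by (intro nn_integral_cong) (auto simp: indicator_def)
    have N: "?N = (\<integral>\<^sup>+x. ennreal (- (v x * indicator (box l u) x)) \<partial>lborel)"
      by (intro nn_integral_cong) (auto simp: indicator_def)
    have fin: "?P \<noteq> \<infinity>" "?N \<noteq> \<infinity>"
      unfolding P N using int[of l u] by (auto simp: real_integrable_def)
    have "enn2real ?P = enn2real ?N"
      using real_lebesgue_integral_def[OF int[of l u]] zero[of l u] unfolding P N by simp
    hence "ennreal (enn2real ?P) = ennreal (enn2real ?N)" by (rule arg_cong)
    moreover have "?P < top" "?N < top" using fin by (simp_all add: less_top)
    ultimately show "?P = ?N" by (simp only: ennreal_enn2real)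
    show "?P \<noteq> \<infinity>" by (rule fin(1))
  qed
  have "density lborel (\<lambda>x. ennreal (v x)) = density lborel (\<lambda>x. ennreal (- v x))"
  proof (rule measure_eqI_generator_eq)
    let ?E = "range (\<lambda>(a, b). box a b::'a set)"
    show "Int_stable ?E"
      by (auto simp: Int_stable_def box_Int_box)
    show "?E \<subseteq> Pow UNIV" "sets (density lborel (\<lambda>x. ennreal (v x))) = sigma_sets UNIV ?E"
      "sets (density lborel (\<lambda>x. ennreal (- v x))) = sigma_sets UNIV ?E"
      by (simp_all add: borel_eq_box)
    let ?A = "\<lambda>n::nat. box (- (real n *\<^sub>R One)) (real n *\<^sub>R One) :: 'a set"
    show "range ?A \<subseteq> ?E" "(\<Union>i. ?A i) = UNIV"
      unfolding UN_box_eq_UNIV by auto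
    show "emeasure (density lborel (\<lambda>x. ennreal (v x))) (?A i) \<noteq> \<infinity>" for i
      by (simp add: emeasure_density box_fin del: infinity_ennreal_def)
    show "emeasure (density lborel (\<lambda>x. ennreal (v x))) X = emeasure (density lborel (\<lambda>x. ennreal (- v x))) X"
      if "X \<in> ?E" for X
      using that by (auto simp: emeasure_density box_eq)
  qed
  hence "AE x in lborel. ennreal (v x) = ennreal (- v x)"
    by (intro sigma_finite_measure.density_unique[OF lborel.sigma_finite_measure_axioms]) measurable
  thus ?thesis
  proof eventually_elim
    case (elim x)
    thus ?case by (cases "v x \<ge> 0") (auto simp: ennreal_neg ennreal_eq_0_iff not_le)
  qed
qed

text \<open>The smooth bumps converge boundedly to the indicators of boxes.\<close>

lemma AE_0_if_test_integrals_0: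
  fixes v :: "'a::euclidean_space \<Rightarrow> real"
  assumes v: "L2_fun v" and zero: "\<And>\<psi>. test_fun \<psi> \<Longrightarrow> (\<integral>x. v x * \<psi> x \<partial>lborel) = 0"
  shows "AE x in lborel. v x = 0"
proof (rule AE_0_if_box_integrals_0)
  show [measurable]: "v \<in> borel_measurable borel" using v by (simp add: L2_fun_def)
  fix l u :: 'a
  show int: "integrable lborel (\<lambda>x. v x * indicator (box l u) x)"
  proof (intro integrable_mult_of_sq)
    have "integrable lborel (indicator (box l u) :: 'a \<Rightarrow> real)"
      by (intro integrable_real_indicator emeasure_bounded_finite) auto
    moreover have "(\<lambda>x. (indicator (box l u) x)\<^sup>2) = (indicator (box l u) :: 'a \<Rightarrow> real)"
      by (auto simp: indicator_def)
    ultimately show "integrable lborel (\<lambda>x. (indicator (box l u) x :: real)\<^sup>2)" by simp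
  qed (use v in \<open>auto simp: L2_fun_def\<close>)
  have [measurable]: "box_bump l u (1 / Suc n) \<in> borel_measurable borel" for n
    by (intro borel_measurable_test_fun test_fun_box_bump) simp
  have "(\<lambda>n. \<integral>x. v x * box_bump l u (1 / Suc n) x \<partial>lborel) \<longlonglongrightarrow> (\<integral>x. v x * indicator (box l u) x \<partial>lborel)"
  proof (rule integral_dominated_convergence[where w="\<lambda>x. \<bar>v x * indicator (box l u) x\<bar>"])
    show "AE x in lborel. (\<lambda>n. v x * box_bump l u (1 / Suc n) x) \<longlonglongrightarrow> v x * indicator (box l u) x"
      by (intro AE_I2 tendsto_mult tendsto_const box_bump_tendsto)
    show "AE x in lborel. norm (v x * box_bump l u (1 / Suc n) x) \<le> \<bar>v x * indicator (box l u) x\<bar>" for n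
      using box_bump_bounds[of "1 / Suc n" l u] by (auto simp: abs_mult intro!: mult_left_mono)
    show "(\<lambda>x. v x * box_bump l u (1 / Suc n) x) \<in> borel_measurable lborel" for n
      by measurable
  qed (use int in auto)
  thus "(\<integral>x. v x * indicator (box l u) x \<partial>lborel) = 0"
    using zero[OF test_fun_box_bump, of "1 / Suc n" l u for n] by (simp add: LIMSEQ_const_iff)
qed

section \<open>Translations of Sobolev functions\<close>

lemma test_fun_translate: "test_fun \<psi> \<Longrightarrow> test_fun (\<lambda>x. \<psi> (x - y))"
proof -
  assume t: "test_fun \<psi>"
  let ?K = "closure {x. \<psi> x \<noteq> 0}"
  have "{x. \<psi> (x - y) \<noteq> 0} \<subseteq> (\<lambda>x. x + y) ` ?K"
    using closure_subset[of "{x. \<psi> x \<noteq> 0}"] by (auto simp: image_iff algebra_simps intro!: bexI[of _ "_ - y"])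
  moreover have "compact ((\<lambda>x. x + y) ` ?K)"
    using t by (intro compact_continuous_image continuous_intros) (auto simp: test_fun_def)
  ultimately have "compact (closure {x. \<psi> (x - y) \<noteq> 0})"
    by (meson bounded_subset compact_closure compact_imp_bounded)
  thus ?thesis using t by (auto simp: test_fun_def intro: Ck_fun_translate)
qed

lemma integral_weak_derivative_translate:
  fixes f g \<psi> :: "'a::euclidean_space \<Rightarrow> real"
  assumes w: "weak_partial_deriv f b g" and \<psi>: "test_fun \<psi>"
    and [measurable]: "f \<in> borel_measurable borel" "g \<in> borel_measurable borel"
  shows "(\<integral>x. f x * frechet_derivative \<psi> (at (x + y)) b \<partial>lborel) = - (\<integral>x. g (x - y) * \<psi> x \<partial>lborel)"
proof -
  have [measurable]: "\<psi> \<in> borel_measurable borel" by (rule borel_measurable_test_fun[OF \<psi>])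
  have d: "frechet_derivative (\<lambda>x. \<psi> (x - (- y))) (at x) = frechet_derivative \<psi> (at (x - (- y)))" for x
    using \<psi> by (intro frechet_derivative_eq frechet_derivative_translate)
      (auto simp: test_fun_def dest!: spec[of _ "Suc 0"])
  have "(\<integral>x. f x * frechet_derivative \<psi> (at (x + y)) b \<partial>lborel) =
      (\<integral>x. f x * frechet_derivative (\<lambda>x. \<psi> (x - (- y))) (at x) b \<partial>lborel)"
    unfolding d by simp
  also have "\<dots> = - (\<integral>x. g x * \<psi> (x - (- y)) \<partial>lborel)"
    using w test_fun_translate[OF \<psi>, of "- y"] unfolding weak_partial_deriv_def by blast
  also have "(\<integral>x. g x * \<psi> (x - (- y)) \<partial>lborel) = (\<integral>x. g (- y + x) * \<psi> (- y + x - (- y)) \<partial>lborel)"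
    by (rule integral_lborel_translate[symmetric]) measurable
  finally show ?thesis by simp
qed

text \<open>Almost everywhere, \<open>f (x - h b) - f x\<close> is the integral of \<open>- h g (x - t h b)\<close> over \<open>t\<close> in the unit
  interval, called \<open>w x\<close> below. Testing against \<open>\<psi>\<close> moves the translation and the fundamental theorem of
  calculus to \<open>\<psi>\<close>, and the weak derivative moves back to \<open>g\<close>; test functions separate square-integrable
  functions. The bound is then the Cauchy-Schwarz inequality in \<open>t\<close>.\<close>

lemma translation_gap_weak_derivative:
  fixes f g :: "'a::euclidean_space \<Rightarrow> real"
  assumes f: "L2_fun f" "integrable lborel f" and g: "L2_fun g"
    and weak: "weak_partial_deriv f b g" and b: "b \<in> Basis"
  shows "translation_gap f (h *\<^sub>R b) \<le> ennreal (h\<^sup>2 * (\<integral>x. (g x)\<^sup>2 \<partial>lborel))"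
proof -
  let ?G = "\<integral>x. (g x)\<^sup>2 \<partial>lborel"
  define p where "p = h *\<^sub>R b"
  have [measurable]: "f \<in> borel_measurable borel" "g \<in> borel_measurable borel"
    using f g by (auto simp: L2_fun_def)
  have f2: "integrable lborel (\<lambda>x. (f x)\<^sup>2)" and g2: "integrable lborel (\<lambda>x. (g x)\<^sup>2)"
    using f g by (auto simp: L2_fun_def)
  define I :: "real \<Rightarrow> real" where "I = indicator {0..1}"
  have [measurable]: "I \<in> borel_measurable borel" by (simp add: I_def)
  have intI: "integrable lborel I" unfolding I_def by simp
  have I_cases: "I t = 0 \<or> I t = 1" for t by (auto simp: I_def indicator_def)
  \<comment> \<open>\<open>I\<close> restricts the Lebesgue integral over \<open>t\<close> to the unit interval.\<close>
  define w where "w x = (\<integral>t. I t * (- h * g (x - t *\<^sub>R p)) \<partial>lborel)" for x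
  have [measurable]: "w \<in> borel_measurable borel" unfolding w_def[abs_def] by measurable
  have f_shift: "integrable lborel (\<lambda>x. f (x - p))"
    using integrable_lborel_affine_iff[of f 1 "- p"] f by simp
  have shift2: "integrable lborel (\<lambda>x. (k (x - y))\<^sup>2)" "(\<integral>x. (k (x - y))\<^sup>2 \<partial>lborel) = (\<integral>x. (k x)\<^sup>2 \<partial>lborel)"
    if "integrable lborel (\<lambda>x. (k x)\<^sup>2)" "k \<in> borel_measurable borel" for k :: "'a \<Rightarrow> real" and y
    using integrable_lborel_affine_iff[of "\<lambda>x. (k x)\<^sup>2" 1 "- y"]
      integral_lborel_translate[of "\<lambda>x. (k x)\<^sup>2" "- y"] that by simp_all

  have w_sq: "(\<integral>\<^sup>+x. ennreal ((w x)\<^sup>2) \<partial>lborel) \<le> ennreal (h\<^sup>2 * ?G)"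
  proof -
    let ?j = "\<lambda>x t. ennreal (I t) * ennreal ((h * g (x - t *\<^sub>R p))\<^sup>2)"
    have "ennreal ((w x)\<^sup>2) \<le> (\<integral>\<^sup>+t. ?j x t \<partial>lborel)" for x
    proof -
      let ?k = "\<lambda>t. I t * (- h * g (x - t *\<^sub>R p))"
      have "ennreal \<bar>w x\<bar> \<le> (\<integral>\<^sup>+t. ennreal \<bar>?k t\<bar> \<partial>lborel)"
      proof (cases "integrable lborel ?k")
        case True
        from integral_norm_bound_ennreal[OF this] show ?thesis by (simp add: w_def)
      next
        case False
        thus ?thesis by (simp add: w_def not_integrable_integral_eq)
      qed
      also have "\<dots> = (\<integral>\<^sup>+t. ennreal (I t) * ennreal \<bar>?k t\<bar> \<partial>lborel)"
        using I_cases by (intro nn_integral_cong) (metis ennreal_0 ennreal_1 mult_1 mult_zero_left abs_zero)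
      finally have "(ennreal \<bar>w x\<bar>)\<^sup>2 \<le> (\<integral>\<^sup>+t. ennreal (I t) * ennreal \<bar>?k t\<bar> \<partial>lborel)\<^sup>2"
        by (rule power_mono) simp
      also have "\<dots> \<le> (\<integral>\<^sup>+t. ennreal (I t) ^ 2 \<partial>lborel) * (\<integral>\<^sup>+t. ennreal \<bar>?k t\<bar> ^ 2 \<partial>lborel)"
        by (rule Cauchy_Schwarz_nn_integral) measurable
      also have "(\<integral>\<^sup>+t. ennreal (I t) ^ 2 \<partial>lborel) = (\<integral>\<^sup>+t. indicator {0..1} t \<partial>(lborel :: real measure))"
        by (intro nn_integral_cong) (auto simp: I_def indicator_def)
      also have "\<dots> = 1" by simp
      also have "1 * (\<integral>\<^sup>+t. ennreal \<bar>?k t\<bar> ^ 2 \<partial>lborel) = (\<integral>\<^sup>+t. ?j x t \<partial>lborel)"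
        unfolding mult_1 by (intro nn_integral_cong) (auto simp: I_def indicator_def ennreal_power)
      finally show ?thesis by (simp add: ennreal_power)
    qed
    hence "(\<integral>\<^sup>+x. ennreal ((w x)\<^sup>2) \<partial>lborel) \<le>
       (\<integral>\<^sup>+x. (\<integral>\<^sup>+t. ?j x t \<partial>lborel) \<partial>lborel)"
      by (intro nn_integral_mono)
    also have "\<dots> = (\<integral>\<^sup>+t. (\<integral>\<^sup>+x. ?j x t \<partial>lborel) \<partial>lborel)"
      by (rule lborel_pair.Fubini') measurable
    also have "\<dots> = (\<integral>\<^sup>+t. ennreal (I t) * ennreal (h\<^sup>2 * ?G) \<partial>lborel)"
    proof (intro nn_integral_cong)
      fix t
      have "(\<integral>\<^sup>+x. ennreal ((h * g (x - t *\<^sub>R p))\<^sup>2) \<partial>lborel) = ennreal (\<integral>x. h\<^sup>2 * (g (x - t *\<^sub>R p))\<^sup>2 \<partial>lborel)"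
        unfolding power_mult_distrib by (rule nn_integral_eq_integral) (use shift2[OF g2] in auto)
      thus "(\<integral>\<^sup>+x. ?j x t \<partial>lborel) = ennreal (I t) * ennreal (h\<^sup>2 * ?G)"
        by (simp add: nn_integral_cmult shift2[OF g2])
    qed
    also have "\<dots> = (\<integral>\<^sup>+t. ennreal (I t) \<partial>lborel) * ennreal (h\<^sup>2 * ?G)"
      by (rule nn_integral_multc) measurable
    also have "(\<integral>\<^sup>+t. ennreal (I t) \<partial>lborel) = (\<integral>\<^sup>+t. indicator {0..1} t \<partial>(lborel :: real measure))"
      by (intro nn_integral_cong) (auto simp: I_def indicator_def)
    finally show ?thesis by simp
  qed
  have w2: "integrable lborel (\<lambda>x. (w x)\<^sup>2)"
    by (rule integrableI_bounded) (use w_sq in \<open>auto intro: le_less_trans\<close>)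

  define v where "v x = (f (x - p) - f x) - w x" for x
  have u2: "integrable lborel (\<lambda>x. (f (x - p) - f x)\<^sup>2)"
  proof (rule Bochner_Integration.integrable_bound)
    show "integrable lborel (\<lambda>x. 2 * (f (x - p))\<^sup>2 + 2 * (f x)\<^sup>2)"
      using f2 shift2[OF f2] by auto
    show "AE x in lborel. norm ((f (x - p) - f x)\<^sup>2) \<le> norm (2 * (f (x - p))\<^sup>2 + 2 * (f x)\<^sup>2)"
      using square_sum_le[of "f (x - p)" "- f x" for x] by (auto simp: algebra_simps)
  qed measurable
  have "integrable lborel (\<lambda>x. (v x)\<^sup>2)"
  proof (rule Bochner_Integration.integrable_bound)
    show "integrable lborel (\<lambda>x. 2 * (f (x - p) - f x)\<^sup>2 + 2 * (w x)\<^sup>2)"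
      using u2 w2 by auto
    show "AE x in lborel. norm ((v x)\<^sup>2) \<le> norm (2 * (f (x - p) - f x)\<^sup>2 + 2 * (w x)\<^sup>2)"
      unfolding v_def using square_sum_le[of "f (x - p) - f x" "- w x" for x] by auto
  qed (simp add: v_def)
  hence v: "L2_fun v" by (simp add: L2_fun_def v_def[abs_def])

  have "(\<integral>x. v x * \<psi> x \<partial>lborel) = 0" if \<psi>: "test_fun \<psi>" for \<psi>
  proof -
    let ?D = "\<lambda>x. frechet_derivative \<psi> (at x) b"
    obtain B K where B: "B \<ge> 0" "compact K" "\<And>x. \<bar>\<psi> x\<bar> \<le> B * indicator K x" "\<And>x. \<bar>?D x\<bar> \<le> B"
      and contD: "continuous_on UNIV ?D"
      using test_fun_bounded[OF \<psi> b] by metis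
    have [measurable]: "\<psi> \<in> borel_measurable borel" by (rule borel_measurable_test_fun[OF \<psi>])
    have [measurable]: "?D \<in> borel_measurable borel" by (rule borel_measurable_continuous_onI[OF contD])
    have \<psi>B: "\<bar>\<psi> x\<bar> \<le> B" for x by (rule order_trans[OF B(3)]) (use B(1) in \<open>auto simp: indicator_def\<close>)
    have diff: "\<psi> differentiable (at x)" for x
      using \<psi> by (auto simp: test_fun_def dest!: spec[of _ "Suc 0"])
    have KB: "integrable lborel (\<lambda>x. B\<^sup>2 * (indicator K x :: real))"
      using B(2) by (intro integrable_mult_right integrable_real_indicator emeasure_compact_finite) (auto intro: borel_compact)
    have \<psi>2: "integrable lborel (\<lambda>x. (\<psi> x)\<^sup>2)"
    proof (rule Bochner_Integration.integrable_bound[OF KB])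
      show "AE x in lborel. norm ((\<psi> x)\<^sup>2) \<le> norm (B\<^sup>2 * (indicator K x :: real))"
      proof (intro AE_I2)
        fix x
        have "(\<psi> x)\<^sup>2 \<le> (B * indicator K x)\<^sup>2" using power_mono[OF B(3)[of x], of 2] by simp
        thus "norm ((\<psi> x)\<^sup>2) \<le> norm (B\<^sup>2 * (indicator K x :: real))"
          by (auto simp: indicator_def split: if_splits)
      qed
    qed measurable
    have bdd_int: "integrable lborel (\<lambda>x. k x * \<psi> (x + y))" if "integrable lborel k" for k :: "'a \<Rightarrow> real" and y
    proof (rule Bochner_Integration.integrable_bound)
      show "integrable lborel (\<lambda>x. B * k x)" using that by simp
      have [measurable]: "k \<in> borel_measurable borel" using that by auto
      show "(\<lambda>x. k x * \<psi> (x + y)) \<in> borel_measurable lborel" by measurable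
      show "AE x in lborel. norm (k x * \<psi> (x + y)) \<le> norm (B * k x)"
        using \<psi>B B(1) by (auto simp: abs_mult mult.commute[of B] intro!: mult_left_mono)
    qed
    have diff_int: "\<psi> (x + p) - \<psi> x = (\<integral>t. I t * (h * ?D (x + t *\<^sub>R p)) \<partial>lborel)" for x
    proof -
      have "(\<integral>t. (h * ?D (x + t *\<^sub>R p)) * indicator {0..1} t \<partial>lborel) = \<psi> (x + 1 *\<^sub>R p) - \<psi> (x + 0 *\<^sub>R p)"
      proof (rule integral_FTC_Icc_real[where F="\<lambda>t. \<psi> (x + t *\<^sub>R p)"])
        fix t :: real
        have 1: "((\<lambda>t. x + t *\<^sub>R p) has_derivative (\<lambda>t. t *\<^sub>R p)) (at t)"
          by (auto intro!: derivative_eq_intros)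
        have 2: "(\<psi> has_derivative frechet_derivative \<psi> (at (x + t *\<^sub>R p))) (at (x + t *\<^sub>R p))"
          using diff by (simp add: frechet_derivative_works)
        have lin: "linear (frechet_derivative \<psi> (at y))" for y
          by (rule linear_frechet_derivative[OF diff])
        from has_derivative_compose[OF 1 2] have "((\<lambda>t. \<psi> (x + t *\<^sub>R p)) has_derivative (\<lambda>s. (h * ?D (x + t *\<^sub>R p)) * s)) (at t)"
          by (simp add: p_def linear_cmul[OF lin] mult_ac)
        thus "((\<lambda>t. \<psi> (x + t *\<^sub>R p)) has_real_derivative h * ?D (x + t *\<^sub>R p)) (at t)"
          by (simp add: has_field_derivative_def)
        have "continuous_on UNIV (\<lambda>t. h * ?D (x + t *\<^sub>R p))"
          by (intro continuous_intros continuous_on_compose2[OF contD]) auto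
        thus "isCont (\<lambda>t. h * ?D (x + t *\<^sub>R p)) t"
          by (simp add: continuous_on_eq_continuous_at)
      qed simp
      thus ?thesis by (simp add: I_def mult.commute)
    qed
    let ?a = "\<lambda>t x. f x * (I t * (h * ?D (x + t *\<^sub>R p)))"
    have "(\<integral>x. (f (x - p) - f x) * \<psi> x \<partial>lborel) = (\<integral>x. f (x - p) * \<psi> x \<partial>lborel) - (\<integral>x. f x * \<psi> x \<partial>lborel)"
      using bdd_int[OF f_shift, of 0] bdd_int[OF f(2), of 0] by (simp add: left_diff_distrib)
    also have "(\<integral>x. f (x - p) * \<psi> x \<partial>lborel) = (\<integral>x. f (p + x - p) * \<psi> (p + x) \<partial>lborel)"
      by (rule integral_lborel_translate[symmetric]) measurable
    also have "\<dots> - (\<integral>x. f x * \<psi> x \<partial>lborel) = (\<integral>x. f x * (\<psi> (x + p) - \<psi> x) \<partial>lborel)"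
      using bdd_int[OF f(2), of p] bdd_int[OF f(2), of 0] by (simp add: right_diff_distrib add.commute)
    also have "\<dots> = (\<integral>x. (\<integral>t. ?a t x \<partial>lborel) \<partial>lborel)"
      unfolding diff_int by simp
    also have "\<dots> = (\<integral>t. (\<integral>x. ?a t x \<partial>lborel) \<partial>lborel)"
    proof (rule lborel_pair.Fubini_dominated(2)[where f="\<lambda>t. I t * (\<bar>h\<bar> * B)" and g="\<lambda>x. \<bar>f x\<bar>"])
      show "integrable lborel (\<lambda>t. I t * (\<bar>h\<bar> * B))" using intI by simp
      show "integrable lborel (\<lambda>x. \<bar>f x\<bar>)" using f by simp
      show "(\<lambda>(t, x). ?a t x) \<in> borel_measurable (lborel \<Otimes>\<^sub>M lborel)"
        by measurable
      show "norm (?a t x) \<le> I t * (\<bar>h\<bar> * B) * \<bar>f x\<bar>" for t x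
        using B(4)[of "x + t *\<^sub>R p"] I_cases[of t] by (auto simp: abs_mult mult.commute[of "\<bar>f x\<bar>"] intro!: mult_mono)
    qed
    also have "\<dots> = (\<integral>t. (\<integral>x. (I t * (- h * g (x - t *\<^sub>R p))) * \<psi> x \<partial>lborel) \<partial>lborel)"
    proof (rule Bochner_Integration.integral_cong[OF refl])
      fix t
      have "(\<integral>x. ?a t x \<partial>lborel) = (I t * h) * (\<integral>x. f x * ?D (x + t *\<^sub>R p) \<partial>lborel)"
        by (subst integral_mult_right_zero[symmetric]) (simp only: mult_ac)
      also have "\<dots> = (- (I t * h)) * (\<integral>x. g (x - t *\<^sub>R p) * \<psi> x \<partial>lborel)"
        by (subst integral_weak_derivative_translate[OF weak \<psi>]) simp_all
      also have "\<dots> = (\<integral>x. (- (I t * h)) * (g (x - t *\<^sub>R p) * \<psi> x) \<partial>lborel)"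
        by (rule integral_mult_right_zero[symmetric])
      finally show "(\<integral>x. ?a t x \<partial>lborel) = (\<integral>x. (I t * (- h * g (x - t *\<^sub>R p))) * \<psi> x \<partial>lborel)"
        by (simp only: mult_ac mult_minus_left mult_minus_right)
    qed
    also have "\<dots> = (\<integral>x. (\<integral>t. (I t * (- h * g (x - t *\<^sub>R p))) * \<psi> x \<partial>lborel) \<partial>lborel)"
    proof (rule lborel_pair.Fubini_integral[symmetric])
      let ?k = "\<lambda>t x. (I t * (- h * g (x - t *\<^sub>R p))) * \<psi> x"
      have int_t: "integrable lborel (?k t)" for t
        using integrable_mult_of_sq[of "\<lambda>x. g (x - t *\<^sub>R p)" lborel \<psi>] shift2[OF g2] \<psi>2 by (simp add: mult.assoc)
      let ?C = "\<bar>h\<bar> * (?G + (\<integral>x. (\<psi> x)\<^sup>2 \<partial>lborel))"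
      have le: "(\<integral>x. norm (?k t x) \<partial>lborel) \<le> I t * ?C" for t
      proof -
        have "(\<integral>x. norm (?k t x) \<partial>lborel) \<le> (\<integral>x. I t * \<bar>h\<bar> * ((g (x - t *\<^sub>R p))\<^sup>2 + (\<psi> x)\<^sup>2) \<partial>lborel)"
        proof (rule integral_mono)
          show "integrable lborel (\<lambda>x. norm (?k t x))" using int_t by (rule integrable_norm)
          show "integrable lborel (\<lambda>x. I t * \<bar>h\<bar> * ((g (x - t *\<^sub>R p))\<^sup>2 + (\<psi> x)\<^sup>2))"
            using shift2[OF g2] \<psi>2 by simp
          fix x
          let ?a = "\<bar>g (x - t *\<^sub>R p)\<bar>" and ?b = "\<bar>\<psi> x\<bar>"
          have "2 * (?a * ?b) \<le> ?a\<^sup>2 + ?b\<^sup>2" using sum_squares_bound[of ?a ?b] by simp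
          moreover have "0 \<le> ?a * ?b" by simp
          ultimately have "?a * ?b \<le> ?a\<^sup>2 + ?b\<^sup>2" by linarith
          hence "I t * \<bar>h\<bar> * (?a * ?b) \<le> I t * \<bar>h\<bar> * (?a\<^sup>2 + ?b\<^sup>2)"
            using I_cases[of t] by (intro mult_left_mono) auto
          thus "norm (?k t x) \<le> I t * \<bar>h\<bar> * ((g (x - t *\<^sub>R p))\<^sup>2 + (\<psi> x)\<^sup>2)"
            using I_cases[of t] by (auto simp: abs_mult mult.assoc)
        qed
        also have "\<dots> = I t * ?C" using shift2[OF g2] \<psi>2 by simp
        finally show ?thesis .
      qed
      show "integrable (lborel \<Otimes>\<^sub>M lborel) (\<lambda>(t, x). ?k t x)"
      proof (rule lborel_pair.Fubini_integrable)
        show "integrable lborel (\<lambda>t. \<integral>x. norm (case (t, x) of (t, x) \<Rightarrow> ?k t x) \<partial>lborel)"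
        proof (rule Bochner_Integration.integrable_bound)
          show "integrable lborel (\<lambda>t. I t * ?C)" using intI by simp
          show "AE t in lborel. norm (\<integral>x. norm (case (t, x) of (t, x) \<Rightarrow> ?k t x) \<partial>lborel) \<le> norm (I t * ?C)"
          proof (intro AE_I2)
            fix t
            have "0 \<le> (\<integral>x. norm (?k t x) \<partial>lborel)" by simp
            thus "norm (\<integral>x. norm (case (t, x) of (t, x) \<Rightarrow> ?k t x) \<partial>lborel) \<le> norm (I t * ?C)"
              using le[of t] unfolding case_prod_conv real_norm_def by linarith
          qed
        qed measurable
        show "AE t in lborel. integrable lborel (\<lambda>x. case (t, x) of (t, x) \<Rightarrow> ?k t x)"
          using int_t by simp
      qed measurable
    qed
    also have "\<dots> = (\<integral>x. w x * \<psi> x \<partial>lborel)"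
      unfolding w_def integral_mult_left_zero ..
    finally have "(\<integral>x. (f (x - p) - f x) * \<psi> x \<partial>lborel) = (\<integral>x. w x * \<psi> x \<partial>lborel)" .
    moreover have "integrable lborel (\<lambda>x. (f (x - p) - f x) * \<psi> x)" "integrable lborel (\<lambda>x. w x * \<psi> x)"
      using u2 w2 \<psi>2 by (auto intro!: integrable_mult_of_sq)
    ultimately show ?thesis by (simp add: v_def left_diff_distrib)
  qed
  hence "AE x in lborel. v x = 0" by (rule AE_0_if_test_integrals_0[OF v])
  hence "translation_gap f p = (\<integral>\<^sup>+x. ennreal ((w x)\<^sup>2) \<partial>lborel)"
    unfolding translation_gap_def by (intro nn_integral_cong_AE) (auto simp: v_def)
  thus ?thesis using w_sq by (simp add: p_def)
qed

text \<open>A translation is composed of translations along the coordinate axes; the induction adds one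
  axis at a time.\<close>

lemma translation_gap_sobolev_1:
  fixes f :: "'a::euclidean_space \<Rightarrow> real"
  assumes f: "L2_fun f" "integrable lborel f"
    and weak: "\<forall>b\<in>Basis. \<exists>g. L2_fun g \<and> weak_partial_deriv f b g"
  shows "\<exists>L\<ge>0. \<forall>y. translation_gap f y \<le> ennreal (L * (norm y)\<^sup>2)"
proof -
  have [measurable]: "f \<in> borel_measurable borel" using f by (simp add: L2_fun_def)
  have "\<exists>L\<ge>0. \<forall>y. translation_gap f (\<Sum>b\<in>A. (y \<bullet> b) *\<^sub>R b) \<le> ennreal (L * (norm y)\<^sup>2)" if "A \<subseteq> Basis" for A
    using finite_subset[OF that finite_Basis] that
  proof (induction rule: finite_induct)
    case empty
    thus ?case by (intro exI[of _ 0]) simp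
  next
    case (insert b A)
    then obtain L where L: "L \<ge> 0" "\<And>y. translation_gap f (\<Sum>b\<in>A. (y \<bullet> b) *\<^sub>R b) \<le> ennreal (L * (norm y)\<^sup>2)"
      by auto
    from insert.prems weak obtain g where g: "L2_fun g" "weak_partial_deriv f b g" by auto
    let ?G = "\<integral>x. (g x)\<^sup>2 \<partial>lborel"
    have "translation_gap f (\<Sum>b\<in>insert b A. (y \<bullet> b) *\<^sub>R b) \<le> ennreal ((2 * ?G + 2 * L) * (norm y)\<^sup>2)" for y
    proof -
      have "translation_gap f (\<Sum>b\<in>insert b A. (y \<bullet> b) *\<^sub>R b) \<le>
          2 * translation_gap f ((y \<bullet> b) *\<^sub>R b) + 2 * translation_gap f (\<Sum>b\<in>A. (y \<bullet> b) *\<^sub>R b)"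
        using insert by (simp add: translation_gap_add)
      also have "\<dots> \<le> 2 * ennreal ((y \<bullet> b)\<^sup>2 * ?G) + 2 * ennreal (L * (norm y)\<^sup>2)"
        by (intro add_mono mult_left_mono L translation_gap_weak_derivative f g) (use insert.prems in auto)
      also have "\<dots> = ennreal (2 * ((y \<bullet> b)\<^sup>2 * ?G) + 2 * (L * (norm y)\<^sup>2))"
        using L by (simp add: ennreal_mult ennreal_plus)
      also have "\<dots> \<le> ennreal ((2 * ?G + 2 * L) * (norm y)\<^sup>2)"
      proof (rule ennreal_leI)
        have "(y \<bullet> b)\<^sup>2 \<le> (norm y)\<^sup>2"
          using Basis_le_norm[of b y] insert.prems by (simp add: abs_le_square_iff[symmetric])
        hence "(y \<bullet> b)\<^sup>2 * ?G \<le> (norm y)\<^sup>2 * ?G" by (rule mult_right_mono) simp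
        thus "2 * ((y \<bullet> b)\<^sup>2 * ?G) + 2 * (L * (norm y)\<^sup>2) \<le> (2 * ?G + 2 * L) * (norm y)\<^sup>2"
          by (simp add: algebra_simps)
      qed
      finally show ?thesis .
    qed
    moreover have "2 * ?G + 2 * L \<ge> 0" using L by simp
    ultimately show ?case by blast
  qed
  from this[of Basis] show ?thesis by (simp add: euclidean_representation)
qed

text \<open>Beyond square integrability, Sobolev regularity enters the risk bound through this estimate alone.\<close>

theorem sobolev_translation_gap:
  fixes f :: "'a::euclidean_space \<Rightarrow> real"
  assumes s: "0 < s" and f: "sobolev s f" and int: "integrable lborel f"
  shows "\<exists>L\<ge>0. \<forall>y. translation_gap f y \<le> ennreal (L * norm y powr (2 * s))"
proof (cases "s = 1")
  case True
  have *: "norm y powr (2 * 1) = (norm y)\<^sup>2" for y :: 'a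
    by (cases "y = 0") (auto simp: powr_numeral)
  show ?thesis
    using translation_gap_sobolev_1[of f] f int unfolding True * by (auto simp: sobolev_def)
next
  case False
  thus ?thesis using translation_gap_gagliardo[of f s] s f by (auto simp: sobolev_def L2_fun_def)
qed

section \<open>Empirical means of an i.i.d. sample\<close>

locale iid_density =
  fixes \<Omega> :: "'w measure" and X :: "nat \<Rightarrow> 'w \<Rightarrow> 'a::euclidean_space" and f0 :: "'a \<Rightarrow> real"
  assumes iid: "iid_sample \<Omega> X f0" and density: "prob_density f0"
begin

sublocale prob_space \<Omega>
  using iid by (simp add: iid_sample_def)

lemma f0_borel [measurable]: "f0 \<in> borel_measurable borel"
  and f0_nonneg: "0 \<le> f0 x"
  and f0_integrable: "integrable lborel f0"
  and f0_integral: "integral\<^sup>L lborel f0 = 1"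
  using density by (auto simp: prob_density_def)

lemma X_distributed: "i \<ge> 1 \<Longrightarrow> distributed \<Omega> lborel (X i) (\<lambda>x. ennreal (f0 x))"
  using iid by (simp add: iid_sample_def)

lemma X_measurable: "i \<ge> 1 \<Longrightarrow> X i \<in> borel_measurable \<Omega>"
  using distributed_measurable[OF X_distributed] by simp

lemma integrable_bounded_density:
  fixes g :: "'a \<Rightarrow> 'c::{banach, second_countable_topology}"
  assumes [measurable]: "g \<in> borel_measurable borel" and bdd: "\<And>x. norm (g x) \<le> B"
  shows "integrable lborel (\<lambda>x. f0 x *\<^sub>R g x)"
proof (rule Bochner_Integration.integrable_bound)
  show "integrable lborel (\<lambda>x. B * f0 x)" using f0_integrable by simp
  show "AE x in lborel. norm (f0 x *\<^sub>R g x) \<le> norm (B * f0 x)"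
  proof (intro AE_I2)
    fix x
    have "norm (f0 x *\<^sub>R g x) \<le> f0 x * B"
      using f0_nonneg[of x] bdd[of x] by (simp add: mult_left_mono)
    thus "norm (f0 x *\<^sub>R g x) \<le> norm (B * f0 x)" by (simp add: mult.commute)
  qed
qed measurable

lemma expectation_X:
  fixes g :: "'a \<Rightarrow> 'c::{banach, second_countable_topology}"
  assumes [measurable]: "g \<in> borel_measurable borel" and i: "i \<ge> 1"
  shows "(\<integral>\<omega>. g (X i \<omega>) \<partial>\<Omega>) = (\<integral>x. f0 x *\<^sub>R g x \<partial>lborel)"
proof -
  have "(\<integral>\<omega>. g (X i \<omega>) \<partial>\<Omega>) = integral\<^sup>L (distr \<Omega> lborel (X i)) g"
    using X_measurable[OF i] by (intro integral_distr[symmetric]) auto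
  also have "distr \<Omega> lborel (X i) = density lborel (\<lambda>x. ennreal (f0 x))"
    by (rule distributed_distr_eq_density[OF X_distributed[OF i]])
  also have "integral\<^sup>L \<dots> g = (\<integral>x. f0 x *\<^sub>R g x \<partial>lborel)"
    by (intro integral_density) (auto simp: f0_nonneg)
  finally show ?thesis .
qed

text \<open>By independence the cross terms vanish, so the second moment of the centred mean is the average
  of the variances divided by \<open>N\<close>.\<close>

lemma empirical_mean_variance:
  fixes g :: "'a \<Rightarrow> real"
  assumes [measurable]: "g \<in> borel_measurable borel" and bdd: "\<And>x. \<bar>g x\<bar> \<le> B" and N: "N \<ge> 1"
  shows "(\<integral>\<^sup>+\<omega>. ennreal (((\<Sum>i=1..N. g (X i \<omega>)) / real N - (\<integral>x. f0 x * g x \<partial>lborel))\<^sup>2) \<partial>\<Omega>)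
     \<le> ennreal ((\<integral>x. f0 x * (g x)\<^sup>2 \<partial>lborel) / real N)"
proof -
  define e where "e = (\<integral>x. f0 x * g x \<partial>lborel)"
  define V where "V = (\<integral>x. f0 x * (g x)\<^sup>2 \<partial>lborel)"
  define Z where "Z i \<omega> = g (X i \<omega>) - e" for i \<omega>
  have Zm [measurable]: "Z i \<in> borel_measurable \<Omega>" if "i \<ge> 1" for i
    unfolding Z_def[abs_def] using X_measurable[OF that] by measurable
  have Zb: "\<bar>Z i \<omega>\<bar> \<le> B + \<bar>e\<bar>" for i \<omega> unfolding Z_def using bdd[of "X i \<omega>"] by linarith
  have Zi: "integrable \<Omega> (Z i)" if "i \<ge> 1" for i
    by (rule integrable_const_bound[where B="B + \<bar>e\<bar>"]) (use Zb Zm[OF that] in auto)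
  have Z2i: "integrable \<Omega> (\<lambda>\<omega>. Z i \<omega> * Z j \<omega>)" if "i \<ge> 1" "j \<ge> 1" for i j
  proof (rule integrable_const_bound[where B="(B + \<bar>e\<bar>) * (B + \<bar>e\<bar>)"])
    have "B + \<bar>e\<bar> \<ge> 0" using Zb[of 0 undefined] by linarith
    thus "AE \<omega> in \<Omega>. norm (Z i \<omega> * Z j \<omega>) \<le> (B + \<bar>e\<bar>) * (B + \<bar>e\<bar>)"
      using Zb by (auto simp: abs_mult intro!: mult_mono)
  qed (use Zm that in measurable)
  have gi: "integrable \<Omega> (\<lambda>\<omega>. g (X i \<omega>))" if "i \<ge> 1" for i
  proof -
    have "integrable \<Omega> (\<lambda>\<omega>. Z i \<omega> + e)" using Zi[OF that] by simp
    thus ?thesis by (simp add: Z_def)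
  qed
  have EZ: "expectation (Z i) = 0" if "i \<ge> 1" for i
    using expectation_X[of g, OF assms(1) that] gi[OF that]
    unfolding Z_def by (simp add: e_def prob_space)
  have cross: "expectation (\<lambda>\<omega>. Z i \<omega> * Z j \<omega>) = 0" if "i \<ge> 1" "j \<ge> 1" "i \<noteq> j" for i j
  proof -
    have "indep_vars (\<lambda>_. borel) X {i, j}"
      by (rule indep_vars_subset[of _ X "{1..}"]) (use iid that in \<open>auto simp: iid_sample_def\<close>)
    hence "indep_vars (\<lambda>_. borel) (\<lambda>k \<omega>. g (X k \<omega>) - e) {i, j}"
      by (rule indep_vars_compose2[where Y="\<lambda>_ x. g x - e"]) auto
    hence "indep_vars (\<lambda>_. borel) Z {i, j}" by (simp add: Z_def[abs_def])
    hence "expectation (\<lambda>\<omega>. \<Prod>k\<in>{i, j}. Z k \<omega>) = (\<Prod>k\<in>{i, j}. expectation (Z k))"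
      by (rule indep_vars_lebesgue_integral[rotated]) (use that in \<open>auto intro: Zi\<close>)
    thus ?thesis using that EZ by simp
  qed
  have var: "expectation (\<lambda>\<omega>. Z i \<omega> * Z i \<omega>) \<le> V" if i: "i \<ge> 1" for i
  proof -
    have g2: "integrable \<Omega> (\<lambda>\<omega>. (g (X i \<omega>))\<^sup>2)"
    proof -
      have "integrable \<Omega> (\<lambda>\<omega>. Z i \<omega> * Z i \<omega> + 2 * e * Z i \<omega> + e\<^sup>2)" using Zi[OF i] Z2i[OF i i] by simp
      moreover have "Z i \<omega> * Z i \<omega> + 2 * e * Z i \<omega> + e\<^sup>2 = (g (X i \<omega>))\<^sup>2" for \<omega>
        by (simp add: Z_def power2_eq_square algebra_simps)
      ultimately show ?thesis by simp
    qed
    have "Z i \<omega> * Z i \<omega> = (g (X i \<omega>))\<^sup>2 - 2 * e * g (X i \<omega>) + e\<^sup>2" for \<omega>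
      by (simp add: Z_def power2_eq_square algebra_simps)
    hence "expectation (\<lambda>\<omega>. Z i \<omega> * Z i \<omega>) = expectation (\<lambda>\<omega>. (g (X i \<omega>))\<^sup>2) - 2 * e * expectation (\<lambda>\<omega>. g (X i \<omega>)) + e\<^sup>2"
      using g2 gi[OF i] by (simp add: prob_space)
    also have "expectation (\<lambda>\<omega>. g (X i \<omega>)) = e"
      using expectation_X[of g, OF _ i] by (simp add: e_def)
    also have "expectation (\<lambda>\<omega>. (g (X i \<omega>))\<^sup>2) = V"
      using expectation_X[of "\<lambda>x. (g x)\<^sup>2", OF _ i] by (simp add: V_def)
    finally show ?thesis by (simp add: power2_eq_square)
  qed
  let ?S = "\<lambda>\<omega>. (\<Sum>i=1..N. g (X i \<omega>)) / real N - e"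
  have S: "(?S \<omega>)\<^sup>2 = (\<Sum>i=1..N. \<Sum>j=1..N. Z i \<omega> * Z j \<omega>) / (real N)\<^sup>2" for \<omega>
  proof -
    have "?S \<omega> = (\<Sum>i=1..N. Z i \<omega>) / real N"
      using N by (simp add: Z_def sum_subtractf diff_divide_distrib)
    thus ?thesis by (simp add: power_divide power2_eq_square[of "sum _ _"] sum_product)
  qed
  have int: "integrable \<Omega> (\<lambda>\<omega>. (?S \<omega>)\<^sup>2)"
    unfolding S by (intro integrable_divide_zero Bochner_Integration.integrable_sum Z2i) auto
  have "expectation (\<lambda>\<omega>. (?S \<omega>)\<^sup>2) = (\<Sum>i=1..N. \<Sum>j=1..N. expectation (\<lambda>\<omega>. Z i \<omega> * Z j \<omega>)) / (real N)\<^sup>2"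
  proof -
    have "expectation (\<lambda>\<omega>. \<Sum>i=1..N. \<Sum>j=1..N. Z i \<omega> * Z j \<omega>) = (\<Sum>i=1..N. expectation (\<lambda>\<omega>. \<Sum>j=1..N. Z i \<omega> * Z j \<omega>))"
      by (intro Bochner_Integration.integral_sum Bochner_Integration.integrable_sum Z2i) auto
    also have "\<dots> = (\<Sum>i=1..N. \<Sum>j=1..N. expectation (\<lambda>\<omega>. Z i \<omega> * Z j \<omega>))"
      by (intro sum.cong refl Bochner_Integration.integral_sum Z2i) auto
    finally show ?thesis unfolding S by simp
  qed
  also have "(\<Sum>i=1..N. \<Sum>j=1..N. expectation (\<lambda>\<omega>. Z i \<omega> * Z j \<omega>)) \<le> (\<Sum>i=1..N. \<Sum>j=1..N. if i = j then V else 0)"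
    by (intro sum_mono) (auto simp: cross var)
  also have "\<dots> = real N * V" by (simp add: sum.delta)
  also have "real N * V / (real N)\<^sup>2 = V / real N"
    using N by (simp add: power2_eq_square)
  finally have "expectation (\<lambda>\<omega>. (?S \<omega>)\<^sup>2) \<le> V / real N"
    by (simp add: divide_right_mono)
  thus ?thesis
    unfolding e_def[symmetric] V_def[symmetric]
    by (subst nn_integral_eq_integral[OF int]) (auto intro: ennreal_leI)
qed

text \<open>Empirical minus true characteristic function.\<close>

definition char_gap :: "nat \<Rightarrow> 'w \<Rightarrow> 'a \<Rightarrow> complex" where
  "char_gap n \<omega> \<xi> = (\<Sum>i=1..n. cis (X i \<omega> \<bullet> \<xi>)) / of_nat n
     - (\<integral>x. cis (x \<bullet> \<xi>) * complex_of_real (f0 x) \<partial>lborel)"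

lemma char_gap_measurable [measurable]:
  "(\<lambda>(\<omega>, \<xi>). char_gap n \<omega> \<xi>) \<in> borel_measurable (\<Omega> \<Otimes>\<^sub>M borel)"
proof -
  have [measurable]: "X i \<in> borel_measurable \<Omega>" if "i \<in> {1..n}" for i
    using that by (intro X_measurable) simp
  show ?thesis unfolding char_gap_def by measurable
qed

lemma char_gap_measurable_snd:
  "\<omega> \<in> space \<Omega> \<Longrightarrow> char_gap n \<omega> \<in> borel_measurable borel"
  using measurable_Pair2[OF char_gap_measurable[of n], of \<omega>] by simp

text \<open>The variances of the cosine and the sine part add up to at most 1.\<close>

lemma char_gap_second_moment:
  assumes n: "n \<ge> 1"
  shows "(\<integral>\<^sup>+\<omega>. ennreal ((norm (char_gap n \<omega> \<xi>))\<^sup>2) \<partial>\<Omega>) \<le> ennreal (1 / real n)"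
proof -
  let ?c = "\<lambda>x. cos (x \<bullet> \<xi>)" and ?s = "\<lambda>x. sin (x \<bullet> \<xi>)"
  let ?C = "\<lambda>\<omega>. (\<Sum>i=1..n. ?c (X i \<omega>)) / real n - (\<integral>x. f0 x * ?c x \<partial>lborel)"
  let ?S = "\<lambda>\<omega>. (\<Sum>i=1..n. ?s (X i \<omega>)) / real n - (\<integral>x. f0 x * ?s x \<partial>lborel)"
  have [measurable]: "X i \<in> borel_measurable \<Omega>" if "i \<in> {1..n}" for i
    using that by (intro X_measurable) simp
  have int: "integrable lborel (\<lambda>x. cis (x \<bullet> \<xi>) * complex_of_real (f0 x))"
    using f0_integrable by (intro integrable_cis_mult) auto
  have int2: "integrable lborel (\<lambda>x. f0 x * (?c x)\<^sup>2)" "integrable lborel (\<lambda>x. f0 x * (?s x)\<^sup>2)"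
    using integrable_bounded_density[of "\<lambda>x. (?c x)\<^sup>2" 1] integrable_bounded_density[of "\<lambda>x. (?s x)\<^sup>2" 1]
    by (simp_all add: power_le_one_iff abs_square_le_1)
  have "Re (char_gap n \<omega> \<xi>) = ?C \<omega>" for \<omega>
    using integral_Re[OF int] by (simp add: char_gap_def mult.commute)
  moreover have "Im (char_gap n \<omega> \<xi>) = ?S \<omega>" for \<omega>
    using integral_Im[OF int] by (simp add: char_gap_def mult.commute)
  ultimately have "ennreal ((norm (char_gap n \<omega> \<xi>))\<^sup>2) = ennreal ((?C \<omega>)\<^sup>2) + ennreal ((?S \<omega>)\<^sup>2)" for \<omega>
    by (simp only: cmod_power2) (simp add: ennreal_plus)
  hence "(\<integral>\<^sup>+\<omega>. ennreal ((norm (char_gap n \<omega> \<xi>))\<^sup>2) \<partial>\<Omega>) =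
      (\<integral>\<^sup>+\<omega>. ennreal ((?C \<omega>)\<^sup>2) \<partial>\<Omega>) + (\<integral>\<^sup>+\<omega>. ennreal ((?S \<omega>)\<^sup>2) \<partial>\<Omega>)"
    by (simp add: nn_integral_add)
  also have "\<dots> \<le> ennreal ((\<integral>x. f0 x * (?c x)\<^sup>2 \<partial>lborel) / real n) + ennreal ((\<integral>x. f0 x * (?s x)\<^sup>2 \<partial>lborel) / real n)"
    by (intro add_mono empirical_mean_variance[where B=1] n) auto
  also have "\<dots> = ennreal (((\<integral>x. f0 x * (?c x)\<^sup>2 \<partial>lborel) + (\<integral>x. f0 x * (?s x)\<^sup>2 \<partial>lborel)) / real n)"
    by (subst ennreal_plus[symmetric]) (auto simp: add_divide_distrib f0_nonneg intro!: divide_nonneg_nonneg integral_nonneg)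
  also have "(\<integral>x. f0 x * (?c x)\<^sup>2 \<partial>lborel) + (\<integral>x. f0 x * (?s x)\<^sup>2 \<partial>lborel) = 1"
    by (subst Bochner_Integration.integral_add[symmetric, OF int2])
      (simp add: f0_integral flip: distrib_left)
  finally show ?thesis .
qed

lemma char_gap_first_moment:
  assumes n: "n \<ge> 1"
  shows "(\<integral>\<^sup>+\<omega>. ennreal (norm (char_gap n \<omega> \<xi>)) \<partial>\<Omega>) \<le> ennreal (1 / sqrt (real n))"
proof -
  have [measurable]: "(\<lambda>\<omega>. char_gap n \<omega> \<xi>) \<in> borel_measurable \<Omega>"
    using measurable_Pair1[OF char_gap_measurable[of n], of \<xi>] by simp
  let ?Z = "\<lambda>\<omega>. norm (char_gap n \<omega> \<xi>)"
  have "ennreal (?Z \<omega>) \<le> ennreal (1 / (2 * sqrt n)) + ennreal (sqrt n / 2) * ennreal ((?Z \<omega>)\<^sup>2)" for \<omega>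
  proof -
    let ?z = "?Z \<omega>"
    \<comment> \<open>The arithmetic-geometric mean inequality, balanced for \<open>?z\<close> of order \<open>1 / sqrt n\<close>.\<close>
    have "0 \<le> (1 - sqrt n * ?z)\<^sup>2" by simp
    hence "sqrt n * (2 * ?z) \<le> sqrt n * (1 / sqrt n + sqrt n * ?z\<^sup>2)"
      using n by (simp add: power2_eq_square algebra_simps)
    hence "2 * ?z \<le> 1 / sqrt n + sqrt n * ?z\<^sup>2"
      using n by (subst (asm) mult_le_cancel_left_pos) auto
    hence "?z \<le> 1 / (2 * sqrt n) + sqrt n / 2 * ?z\<^sup>2" by (simp add: field_simps)
    thus ?thesis by (simp add: ennreal_leI flip: ennreal_plus ennreal_mult)
  qed
  hence "(\<integral>\<^sup>+\<omega>. ennreal (?Z \<omega>) \<partial>\<Omega>) \<le>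
     (\<integral>\<^sup>+\<omega>. ennreal (1 / (2 * sqrt n)) + ennreal (sqrt n / 2) * ennreal ((?Z \<omega>)\<^sup>2) \<partial>\<Omega>)"
    by (intro nn_integral_mono)
  also have "\<dots> = ennreal (1 / (2 * sqrt n)) + ennreal (sqrt n / 2) * (\<integral>\<^sup>+\<omega>. ennreal ((?Z \<omega>)\<^sup>2) \<partial>\<Omega>)"
    by (simp add: nn_integral_add nn_integral_cmult emeasure_space_1)
  also have "\<dots> \<le> ennreal (1 / (2 * sqrt n)) + ennreal (sqrt n / 2) * ennreal (1 / real n)"
    by (intro add_mono mult_left_mono char_gap_second_moment n) auto
  also have "\<dots> = ennreal (1 / (2 * sqrt n) + sqrt n / 2 * (1 / n))"
    by (simp flip: ennreal_plus ennreal_mult)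
  also have "1 / (2 * sqrt n) + sqrt n / 2 * (1 / n) = 1 / sqrt n"
    using n by (simp add: field_simps flip: power2_eq_square)
  finally show ?thesis .
qed

section \<open>Approximation by mixtures\<close>

text \<open>The factor \<open>norm y powr s\<close> is split off before applying the Cauchy-Schwarz inequality: one factor is
  then the moment of order \<open>s\<close>, and in the other the weight \<open>norm y powr (- s)\<close> meets the gap of order
  \<open>norm y powr (2 * s)\<close>, which leaves the same moment again. Applying Jensen's inequality instead would
  ask for a moment of order \<open>2 * s\<close>.\<close>

lemma bias_bound:
  fixes k :: "'a \<Rightarrow> real"
  assumes k: "prob_density k" and bdd: "\<And>x. k x \<le> B"
    and gap: "\<And>y. translation_gap f0 y \<le> ennreal (L * norm y powr (2 * s))" and L: "L \<ge> 0"
  shows "(\<integral>\<^sup>+x. ennreal (((\<integral>y. f0 y * k (x - y) \<partial>lborel) - f0 x)\<^sup>2) \<partial>lborel)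
     \<le> ennreal L * (\<integral>\<^sup>+y. ennreal (norm y powr s * k y) \<partial>lborel)\<^sup>2"
proof -
  let ?h = "\<lambda>x. \<integral>y. f0 y * k (x - y) \<partial>lborel"
  have [measurable]: "k \<in> borel_measurable borel" and k0: "\<And>x. 0 \<le> k x"
    and ki: "integrable lborel k" "integral\<^sup>L lborel k = 1"
    using k by (auto simp: prob_density_def)
  define A where "A = (\<integral>\<^sup>+y. ennreal (norm y powr s * k y) \<partial>lborel)"
  define p where "p y = sqrt (k y * norm y powr s)" for y
  define q where "q y = sqrt (k y * norm y powr (- s))" for y
  have [measurable]: "p \<in> borel_measurable borel" "q \<in> borel_measurable borel"
    unfolding p_def[abs_def] q_def[abs_def] by measurable
  let ?e = "\<lambda>x y. ennreal ((q y)\<^sup>2) * ennreal ((f0 (x - y) - f0 x)\<^sup>2)"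
  have p0: "p y \<ge> 0" "q y \<ge> 0" for y using k0 by (auto simp: p_def q_def)
  have p2: "ennreal (p y) ^ 2 = ennreal (norm y powr s * k y)" for y
    using k0[of y] by (simp add: p_def ennreal_power mult.commute)
  \<comment> \<open>At the origin the powers of \<open>norm y\<close> are 0, but there the increment of \<open>f0\<close> vanishes as well.\<close>
  have pq: "p y * q y = k y" if "y \<noteq> 0" for y
    using that k0[of y] by (simp add: p_def q_def real_sqrt_mult[symmetric] powr_minus field_simps flip: power2_eq_square)
  have point: "ennreal ((?h x - f0 x)\<^sup>2) \<le>
      A * (\<integral>\<^sup>+y. ?e x y \<partial>lborel)" for x
  proof -
    have i1: "integrable lborel (\<lambda>y. f0 (x - y) * k y)"
    proof -
      have "integrable lborel (\<lambda>y. f0 y * k (x - y))"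
        using integrable_bounded_density[of "\<lambda>y. k (x - y)" B] bdd k0 by simp
      hence "integrable lborel (\<lambda>y. f0 (x + (-1) *\<^sub>R y) * k (x - (x + (-1) *\<^sub>R y)))"
        by (subst integrable_lborel_affine_iff[of "\<lambda>y. f0 y * k (x - y)"]) auto
      thus ?thesis by simp
    qed
    have "?h x = (\<integral>y. f0 (x - y) * k (x - (x - y)) \<partial>lborel)"
      by (rule integral_lborel_reflect[symmetric]) measurable
    hence "?h x - f0 x = (\<integral>y. f0 (x - y) * k y \<partial>lborel) - (\<integral>y. f0 x * k y \<partial>lborel)"
      by (simp add: ki)
    also have "\<dots> = (\<integral>y. (f0 (x - y) - f0 x) * k y \<partial>lborel)"
      using i1 ki by (subst Bochner_Integration.integral_diff[symmetric]) (auto simp: left_diff_distrib)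
    finally have eq: "?h x - f0 x = (\<integral>y. (f0 (x - y) - f0 x) * k y \<partial>lborel)" .
    have "integrable lborel (\<lambda>y. (f0 (x - y) - f0 x) * k y)"
      using i1 ki by (simp add: left_diff_distrib)
    from integral_norm_bound_ennreal[OF this]
    have "ennreal \<bar>?h x - f0 x\<bar> \<le> (\<integral>\<^sup>+y. ennreal \<bar>(f0 (x - y) - f0 x) * k y\<bar> \<partial>lborel)"
      unfolding eq by simp
    also have "\<dots> = (\<integral>\<^sup>+y. ennreal (p y) * (ennreal (q y) * ennreal \<bar>f0 (x - y) - f0 x\<bar>) \<partial>lborel)"
    proof (intro nn_integral_cong)
      fix y
      show "ennreal \<bar>(f0 (x - y) - f0 x) * k y\<bar> = ennreal (p y) * (ennreal (q y) * ennreal \<bar>f0 (x - y) - f0 x\<bar>)"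
      proof (cases "y = 0")
        case False
        have "ennreal (p y) * (ennreal (q y) * ennreal \<bar>f0 (x - y) - f0 x\<bar>) = ennreal ((p y * q y) * \<bar>f0 (x - y) - f0 x\<bar>)"
          using p0 by (simp add: ennreal_mult mult.assoc)
        thus ?thesis using pq[OF False] k0[of y] by (simp add: abs_mult mult.commute)
      qed simp
    qed
    finally have "ennreal \<bar>?h x - f0 x\<bar> ^ 2 \<le>
       (\<integral>\<^sup>+y. ennreal (p y) * (ennreal (q y) * ennreal \<bar>f0 (x - y) - f0 x\<bar>) \<partial>lborel)\<^sup>2"
      by (rule power_mono) simp
    also have "\<dots> \<le> (\<integral>\<^sup>+y. ennreal (p y) ^ 2 \<partial>lborel) * (\<integral>\<^sup>+y. (ennreal (q y) * ennreal \<bar>f0 (x - y) - f0 x\<bar>) ^ 2 \<partial>lborel)"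
      by (rule Cauchy_Schwarz_nn_integral) measurable
    also have "\<dots> = A * (\<integral>\<^sup>+y. ?e x y \<partial>lborel)"
      using p0 unfolding p2 A_def power_mult_distrib by (simp add: ennreal_power)
    finally show ?thesis by (simp add: ennreal_power)
  qed
  have "(\<integral>\<^sup>+x. (\<integral>\<^sup>+y. ?e x y \<partial>lborel) \<partial>lborel) =
      (\<integral>\<^sup>+y. (\<integral>\<^sup>+x. ?e x y \<partial>lborel) \<partial>lborel)"
    by (rule lborel_pair.Fubini') measurable
  also have "\<dots> = (\<integral>\<^sup>+y. ennreal ((q y)\<^sup>2) * translation_gap f0 y \<partial>lborel)"
    unfolding translation_gap_def by (intro nn_integral_cong nn_integral_cmult) measurable
  also have "\<dots> \<le> (\<integral>\<^sup>+y. ennreal L * ennreal (norm y powr s * k y) \<partial>lborel)"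
  proof (intro nn_integral_mono)
    fix y
    show "ennreal ((q y)\<^sup>2) * translation_gap f0 y \<le> ennreal L * ennreal (norm y powr s * k y)"
    proof (cases "y = 0")
      case False
      have "ennreal ((q y)\<^sup>2) * translation_gap f0 y \<le> ennreal ((q y)\<^sup>2) * ennreal (L * norm y powr (2 * s))"
        by (intro mult_left_mono gap) simp
      also have "\<dots> = ennreal ((q y)\<^sup>2 * (L * norm y powr (2 * s)))"
        using L by (simp add: ennreal_mult)
      also have "(q y)\<^sup>2 * (L * norm y powr (2 * s)) = L * (norm y powr s * k y)"
        using False k0[of y] by (simp add: q_def mult_ac powr_add[symmetric])
      finally show ?thesis using L k0[of y] by (simp add: ennreal_mult)
    qed simp
  qed
  also have "\<dots> = ennreal L * A"
    unfolding A_def by (rule nn_integral_cmult) measurable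
  finally have inner: "(\<integral>\<^sup>+x. (\<integral>\<^sup>+y. ?e x y \<partial>lborel) \<partial>lborel) \<le> ennreal L * A" .
  have "(\<integral>\<^sup>+x. ennreal ((?h x - f0 x)\<^sup>2) \<partial>lborel) \<le>
      (\<integral>\<^sup>+x. A * (\<integral>\<^sup>+y. ?e x y \<partial>lborel) \<partial>lborel)"
    by (intro nn_integral_mono point)
  also have "\<dots> = A * (\<integral>\<^sup>+x. (\<integral>\<^sup>+y. ?e x y \<partial>lborel) \<partial>lborel)"
    by (rule nn_integral_cmult) measurable
  also have "\<dots> \<le> A * (ennreal L * A)"
    by (intro mult_left_mono inner) simp
  also have "\<dots> = ennreal L * A\<^sup>2"
    by (simp add: power2_eq_square mult_ac)
  finally show ?thesis unfolding A_def .
qed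

text \<open>The equally weighted mixture centred at the observations is, at each point \<open>x\<close>, an empirical mean
  with expectation \<open>(f0 * k) x\<close>. The integral of its pointwise variances is at most \<open>(\<integral>k\<^sup>2) / m\<close>.\<close>

lemma random_mixture_bound:
  fixes k :: "'a \<Rightarrow> real"
  assumes [measurable]: "k \<in> borel_measurable borel" and bdd: "\<And>x. \<bar>k x\<bar> \<le> B"
    and k2: "integrable lborel (\<lambda>x. (k x)\<^sup>2)" and m: "m \<ge> 1"
    and bias: "(\<integral>\<^sup>+x. ennreal (((\<integral>y. f0 y * k (x - y) \<partial>lborel) - f0 x)\<^sup>2) \<partial>lborel) \<le> b"
  shows "(\<integral>\<^sup>+\<omega>. L2_dist_sq (\<lambda>x. \<Sum>j=1..m. 1 / real m * k (x - X j \<omega>)) f0 \<partial>\<Omega>)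
     \<le> 2 * ennreal ((\<integral>x. (k x)\<^sup>2 \<partial>lborel) / real m) + 2 * b"
proof -
  define h where "h x = (\<integral>y. f0 y * k (x - y) \<partial>lborel)" for x
  have [measurable]: "h \<in> borel_measurable borel" unfolding h_def[abs_def] by measurable
  have [measurable]: "X i \<in> borel_measurable \<Omega>" if "i \<in> {1..m}" for i
    using that by (intro X_measurable) simp
  interpret P: pair_sigma_finite \<Omega> "lborel :: 'a measure" ..
  let ?v = "\<lambda>x y. ennreal (f0 y * (k (x - y))\<^sup>2 / real m)"
  let ?f = "\<lambda>\<omega> x. \<Sum>j=1..m. 1 / real m * k (x - X j \<omega>)"
  have "(\<integral>\<^sup>+\<omega>. L2_dist_sq (?f \<omega>) f0 \<partial>\<Omega>) \<le>
     (\<integral>\<^sup>+\<omega>. (\<integral>\<^sup>+x. 2 * ennreal ((?f \<omega> x - h x)\<^sup>2) + 2 * ennreal ((h x - f0 x)\<^sup>2) \<partial>lborel) \<partial>\<Omega>)"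
    unfolding L2_dist_sq_def
  proof (intro nn_integral_mono)
    fix \<omega> x
    have "ennreal ((?f \<omega> x - f0 x)\<^sup>2) \<le> ennreal (2 * (?f \<omega> x - h x)\<^sup>2 + 2 * (h x - f0 x)\<^sup>2)"
      using square_sum_le[of "?f \<omega> x - h x" "h x - f0 x"] by (intro ennreal_leI) simp
    thus "ennreal ((?f \<omega> x - f0 x)\<^sup>2) \<le> 2 * ennreal ((?f \<omega> x - h x)\<^sup>2) + 2 * ennreal ((h x - f0 x)\<^sup>2)"
      by (simp add: ennreal_plus ennreal_mult)
  qed
  also have "\<dots> = (\<integral>\<^sup>+x. (\<integral>\<^sup>+\<omega>. 2 * ennreal ((?f \<omega> x - h x)\<^sup>2) + 2 * ennreal ((h x - f0 x)\<^sup>2) \<partial>\<Omega>) \<partial>lborel)"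
    by (rule P.Fubini'[symmetric]) measurable
  also have "\<dots> = (\<integral>\<^sup>+x. 2 * (\<integral>\<^sup>+\<omega>. ennreal ((?f \<omega> x - h x)\<^sup>2) \<partial>\<Omega>) + 2 * ennreal ((h x - f0 x)\<^sup>2) \<partial>lborel)"
    by (intro nn_integral_cong) (simp add: nn_integral_add nn_integral_cmult emeasure_space_1)
  also have "\<dots> \<le> (\<integral>\<^sup>+x. 2 * (\<integral>\<^sup>+y. ?v x y \<partial>lborel) + 2 * ennreal ((h x - f0 x)\<^sup>2) \<partial>lborel)"
  proof (intro nn_integral_mono add_mono mult_left_mono order_refl)
    fix x
    have f: "?f \<omega> x = (\<Sum>i=1..m. k (x - X i \<omega>)) / real m" for \<omega>
      by (simp add: sum_divide_distrib)
    have "(\<integral>\<^sup>+\<omega>. ennreal ((?f \<omega> x - h x)\<^sup>2) \<partial>\<Omega>) \<le> ennreal ((\<integral>y. f0 y * (k (x - y))\<^sup>2 \<partial>lborel) / real m)"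
      unfolding f h_def by (rule empirical_mean_variance[where B=B]) (use bdd m in auto)
    also have "\<dots> = (\<integral>\<^sup>+y. ?v x y \<partial>lborel)"
    proof -
      have "integrable lborel (\<lambda>y. f0 y *\<^sub>R (k (x - y))\<^sup>2)"
      proof (rule integrable_bounded_density)
        show "norm ((k (x - y))\<^sup>2) \<le> B\<^sup>2" for y
          using power_mono[OF bdd[of "x - y"], of 2] by simp
      qed measurable
      thus ?thesis
        by (subst nn_integral_eq_integral) (auto simp: f0_nonneg)
    qed
    finally show "(\<integral>\<^sup>+\<omega>. ennreal ((?f \<omega> x - h x)\<^sup>2) \<partial>\<Omega>) \<le> (\<integral>\<^sup>+y. ?v x y \<partial>lborel)" .
  qed auto
  also have "\<dots> = 2 * (\<integral>\<^sup>+x. (\<integral>\<^sup>+y. ?v x y \<partial>lborel) \<partial>lborel) + 2 * (\<integral>\<^sup>+x. ennreal ((h x - f0 x)\<^sup>2) \<partial>lborel)"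
    by (subst nn_integral_add) (auto simp: nn_integral_cmult)
  also have "(\<integral>\<^sup>+x. (\<integral>\<^sup>+y. ?v x y \<partial>lborel) \<partial>lborel) =
      (\<integral>\<^sup>+y. (\<integral>\<^sup>+x. ?v x y \<partial>lborel) \<partial>lborel)"
    by (rule lborel_pair.Fubini') measurable
  also have "\<dots> = (\<integral>\<^sup>+y. ennreal (f0 y) * ennreal ((\<integral>x. (k x)\<^sup>2 \<partial>lborel) / real m) \<partial>lborel)"
  proof (intro nn_integral_cong)
    fix y
    have "(\<integral>\<^sup>+x. ?v x y \<partial>lborel) = (\<integral>\<^sup>+x. ennreal (f0 y * (k (- y + x))\<^sup>2 / real m) \<partial>lborel)"
      by simp
    also have "\<dots> = (\<integral>\<^sup>+x. ennreal (f0 y * (k x)\<^sup>2 / real m) \<partial>lborel)"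
      by (rule nn_integral_lborel_translate[of "\<lambda>x. ennreal (f0 y * (k x)\<^sup>2 / real m)"]) measurable
    also have "\<dots> = ennreal (\<integral>x. f0 y * (k x)\<^sup>2 / real m \<partial>lborel)"
      using k2 by (intro nn_integral_eq_integral) (auto simp: f0_nonneg)
    also have "\<dots> = ennreal (f0 y) * ennreal ((\<integral>x. (k x)\<^sup>2 \<partial>lborel) / real m)"
      by (simp add: f0_nonneg flip: ennreal_mult)
    finally show "(\<integral>\<^sup>+x. ?v x y \<partial>lborel) = ennreal (f0 y) * ennreal ((\<integral>x. (k x)\<^sup>2 \<partial>lborel) / real m)" .
  qed
  also have "\<dots> = (\<integral>\<^sup>+y. ennreal (f0 y) \<partial>lborel) * ennreal ((\<integral>x. (k x)\<^sup>2 \<partial>lborel) / real m)"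
    by (rule nn_integral_multc) measurable
  also have "(\<integral>\<^sup>+y. ennreal (f0 y) \<partial>lborel) = 1"
    using nn_integral_eq_integral[OF f0_integrable] by (simp add: f0_nonneg f0_integral)
  finally show ?thesis
    using bias unfolding h_def mult_1 by (elim order_trans) (intro add_mono mult_left_mono order_refl, auto)
qed

end

section \<open>Mixtures of a dilated kernel\<close>

subsection \<open>Essential and pointwise bounds\<close>

lemma continuous_AE_le_imp_le:
  fixes g :: "'a::euclidean_space \<Rightarrow> real"
  assumes "continuous_on UNIV g" and ae: "AE x in lborel. g x \<le> r"
  shows "g x \<le> r"
proof (rule ccontr)
  assume "\<not> g x \<le> r"
  moreover have op: "open {x. r < g x}"
    using assms(1) by (intro open_Collect_less continuous_on_const)
  ultimately obtain e where e: "e > 0" "ball x e \<subseteq> {x. r < g x}"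
    by (metis mem_Collect_eq not_le open_contains_ball)
  have "emeasure lborel {x. r < g x} = 0"
    using ae op by (subst (asm) AE_iff_measurable[OF _ refl]) (auto simp: not_le borel_open)
  moreover have "emeasure lborel (ball x e) \<le> emeasure lborel {x. r < g x}"
    using e op by (intro emeasure_mono) (auto intro: borel_open)
  ultimately show False
    using e unit_ball_vol_pos[of "real DIM('a)"] by (simp add: emeasure_ball)
qed

lemma Linf_fun_continuous_bounded:
  fixes g :: "'a::euclidean_space \<Rightarrow> real"
  assumes "continuous_on UNIV g" "Linf_fun g"
  shows "\<exists>B. \<forall>x. \<bar>g x\<bar> \<le> B"
proof -
  let ?E = "esssup lborel (\<lambda>x. ereal \<bar>g x\<bar>)"
  from assms(2) obtain r where "?E \<le> ereal r" 
    by (auto simp: Linf_fun_def intro: less_imp_le dest: less_PInf_Ex_of_nat[THEN iffD1])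
  moreover have "AE x in lborel. ereal \<bar>g x\<bar> \<le> ?E" by (rule esssup_AE)
  ultimately have "AE x in lborel. ereal \<bar>g x\<bar> \<le> ereal r"
    by (auto elim!: eventually_mono intro: order_trans simp del: ereal_less_eq)
  hence "AE x in lborel. \<bar>g x\<bar> \<le> r" by simp
  hence "\<bar>g x\<bar> \<le> r" for x
    using assms(1) by (intro continuous_AE_le_imp_le[of "\<lambda>x. \<bar>g x\<bar>"] continuous_intros)
  thus ?thesis by blast
qed

text \<open>The bound \<open>B\<close> makes the essential supremum finite, so that its real value is the genuine one.\<close>

lemma le_Linf_norm:
  fixes g :: "'a::euclidean_space \<Rightarrow> real"
  assumes cont: "continuous_on UNIV g" and bdd: "\<And>x. \<bar>g x\<bar> \<le> B"
  shows "\<bar>g x\<bar> \<le> Linf_norm g"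
proof -
  let ?E = "esssup lborel (\<lambda>x. ereal \<bar>g x\<bar>)"
  have [measurable]: "g \<in> borel_measurable borel" by (rule borel_measurable_continuous_onI[OF cont])
  have ae: "AE x in lborel. ereal \<bar>g x\<bar> \<le> ?E"
    by (rule esssup_AE)
  have "?E \<le> ereal B" using bdd by (intro esssup_I) auto
  moreover have "?E \<noteq> -\<infinity>"
  proof
    assume "?E = -\<infinity>"
    hence "AE x in (lborel :: 'a measure). False" using ae by simp
    thus False by (simp add: eventually_False ae_filter_eq_bot_iff)
  qed
  ultimately obtain r where r: "?E = ereal r" by (cases ?E) auto
  hence "AE x in lborel. \<bar>g x\<bar> \<le> r" using ae by simp
  hence "\<bar>g x\<bar> \<le> r"
    using cont by (intro continuous_AE_le_imp_le[of "\<lambda>x. \<bar>g x\<bar>"] continuous_intros)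
  thus ?thesis by (simp add: Linf_norm_def r)
qed

subsection \<open>Dilation\<close>

context
  fixes \<phi> :: "'a::euclidean_space \<Rightarrow> real" and \<nu> :: real
  assumes \<nu>: "\<nu> > 0"
begin

lemma continuous_dilate:
  assumes cont: "continuous_on UNIV \<phi>"
  shows "continuous_on UNIV (dilate \<nu> \<phi>)"
proof -
  have "continuous_on UNIV (\<lambda>x. \<phi> (\<nu> *\<^sub>R x))"
    by (rule continuous_on_compose2[OF cont]) (auto intro!: continuous_intros)
  thus ?thesis unfolding dilate_def[abs_def] by (intro continuous_on_mult continuous_on_const)
qed

lemma borel_measurable_dilate:
  assumes [measurable]: "\<phi> \<in> borel_measurable borel"
  shows "dilate \<nu> \<phi> \<in> borel_measurable borel"
  unfolding dilate_def[abs_def] by measurable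

lemma prob_density_dilate:
  assumes "prob_density \<phi>"
  shows "prob_density (dilate \<nu> \<phi>)"
proof -
  have [measurable]: "\<phi> \<in> borel_measurable borel" and int: "integrable lborel \<phi>" "integral\<^sup>L lborel \<phi> = 1"
    using assms by (auto simp: prob_density_def)
  have "integrable lborel (\<lambda>x. \<phi> (\<nu> *\<^sub>R x))"
    using integrable_lborel_affine_iff[of \<phi> \<nu> 0] int \<nu> by simp
  moreover have "integral\<^sup>L lborel (dilate \<nu> \<phi>) = 1"
    using integral_lborel_affine[of \<phi> \<nu> 0] int \<nu> by (simp add: dilate_def[abs_def])
  ultimately show ?thesis
    using assms \<nu> by (auto simp: prob_density_def dilate_def[abs_def] intro!: mult_nonneg_nonneg)
qed

lemma dilate_le: "(\<And>x. \<phi> x \<le> B) \<Longrightarrow> dilate \<nu> \<phi> x \<le> \<nu> ^ DIM('a) * B"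
  using \<nu> by (simp add: dilate_def mult_left_mono)

lemma
  assumes "L2_fun \<phi>"
  shows integrable_dilate_sq: "integrable lborel (\<lambda>x. (dilate \<nu> \<phi> x)\<^sup>2)"
    and integral_dilate_sq: "(\<integral>x. (dilate \<nu> \<phi> x)\<^sup>2 \<partial>lborel) = \<nu> ^ DIM('a) * (\<integral>x. (\<phi> x)\<^sup>2 \<partial>lborel)"
proof -
  have [measurable]: "\<phi> \<in> borel_measurable borel" and int: "integrable lborel (\<lambda>x. (\<phi> x)\<^sup>2)"
    using assms by (auto simp: L2_fun_def)
  have "integrable lborel (\<lambda>x. (\<phi> (\<nu> *\<^sub>R x))\<^sup>2)"
    using integrable_lborel_affine_iff[of "\<lambda>x. (\<phi> x)\<^sup>2" \<nu> 0] int \<nu> by simp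
  thus "integrable lborel (\<lambda>x. (dilate \<nu> \<phi> x)\<^sup>2)"
    by (simp add: dilate_def power_mult_distrib)
  have "(\<integral>x. (\<phi> x)\<^sup>2 \<partial>lborel) = \<nu> ^ DIM('a) * (\<integral>x. (\<phi> (\<nu> *\<^sub>R x))\<^sup>2 \<partial>lborel)"
    using integral_lborel_affine[of "\<lambda>x. (\<phi> x)\<^sup>2" \<nu> 0] \<nu> by simp
  thus "(\<integral>x. (dilate \<nu> \<phi> x)\<^sup>2 \<partial>lborel) = \<nu> ^ DIM('a) * (\<integral>x. (\<phi> x)\<^sup>2 \<partial>lborel)"
    by (simp add: dilate_def power_mult_distrib) (simp add: power2_eq_square)
qed

lemma moment_dilate:
  assumes [measurable]: "\<phi> \<in> borel_measurable borel"
  shows "(\<integral>\<^sup>+x. ennreal (norm x powr s * dilate \<nu> \<phi> x) \<partial>lborel) =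
     ennreal (\<nu> powr (- s)) * (\<integral>\<^sup>+x. ennreal (norm x powr s * \<phi> x) \<partial>lborel)"
proof -
  have eq: "ennreal (norm x powr s * dilate \<nu> \<phi> x) =
      ennreal (\<nu> powr (- s) * \<nu> ^ DIM('a)) * ennreal (norm (0 + \<nu> *\<^sub>R x) powr s * \<phi> (0 + \<nu> *\<^sub>R x))" for x
    using \<nu> by (subst ennreal_mult'[symmetric])
      (auto simp: dilate_def powr_mult powr_minus field_simps)
  have "(\<integral>\<^sup>+x. ennreal (norm x powr s * dilate \<nu> \<phi> x) \<partial>lborel) =
      ennreal (\<nu> powr (- s) * \<nu> ^ DIM('a)) * (\<integral>\<^sup>+x. ennreal (norm (0 + \<nu> *\<^sub>R x) powr s * \<phi> (0 + \<nu> *\<^sub>R x)) \<partial>lborel)"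
    unfolding eq by (rule nn_integral_cmult) measurable
  also have "\<dots> = ennreal (\<nu> powr (- s)) * (ennreal (\<bar>\<nu>\<bar> ^ DIM('a)) * (\<integral>\<^sup>+x. ennreal (norm (0 + \<nu> *\<^sub>R x) powr s * \<phi> (0 + \<nu> *\<^sub>R x)) \<partial>lborel))"
    using \<nu> by (simp add: ennreal_mult mult.assoc)
  also have "\<dots> = ennreal (\<nu> powr (- s)) * (\<integral>\<^sup>+x. ennreal (norm x powr s * \<phi> x) \<partial>lborel)"
    using \<nu> by (subst nn_integral_lborel_affine[of "\<lambda>x. ennreal (norm x powr s * \<phi> x)" \<nu> 0]) auto
  finally show ?thesis .
qed

lemma fourier_dilate:
  assumes [measurable]: "\<phi> \<in> borel_measurable borel"
  shows "fourier (dilate \<nu> \<phi>) \<xi> = fourier \<phi> (\<xi> /\<^sub>R \<nu>)"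
proof -
  have dil: "(0 + \<nu> *\<^sub>R x) \<bullet> (\<xi> /\<^sub>R \<nu>) = x \<bullet> \<xi>" for x
    using \<nu> by simp
  have "(\<integral>x. cis (- (x \<bullet> (\<xi> /\<^sub>R \<nu>))) * complex_of_real (\<phi> x) \<partial>lborel) =
     (\<bar>\<nu>\<bar> ^ DIM('a)) *\<^sub>R (\<integral>x. cis (- ((0 + \<nu> *\<^sub>R x) \<bullet> (\<xi> /\<^sub>R \<nu>))) * complex_of_real (\<phi> (0 + \<nu> *\<^sub>R x)) \<partial>lborel)"
    using \<nu> by (intro integral_lborel_affine) auto
  also have "\<dots> = complex_of_real (\<nu> ^ DIM('a)) * (\<integral>x. cis (- (x \<bullet> \<xi>)) * complex_of_real (\<phi> (\<nu> *\<^sub>R x)) \<partial>lborel)"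
    using \<nu> unfolding dil by (simp add: scaleR_conv_of_real)
  also have "\<dots> = (\<integral>x. complex_of_real (\<nu> ^ DIM('a)) * (cis (- (x \<bullet> \<xi>)) * complex_of_real (\<phi> (\<nu> *\<^sub>R x))) \<partial>lborel)"
    by (rule integral_mult_right_zero[symmetric])
  also have "\<dots> = (\<integral>x. cis (- (x \<bullet> \<xi>)) * complex_of_real (dilate \<nu> \<phi> x) \<partial>lborel)"
    by (simp only: dilate_def of_real_mult mult.left_commute)
  finally show ?thesis by (simp add: fourier_cis)
qed

end

subsection \<open>Regularity of mixtures\<close>

text \<open>The properties that mixtures of translates of \<open>k\<close> share: convex combinations of translates keep
  the bounds of \<open>k\<close>, and a translation multiplies the Fourier transform by a factor of modulus 1.\<close>

definition kernel_like :: "('a::euclidean_space \<Rightarrow> real) \<Rightarrow> real \<Rightarrow> ('a \<Rightarrow> real) \<Rightarrow> bool" where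
  "kernel_like k B f \<longleftrightarrow> continuous_on UNIV f \<and> (\<forall>x. \<bar>f x\<bar> \<le> B) \<and> integrable lborel f \<and>
     (\<forall>\<xi>. norm (fourier f \<xi>) \<le> norm (fourier k \<xi>))"

lemma integrable_fourier_integrand:
  fixes f :: "'a::euclidean_space \<Rightarrow> real"
  assumes "integrable lborel f"
  shows "integrable lborel (\<lambda>x. cis (- (x \<bullet> \<xi>)) * complex_of_real (f x))"
  using assms by (intro integrable_cis_mult) auto

lemma fourier_translate:
  fixes k :: "'a::euclidean_space \<Rightarrow> real"
  assumes [measurable]: "k \<in> borel_measurable borel"
  shows "fourier (\<lambda>x. k (x - \<mu>)) \<xi> = cis (- (\<mu> \<bullet> \<xi>)) * fourier k \<xi>"
proof -
  have "(\<integral>x. cis (- (x \<bullet> \<xi>)) * complex_of_real (k (x - \<mu>)) \<partial>lborel) =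
     (\<integral>x. cis (- ((\<mu> + x) \<bullet> \<xi>)) * complex_of_real (k (\<mu> + x - \<mu>)) \<partial>lborel)"
    by (rule integral_lborel_translate[symmetric]) measurable
  also have "\<dots> = (\<integral>x. cis (- (\<mu> \<bullet> \<xi>)) * (cis (- (x \<bullet> \<xi>)) * complex_of_real (k x)) \<partial>lborel)"
    by (simp add: inner_add_left cis_mult flip: mult.assoc)
  also have "\<dots> = cis (- (\<mu> \<bullet> \<xi>)) * (\<integral>x. cis (- (x \<bullet> \<xi>)) * complex_of_real (k x) \<partial>lborel)"
    by (rule integral_mult_right_zero)
  finally show ?thesis by (simp add: fourier_cis mult.left_commute)
qed

lemma fourier_diff:
  fixes f g :: "'a::euclidean_space \<Rightarrow> real"
  assumes "integrable lborel f" "integrable lborel g"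
  shows "fourier (\<lambda>x. f x - g x) \<xi> = fourier f \<xi> - fourier g \<xi>"
  using integrable_fourier_integrand[OF assms(1)] integrable_fourier_integrand[OF assms(2)]
  by (simp add: fourier_cis right_diff_distrib)

lemma fourier_sum:
  fixes f :: "'i \<Rightarrow> 'a::euclidean_space \<Rightarrow> real"
  assumes "\<And>j. j \<in> J \<Longrightarrow> integrable lborel (f j)"
  shows "fourier (\<lambda>x. \<Sum>j\<in>J. w j * f j x) \<xi> = (\<Sum>j\<in>J. complex_of_real (w j) * fourier (f j) \<xi>)"
proof -
  have "(\<integral>x. cis (- (x \<bullet> \<xi>)) * complex_of_real (\<Sum>j\<in>J. w j * f j x) \<partial>lborel) =
    (\<integral>x. (\<Sum>j\<in>J. complex_of_real (w j) * (cis (- (x \<bullet> \<xi>)) * complex_of_real (f j x))) \<partial>lborel)"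
    by (simp add: sum_distrib_left mult_ac)
  also have "\<dots> = (\<Sum>j\<in>J. \<integral>x. complex_of_real (w j) * (cis (- (x \<bullet> \<xi>)) * complex_of_real (f j x)) \<partial>lborel)"
    by (intro Bochner_Integration.integral_sum integrable_mult_right integrable_fourier_integrand assms)
  also have "\<dots> = (\<Sum>j\<in>J. complex_of_real (w j) * (\<integral>x. cis (- (x \<bullet> \<xi>)) * complex_of_real (f j x) \<partial>lborel))"
    by (simp only: integral_mult_right_zero)
  finally show ?thesis by (simp add: fourier_cis sum_distrib_left mult_ac)
qed

lemma mixture_kernel_like:
  fixes k :: "'a::euclidean_space \<Rightarrow> real"
  assumes cont: "continuous_on UNIV k" and k: "prob_density k" and bdd: "\<And>x. k x \<le> B"
    and w: "\<And>j. j \<in> J \<Longrightarrow> 0 \<le> w j" "(\<Sum>j\<in>J. w j) = 1"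
  shows "kernel_like k B (\<lambda>x. \<Sum>j\<in>J. w j * k (x - \<mu> j))"
proof -
  have [measurable]: "k \<in> borel_measurable borel" and k0: "\<And>x. 0 \<le> k x" and ki: "integrable lborel k"
    using k by (auto simp: prob_density_def)
  have int: "integrable lborel (\<lambda>x. k (x - \<mu> j))" for j
    using integrable_lborel_affine_iff[of k 1 "- \<mu> j"] ki by simp
  have "continuous_on UNIV (\<lambda>x. \<Sum>j\<in>J. w j * k (x - \<mu> j))"
    by (intro continuous_intros continuous_on_compose2[OF cont]) auto
  moreover have "\<bar>\<Sum>j\<in>J. w j * k (x - \<mu> j)\<bar> \<le> B" for x
  proof -
    have "\<bar>\<Sum>j\<in>J. w j * k (x - \<mu> j)\<bar> = (\<Sum>j\<in>J. w j * k (x - \<mu> j))"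
      using w k0 by (intro abs_of_nonneg sum_nonneg) auto
    also have "\<dots> \<le> (\<Sum>j\<in>J. w j * B)" using w bdd by (intro sum_mono mult_left_mono) auto
    also have "\<dots> = B" using w by (simp flip: sum_distrib_right)
    finally show ?thesis .
  qed
  moreover have "integrable lborel (\<lambda>x. \<Sum>j\<in>J. w j * k (x - \<mu> j))" using int by simp
  moreover have "norm (fourier (\<lambda>x. \<Sum>j\<in>J. w j * k (x - \<mu> j)) \<xi>) \<le> norm (fourier k \<xi>)" for \<xi>
  proof -
    have "norm (fourier (\<lambda>x. \<Sum>j\<in>J. w j * k (x - \<mu> j)) \<xi>) \<le> (\<Sum>j\<in>J. w j * norm (fourier k \<xi>))"
      unfolding fourier_sum[of J "\<lambda>j x. k (x - \<mu> j)", OF int]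
      by (intro sum_norm_le) (use w in \<open>simp add: fourier_translate norm_mult\<close>)
    also have "\<dots> = norm (fourier k \<xi>)" using w by (simp flip: sum_distrib_right)
    finally show ?thesis .
  qed
  ultimately show ?thesis by (simp add: kernel_like_def)
qed

lemma integrable_sq_of_bounded:
  fixes f :: "'a::euclidean_space \<Rightarrow> real"
  assumes "integrable lborel f" "\<And>x. \<bar>f x\<bar> \<le> B"
  shows "integrable lborel (\<lambda>x. (f x)\<^sup>2)"
proof (rule Bochner_Integration.integrable_bound)
  show "integrable lborel (\<lambda>x. B * f x)" using assms by simp
  show "AE x in lborel. norm ((f x)\<^sup>2) \<le> norm (B * f x)"
  proof (intro AE_I2)
    fix x
    have "\<bar>f x\<bar> * \<bar>f x\<bar> \<le> \<bar>B\<bar> * \<bar>f x\<bar>"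
      using assms(2)[of x] by (intro mult_right_mono) auto
    thus "norm ((f x)\<^sup>2) \<le> norm (B * f x)" by (simp add: power2_eq_square abs_mult)
  qed
qed (use assms in measurable)

text \<open>An infimum of reals is a lower bound only for a set that is bounded below; here the criterion is
  at least \<open>- 2 * B\<close>.\<close>

lemma ls_criterion_near_minimal:
  fixes k :: "'a::euclidean_space \<Rightarrow> real"
  assumes like: "\<And>f. f \<in> F \<Longrightarrow> kernel_like k B f"
    and min: "ls_criterion n x fh \<le> (INF f\<in>F. ls_criterion n x f) + \<epsilon>" and f: "f \<in> F" and n: "n \<ge> 1"
  shows "ls_criterion n x fh \<le> ls_criterion n x f + \<epsilon>"
proof -
  have "bdd_below (ls_criterion n x ` F)"
  proof (rule bdd_belowI2)
    fix f assume "f \<in> F"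
    hence fB: "f (x i) \<le> B" for i using like by (fastforce simp: kernel_like_def abs_le_iff)
    have "(\<Sum>i=1..n. f (x i)) \<le> (\<Sum>i=1..n. B)" by (intro sum_mono fB)
    hence "empirical_mean n x f \<le> B"
      using n by (simp add: empirical_mean_def divide_le_eq mult.commute)
    moreover have "(\<integral>y. (f y)\<^sup>2 \<partial>lborel) \<ge> 0" by simp
    ultimately show "- 2 * B \<le> ls_criterion n x f" unfolding ls_criterion_def by linarith
  qed
  hence "(INF f\<in>F. ls_criterion n x f) \<le> ls_criterion n x f"
    using f by (rule cINF_lower)
  thus ?thesis using min by linarith
qed

section \<open>The localized empirical process in the Fourier domain\<close>

context iid_density
begin

text \<open>The error of the empirical mean of \<open>g\<close> is the pairing of the transform of \<open>g\<close> with the gap of the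
  characteristic functions. The normalizing constant is at most 1 and is dropped.\<close>

lemma empirical_process_fourier:
  fixes g :: "'a \<Rightarrow> real"
  assumes cont: "continuous_on UNIV g" and bdd: "\<And>x. \<bar>g x\<bar> \<le> B"
    and g: "integrable lborel g" and Fg: "integrable lborel (fourier g)"
    and \<omega>: "\<omega> \<in> space \<Omega>" and n: "n \<ge> 1"
  shows "ennreal \<bar>empirical_mean n (\<lambda>i. X i \<omega>) g - (\<integral>x. g x * f0 x \<partial>lborel)\<bar>
     \<le> (\<integral>\<^sup>+\<xi>. ennreal (norm (fourier g \<xi>) * norm (char_gap n \<omega> \<xi>)) \<partial>lborel)"
proof -
  let ?q = "(2 * pi) powr (- real DIM('a) / 2)"
  have [measurable]: "g \<in> borel_measurable borel" using g by auto
  note [measurable] = char_gap_measurable_snd[OF \<omega>]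
  have q: "0 \<le> ?q" "?q \<le> 1"
  proof -
    have "(2 * pi) powr (- real DIM('a) / 2) \<le> (2 * pi) powr 0"
      using pi_gt3 by (intro powr_mono) auto
    thus "?q \<le> 1" using pi_gt3 by simp
  qed simp
  have int1: "integrable lborel (\<lambda>\<xi>. cis (y \<bullet> \<xi>) * fourier g \<xi>)" for y
    using Fg by (intro integrable_cis_mult) auto
  have int2: "integrable lborel (\<lambda>\<xi>. fourier g \<xi> * (\<integral>x. cis (x \<bullet> \<xi>) * complex_of_real (f0 x) \<partial>lborel))"
  proof (rule Bochner_Integration.integrable_bound[OF Fg])
    show "AE \<xi> in lborel. norm (fourier g \<xi> * (\<integral>x. cis (x \<bullet> \<xi>) * complex_of_real (f0 x) \<partial>lborel)) \<le> norm (fourier g \<xi>)"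
    proof (intro AE_I2)
      fix \<xi>
      have "norm (\<integral>x. cis (x \<bullet> \<xi>) * complex_of_real (f0 x) \<partial>lborel) \<le> (\<integral>x. f0 x \<partial>lborel)"
        by (rule order_trans[OF integral_norm_bound]) (simp add: norm_mult f0_nonneg)
      thus "norm (fourier g \<xi> * (\<integral>x. cis (x \<bullet> \<xi>) * complex_of_real (f0 x) \<partial>lborel)) \<le> norm (fourier g \<xi>)"
        by (simp add: norm_mult f0_integral mult_left_le)
    qed
  qed measurable
  have "complex_of_real (empirical_mean n (\<lambda>i. X i \<omega>) g) =
      (\<Sum>i=1..n. ?q * (\<integral>\<xi>. cis (X i \<omega> \<bullet> \<xi>) * fourier g \<xi> \<partial>lborel)) / of_nat n"
    unfolding empirical_mean_def of_real_divide of_real_sum fourier_inversion[OF cont bdd g Fg] by simp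
  also have "\<dots> = ?q * ((\<integral>\<xi>. (\<Sum>i=1..n. cis (X i \<omega> \<bullet> \<xi>) * fourier g \<xi>) \<partial>lborel) / of_nat n)"
    by (subst Bochner_Integration.integral_sum) (auto intro: int1 simp: sum_distrib_left)
  also have "\<dots> = ?q * (\<integral>\<xi>. (\<Sum>i=1..n. cis (X i \<omega> \<bullet> \<xi>) * fourier g \<xi>) / of_nat n \<partial>lborel)"
    by simp
  also have "\<dots> - complex_of_real (\<integral>x. g x * f0 x \<partial>lborel) =
     ?q * ((\<integral>\<xi>. (\<Sum>i=1..n. cis (X i \<omega> \<bullet> \<xi>) * fourier g \<xi>) / of_nat n \<partial>lborel) -
       (\<integral>\<xi>. fourier g \<xi> * (\<integral>x. cis (x \<bullet> \<xi>) * complex_of_real (f0 x) \<partial>lborel) \<partial>lborel))"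
    unfolding integral_times_eq_fourier[OF cont bdd g Fg f0_integrable] by (simp only: right_diff_distrib)
  also have "\<dots> = ?q * (\<integral>\<xi>. (\<Sum>i=1..n. cis (X i \<omega> \<bullet> \<xi>) * fourier g \<xi>) / of_nat n -
       fourier g \<xi> * (\<integral>x. cis (x \<bullet> \<xi>) * complex_of_real (f0 x) \<partial>lborel) \<partial>lborel)"
    by (subst Bochner_Integration.integral_diff)
      (intro integrable_divide_zero Bochner_Integration.integrable_sum int1 int2 refl)+
  also have "\<dots> = ?q * (\<integral>\<xi>. fourier g \<xi> * char_gap n \<omega> \<xi> \<partial>lborel)"
  proof -
    have "(\<Sum>i=1..n. cis (X i \<omega> \<bullet> \<xi>) * fourier g \<xi>) / of_nat n -
        fourier g \<xi> * (\<integral>x. cis (x \<bullet> \<xi>) * complex_of_real (f0 x) \<partial>lborel) = fourier g \<xi> * char_gap n \<omega> \<xi>" for \<xi>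
      unfolding char_gap_def sum_distrib_right[symmetric] right_diff_distrib by simp
    thus ?thesis by (simp only:)
  qed
  finally have eq: "complex_of_real (empirical_mean n (\<lambda>i. X i \<omega>) g - (\<integral>x. g x * f0 x \<partial>lborel)) =
     ?q * (\<integral>\<xi>. fourier g \<xi> * char_gap n \<omega> \<xi> \<partial>lborel)" by simp
  have "\<bar>empirical_mean n (\<lambda>i. X i \<omega>) g - (\<integral>x. g x * f0 x \<partial>lborel)\<bar> =
      norm (complex_of_real (empirical_mean n (\<lambda>i. X i \<omega>) g - (\<integral>x. g x * f0 x \<partial>lborel)))"
    by (simp only: norm_of_real)
  also have "\<dots> \<le> norm (\<integral>\<xi>. fourier g \<xi> * char_gap n \<omega> \<xi> \<partial>lborel)"
    unfolding eq using q by (simp add: norm_mult mult_left_le_one_le)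
  finally have "ennreal \<bar>empirical_mean n (\<lambda>i. X i \<omega>) g - (\<integral>x. g x * f0 x \<partial>lborel)\<bar>
      \<le> ennreal (norm (\<integral>\<xi>. fourier g \<xi> * char_gap n \<omega> \<xi> \<partial>lborel))" by (rule ennreal_leI)
  also have "\<dots> \<le> (\<integral>\<^sup>+\<xi>. ennreal (norm (fourier g \<xi> * char_gap n \<omega> \<xi>)) \<partial>lborel)"
  proof (cases "integrable lborel (\<lambda>\<xi>. fourier g \<xi> * char_gap n \<omega> \<xi>)")
    case True thus ?thesis by (rule integral_norm_bound_ennreal)
  qed (simp add: not_integrable_integral_eq)
  finally show ?thesis by (simp add: norm_mult)
qed

definition low_freq :: "nat \<Rightarrow> real \<Rightarrow> 'w \<Rightarrow> ennreal" where
  "low_freq n R \<omega> = (\<integral>\<^sup>+\<xi>. indicator (cball 0 R) \<xi> * ennreal ((norm (char_gap n \<omega> \<xi>))\<^sup>2) \<partial>lborel)"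

definition high_freq :: "('a \<Rightarrow> real) \<Rightarrow> nat \<Rightarrow> real \<Rightarrow> 'w \<Rightarrow> ennreal" where
  "high_freq k n R \<omega> = (\<integral>\<^sup>+\<xi>. indicator (- cball 0 R) \<xi> * ennreal (norm (fourier k \<xi>)) *
      ennreal (norm (char_gap n \<omega> \<xi>)) \<partial>lborel)"

text \<open>At low frequencies the arithmetic-geometric mean inequality separates \<open>g\<close> from the sample, and
  the Plancherel identity turns the part with \<open>g\<close> into a quarter of its squared norm. At high frequencies
  the transform of \<open>g\<close> is bounded by twice that of \<open>k\<close>. The two random terms do not depend on \<open>f\<close>
  and \<open>fh\<close>, so the inequality is uniform over all mixtures.\<close>

lemma empirical_process_split:
  fixes k f fh :: "'a \<Rightarrow> real"
  assumes k: "integrable lborel k" and Fk: "integrable lborel (fourier k)"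
    and f: "kernel_like k B f" and fh: "kernel_like k B fh"
    and \<omega>: "\<omega> \<in> space \<Omega>" and n: "n \<ge> 1"
  defines "g \<equiv> \<lambda>x. fh x - f x"
  shows "ennreal (2 * \<bar>empirical_mean n (\<lambda>i. X i \<omega>) g - (\<integral>x. g x * f0 x \<partial>lborel)\<bar>)
     \<le> ennreal ((\<integral>x. (g x)\<^sup>2 \<partial>lborel) / 4) + 4 * low_freq n R \<omega> + 4 * high_freq k n R \<omega>"
proof -
  have int: "integrable lborel f" "integrable lborel fh" using f fh by (auto simp: kernel_like_def)
  have gi: "integrable lborel g" unfolding g_def using int by simp
  have [measurable]: "g \<in> borel_measurable borel" "k \<in> borel_measurable borel" using gi k by auto
  have [measurable]: "cball (0::'a) R \<in> sets borel" by (simp add: borel_closed)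
  note [measurable] = char_gap_measurable_snd[OF \<omega>]
  have cont: "continuous_on UNIV g"
    unfolding g_def using f fh by (intro continuous_intros) (auto simp: kernel_like_def)
  have bdd: "\<bar>g x\<bar> \<le> 2 * B" for x
  proof -
    have "\<bar>f x\<bar> \<le> B" "\<bar>fh x\<bar> \<le> B" using f fh by (auto simp: kernel_like_def)
    thus ?thesis unfolding g_def by linarith
  qed
  have Fg_le: "norm (fourier g \<xi>) \<le> 2 * norm (fourier k \<xi>)" for \<xi>
  proof -
    have "norm (fourier f \<xi>) \<le> norm (fourier k \<xi>)" "norm (fourier fh \<xi>) \<le> norm (fourier k \<xi>)"
      using f fh by (auto simp: kernel_like_def)
    thus ?thesis unfolding g_def fourier_diff[OF int(2,1)]
      using norm_triangle_ineq4[of "fourier fh \<xi>" "fourier f \<xi>"] by linarith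
  qed
  have Fg: "integrable lborel (fourier g)"
  proof (rule Bochner_Integration.integrable_bound)
    show "integrable lborel (\<lambda>\<xi>. 2 * norm (fourier k \<xi>))" using Fk by simp
  qed (use Fg_le in auto)
  let ?D = "\<lambda>\<xi>. norm (char_gap n \<omega> \<xi>)"
  have "ennreal (2 * \<bar>empirical_mean n (\<lambda>i. X i \<omega>) g - (\<integral>x. g x * f0 x \<partial>lborel)\<bar>) \<le>
      2 * (\<integral>\<^sup>+\<xi>. ennreal (norm (fourier g \<xi>) * ?D \<xi>) \<partial>lborel)"
    using empirical_process_fourier[OF cont bdd gi Fg \<omega> n] by (simp add: ennreal_mult mult_left_mono)
  also have "\<dots> = (\<integral>\<^sup>+\<xi>. 2 * ennreal (norm (fourier g \<xi>) * ?D \<xi>) \<partial>lborel)"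
    by (rule nn_integral_cmult[symmetric]) measurable
  also have "\<dots> \<le> (\<integral>\<^sup>+\<xi>. ennreal ((norm (fourier g \<xi>))\<^sup>2 / 4) +
      4 * (indicator (cball 0 R) \<xi> * ennreal ((?D \<xi>)\<^sup>2)) +
      4 * (indicator (- cball 0 R) \<xi> * ennreal (norm (fourier k \<xi>)) * ennreal (?D \<xi>)) \<partial>lborel)"
  proof (intro nn_integral_mono)
    fix \<xi> :: 'a
    let ?a = "norm (fourier g \<xi>)"
    show "2 * ennreal (?a * ?D \<xi>) \<le> ennreal (?a\<^sup>2 / 4) +
      4 * (indicator (cball 0 R) \<xi> * ennreal ((?D \<xi>)\<^sup>2)) +
      4 * (indicator (- cball 0 R) \<xi> * ennreal (norm (fourier k \<xi>)) * ennreal (?D \<xi>))"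
    proof (cases "\<xi> \<in> cball 0 R")
      case True
      have "0 \<le> (?a / 2 - 2 * ?D \<xi>)\<^sup>2" by simp
      hence "2 * (?a * ?D \<xi>) \<le> ?a\<^sup>2 / 4 + 4 * (?D \<xi>)\<^sup>2" by (simp add: power2_diff power_divide power_mult_distrib)
      hence "ennreal (2 * (?a * ?D \<xi>)) \<le> ennreal (?a\<^sup>2 / 4 + 4 * (?D \<xi>)\<^sup>2)" by (rule ennreal_leI)
      thus ?thesis using True by (simp add: ennreal_mult ennreal_plus)
    next
      case False
      have "2 * (?a * ?D \<xi>) \<le> 2 * ((2 * norm (fourier k \<xi>)) * ?D \<xi>)"
        by (intro mult_left_mono mult_right_mono Fg_le) auto
      hence "ennreal (2 * (?a * ?D \<xi>)) \<le> ennreal (4 * (norm (fourier k \<xi>) * ?D \<xi>))" by (intro ennreal_leI) simp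
      also have "\<dots> \<le> ennreal (?a\<^sup>2 / 4) + ennreal (4 * (norm (fourier k \<xi>) * ?D \<xi>))" by simp
      finally show ?thesis using False by (simp add: ennreal_mult)
    qed
  qed
  also have "\<dots> = (\<integral>\<^sup>+\<xi>. ennreal ((norm (fourier g \<xi>))\<^sup>2 / 4) \<partial>lborel) + 4 * low_freq n R \<omega> + 4 * high_freq k n R \<omega>"
    unfolding low_freq_def high_freq_def by (simp add: nn_integral_add nn_integral_cmult)
  also have "(\<integral>\<^sup>+\<xi>. ennreal ((norm (fourier g \<xi>))\<^sup>2 / 4) \<partial>lborel) = ennreal (\<integral>\<xi>. (norm (fourier g \<xi>))\<^sup>2 / 4 \<partial>lborel)"
    by (rule nn_integral_eq_integral) (use integrable_norm_fourier_sq[OF gi Fg] in auto)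
  also have "(\<integral>\<xi>. (norm (fourier g \<xi>))\<^sup>2 / 4 \<partial>lborel) = (\<integral>x. (g x)\<^sup>2 \<partial>lborel) / 4"
    by (simp add: plancherel[OF cont bdd gi Fg])
  finally show ?thesis .
qed

text \<open>The quarter of \<open>\<integral>(fh - f)\<^sup>2\<close> produced by the split is at most half the sum of the two squared
  distances to \<open>f0\<close>; absorbing half of the squared distance of \<open>fh\<close> into the left-hand side doubles
  the remaining terms.\<close>

lemma pathwise_risk_inequality:
  fixes k f fh :: "'a \<Rightarrow> real"
  assumes k: "integrable lborel k" and Fk: "integrable lborel (fourier k)"
    and f: "kernel_like k B f" and fh: "kernel_like k B fh" and f0: "L2_fun f0"
    and \<omega>: "\<omega> \<in> space \<Omega>" and n: "n \<ge> 1" and \<epsilon>: "\<epsilon> \<ge> 0"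
    and min: "ls_criterion n (\<lambda>i. X i \<omega>) fh \<le> ls_criterion n (\<lambda>i. X i \<omega>) f + \<epsilon>"
  shows "L2_dist_sq fh f0 \<le> 3 * L2_dist_sq f f0 + 2 * ennreal \<epsilon> + 8 * low_freq n R \<omega> + 8 * high_freq k n R \<omega>"
proof -
  have int: "integrable lborel f" "integrable lborel fh" and bdd: "\<And>x. \<bar>f x\<bar> \<le> B" "\<And>x. \<bar>fh x\<bar> \<le> B"
    using f fh by (auto simp: kernel_like_def)
  have [measurable]: "f \<in> borel_measurable borel" "fh \<in> borel_measurable borel" using int by auto
  have sq: "integrable lborel (\<lambda>x. (f x)\<^sup>2)" "integrable lborel (\<lambda>x. (fh x)\<^sup>2)" "integrable lborel (\<lambda>x. (f0 x)\<^sup>2)"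
    using integrable_sq_of_bounded[OF int(1) bdd(1)] integrable_sq_of_bounded[OF int(2) bdd(2)] f0
    by (auto simp: L2_fun_def)
  have prods: "integrable lborel (\<lambda>x. f x * f0 x)" "integrable lborel (\<lambda>x. fh x * f0 x)" "integrable lborel (\<lambda>x. fh x * f x)"
    using sq by (auto intro!: integrable_mult_of_sq)
  define a where "a = (\<integral>x. (fh x - f0 x)\<^sup>2 \<partial>lborel)"
  define b where "b = (\<integral>x. (f x - f0 x)\<^sup>2 \<partial>lborel)"
  define c where "c = (\<integral>x. (fh x - f x)\<^sup>2 \<partial>lborel)"
  have diffs: "integrable lborel (\<lambda>x. (fh x - f0 x)\<^sup>2)" "integrable lborel (\<lambda>x. (f x - f0 x)\<^sup>2)"
    "integrable lborel (\<lambda>x. (fh x - f x)\<^sup>2)"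
    using sq prods by (simp_all add: power2_diff mult.assoc)
  have ab0: "a \<ge> 0" "b \<ge> 0" "c \<ge> 0" by (simp_all add: a_def b_def c_def)
  have L2: "L2_dist_sq fh f0 = ennreal a" "L2_dist_sq f f0 = ennreal b"
    unfolding L2_dist_sq_def a_def b_def by (intro nn_integral_eq_integral diffs; simp)+
  have c: "c \<le> 2 * a + 2 * b"
  proof -
    have "c \<le> (\<integral>x. 2 * (fh x - f0 x)\<^sup>2 + 2 * (f x - f0 x)\<^sup>2 \<partial>lborel)"
      unfolding c_def
    proof (rule integral_mono)
      show "(fh x - f x)\<^sup>2 \<le> 2 * (fh x - f0 x)\<^sup>2 + 2 * (f x - f0 x)\<^sup>2" for x
        using square_sum_le[of "fh x - f0 x" "f0 x - f x"] by (simp add: power2_commute[of "f0 x"])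
    qed (use diffs in auto)
    also have "\<dots> = 2 * a + 2 * b" unfolding a_def b_def using diffs by simp
    finally show ?thesis .
  qed
  define e where "e = \<bar>empirical_mean n (\<lambda>i. X i \<omega>) (\<lambda>x. fh x - f x) - (\<integral>x. (fh x - f x) * f0 x \<partial>lborel)\<bar>"
  have basic: "a \<le> b + 2 * e + \<epsilon>"
  proof -
    have "a = (\<integral>x. (fh x)\<^sup>2 \<partial>lborel) - 2 * (\<integral>x. fh x * f0 x \<partial>lborel) + (\<integral>x. (f0 x)\<^sup>2 \<partial>lborel)"
      unfolding a_def power2_diff mult.assoc using sq prods by simp
    moreover have "b = (\<integral>x. (f x)\<^sup>2 \<partial>lborel) - 2 * (\<integral>x. f x * f0 x \<partial>lborel) + (\<integral>x. (f0 x)\<^sup>2 \<partial>lborel)"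
      unfolding b_def power2_diff mult.assoc using sq prods by simp
    moreover have "(\<integral>x. (fh x - f x) * f0 x \<partial>lborel) = (\<integral>x. fh x * f0 x \<partial>lborel) - (\<integral>x. f x * f0 x \<partial>lborel)"
      unfolding left_diff_distrib using prods by simp
    moreover have "empirical_mean n (\<lambda>i. X i \<omega>) (\<lambda>x. fh x - f x) =
       empirical_mean n (\<lambda>i. X i \<omega>) fh - empirical_mean n (\<lambda>i. X i \<omega>) f"
      by (simp add: empirical_mean_def sum_subtractf diff_divide_distrib)
    moreover have "empirical_mean n (\<lambda>i. X i \<omega>) (\<lambda>x. fh x - f x) - (\<integral>x. (fh x - f x) * f0 x \<partial>lborel) \<le> e"
      unfolding e_def by (rule abs_ge_self)
    ultimately show ?thesis using min unfolding ls_criterion_def by linarith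
  qed
  have split: "ennreal (2 * e) \<le> ennreal (c / 4) + 4 * low_freq n R \<omega> + 4 * high_freq k n R \<omega>"
    unfolding e_def c_def by (rule empirical_process_split[OF k Fk f fh \<omega> n])
  show ?thesis
  proof (cases "low_freq n R \<omega> = \<infinity> \<or> high_freq k n R \<omega> = \<infinity>")
    case True
    thus ?thesis by (auto simp: ennreal_mult_eq_top_iff ennreal_top_mult)
  next
    case False
    then obtain u v where uv: "low_freq n R \<omega> = ennreal u" "high_freq k n R \<omega> = ennreal v" "u \<ge> 0" "v \<ge> 0"
      by (cases "low_freq n R \<omega>"; cases "high_freq k n R \<omega>") auto
    have "ennreal (2 * e) \<le> ennreal (c / 4 + 4 * u + 4 * v)"
      using split uv ab0 by (simp add: ennreal_plus ennreal_mult)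
    moreover have "0 \<le> c / 4 + 4 * u + 4 * v" using uv ab0 by simp
    ultimately have "2 * e \<le> c / 4 + 4 * u + 4 * v" by (simp only: ennreal_le_iff)
    hence "a \<le> 3 * b + 2 * \<epsilon> + 8 * u + 8 * v" using basic c by linarith
    hence "ennreal a \<le> ennreal (3 * b + 2 * \<epsilon> + 8 * u + 8 * v)" by (rule ennreal_leI)
    thus ?thesis using uv ab0 \<epsilon> unfolding L2 by (simp add: ennreal_plus ennreal_mult)
  qed
qed

lemma low_freq_measurable [measurable]: "low_freq n R \<in> borel_measurable \<Omega>"
  and high_freq_measurable: "k \<in> borel_measurable borel \<Longrightarrow> high_freq k n R \<in> borel_measurable \<Omega>"
proof -
  have [measurable]: "cball (0::'a) R \<in> sets borel" by (simp add: borel_closed)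
  show "low_freq n R \<in> borel_measurable \<Omega>" unfolding low_freq_def[abs_def] by measurable
  assume [measurable]: "k \<in> borel_measurable borel"
  show "high_freq k n R \<in> borel_measurable \<Omega>" unfolding high_freq_def[abs_def] by measurable
qed

lemma expected_low_freq:
  assumes n: "n \<ge> 1" and R: "R \<ge> 0"
  shows "(\<integral>\<^sup>+\<omega>. low_freq n R \<omega> \<partial>\<Omega>) \<le> ennreal (unit_ball_vol DIM('a) * R ^ DIM('a) / n)"
proof -
  interpret P: pair_sigma_finite \<Omega> "lborel :: 'a measure" ..
  have [measurable]: "cball (0::'a) R \<in> sets borel" by (simp add: borel_closed)
  have [measurable]: "(\<lambda>\<omega>. char_gap n \<omega> \<xi>) \<in> borel_measurable \<Omega>" for \<xi>
    using measurable_Pair1[OF char_gap_measurable[of n], of \<xi>] by simp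
  let ?D = "\<lambda>\<omega> \<xi>. ennreal ((norm (char_gap n \<omega> \<xi>))\<^sup>2)"
  have "(\<integral>\<^sup>+\<omega>. low_freq n R \<omega> \<partial>\<Omega>) = (\<integral>\<^sup>+\<xi>. (\<integral>\<^sup>+\<omega>. indicator (cball 0 R) \<xi> * ?D \<omega> \<xi> \<partial>\<Omega>) \<partial>lborel)"
    unfolding low_freq_def by (rule P.Fubini'[symmetric]) measurable
  also have "\<dots> = (\<integral>\<^sup>+\<xi>. indicator (cball 0 R) \<xi> * (\<integral>\<^sup>+\<omega>. ?D \<omega> \<xi> \<partial>\<Omega>) \<partial>lborel)"
    by (intro nn_integral_cong nn_integral_cmult) measurable
  also have "\<dots> \<le> (\<integral>\<^sup>+\<xi>. indicator (cball (0::'a) R) \<xi> * ennreal (1 / n) \<partial>lborel)"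
    by (intro nn_integral_mono mult_left_mono char_gap_second_moment n) auto
  also have "\<dots> = emeasure lborel (cball (0::'a) R) * ennreal (1 / n)"
    by (subst nn_integral_multc) auto
  also have "\<dots> = ennreal (unit_ball_vol DIM('a) * R ^ DIM('a) / n)"
    using R by (simp add: emeasure_cball flip: ennreal_mult)
  finally show ?thesis .
qed

lemma expected_high_freq:
  fixes k :: "'a \<Rightarrow> real"
  assumes n: "n \<ge> 1" and [measurable]: "k \<in> borel_measurable borel"
  shows "(\<integral>\<^sup>+\<omega>. high_freq k n R \<omega> \<partial>\<Omega>) \<le>
    (\<integral>\<^sup>+\<xi>. indicator (- cball 0 R) \<xi> * ennreal (norm (fourier k \<xi>)) \<partial>lborel) * ennreal (1 / sqrt n)"
proof -
  interpret P: pair_sigma_finite \<Omega> "lborel :: 'a measure" ..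
  have [measurable]: "cball (0::'a) R \<in> sets borel" by (simp add: borel_closed)
  have [measurable]: "(\<lambda>\<omega>. char_gap n \<omega> \<xi>) \<in> borel_measurable \<Omega>" for \<xi>
    using measurable_Pair1[OF char_gap_measurable[of n], of \<xi>] by simp
  let ?t = "\<lambda>\<xi>. indicator (- cball 0 R) \<xi> * ennreal (norm (fourier k \<xi>))"
  let ?D = "\<lambda>\<omega> \<xi>. ennreal (norm (char_gap n \<omega> \<xi>))"
  have "(\<integral>\<^sup>+\<omega>. high_freq k n R \<omega> \<partial>\<Omega>) = (\<integral>\<^sup>+\<xi>. (\<integral>\<^sup>+\<omega>. ?t \<xi> * ?D \<omega> \<xi> \<partial>\<Omega>) \<partial>lborel)"
    unfolding high_freq_def by (rule P.Fubini'[symmetric]) measurable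
  also have "\<dots> = (\<integral>\<^sup>+\<xi>. ?t \<xi> * (\<integral>\<^sup>+\<omega>. ?D \<omega> \<xi> \<partial>\<Omega>) \<partial>lborel)"
    by (intro nn_integral_cong nn_integral_cmult) measurable
  also have "\<dots> \<le> (\<integral>\<^sup>+\<xi>. ?t \<xi> * ennreal (1 / sqrt n) \<partial>lborel)"
    by (intro nn_integral_mono mult_left_mono char_gap_first_moment n) auto
  also have "\<dots> = (\<integral>\<^sup>+\<xi>. ?t \<xi> \<partial>lborel) * ennreal (1 / sqrt n)"
    by (rule nn_integral_multc) measurable
  finally show ?thesis .
qed

end

section \<open>The risk bound\<close>

text \<open>Through a point where \<open>\<phi>\<close> is positive this lets \<open>sup_bound\<close> replace \<open>\<nu> ^ d\<close> in the general bounds.\<close>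

lemma sup_bound_ge:
  fixes \<phi> :: "'a::euclidean_space \<Rightarrow> real"
  assumes \<nu>: "\<nu> > 0" and cont: "continuous_on UNIV \<phi>" and bdd: "\<And>x. \<bar>\<phi> x\<bar> \<le> B"
  shows "\<nu> ^ DIM('a) * \<phi> x \<le> sup_bound f0 \<phi> \<nu>"
proof -
  have "\<bar>dilate \<nu> \<phi> y\<bar> \<le> \<nu> ^ DIM('a) * B" for y
    using \<nu> bdd by (simp add: dilate_def abs_mult mult_left_mono)
  from le_Linf_norm[OF continuous_dilate[OF \<nu> cont] this, of "x /\<^sub>R \<nu>"]
  have "\<bar>\<nu> ^ DIM('a) * \<phi> x\<bar> \<le> Linf_norm (dilate \<nu> \<phi>)"
    using \<nu> unfolding dilate_def[of _ _ "x /\<^sub>R \<nu>"] by simp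
  thus ?thesis unfolding sup_bound_def by linarith
qed

lemma prob_density_pos_somewhere:
  fixes \<phi> :: "'a::euclidean_space \<Rightarrow> real"
  assumes "prob_density \<phi>"
  obtains x where "\<phi> x > 0"
proof -
  have "\<exists>x. \<phi> x > 0"
  proof (rule ccontr)
    assume "\<nexists>x. \<phi> x > 0"
    hence "\<phi> = (\<lambda>_. 0)" using assms by (auto simp: prob_density_def fun_eq_iff not_less intro: antisym)
    thus False using assms by (simp add: prob_density_def)
  qed
  thus ?thesis using that by blast
qed

definition fourier_tail :: "('a::euclidean_space \<Rightarrow> real) \<Rightarrow> real \<Rightarrow> ennreal" where
  "fourier_tail \<phi> T = (\<integral>\<^sup>+\<xi>. indicator (- cball 0 T) \<xi> * ennreal (norm (fourier \<phi> \<xi>)) \<partial>lborel)"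

lemma fourier_tail_dilate:
  fixes \<phi> :: "'a::euclidean_space \<Rightarrow> real"
  assumes \<nu>: "\<nu> > 0" and [measurable]: "\<phi> \<in> borel_measurable borel"
  shows "fourier_tail (dilate \<nu> \<phi>) (\<nu> * T) = ennreal (\<nu> ^ DIM('a)) * fourier_tail \<phi> T"
proof -
  have [measurable]: "cball (0::'a) R \<in> sets borel" for R by (simp add: borel_closed)
  have [measurable]: "dilate \<nu> \<phi> \<in> borel_measurable borel" by (rule borel_measurable_dilate[OF \<nu>]) measurable
  have "fourier_tail (dilate \<nu> \<phi>) (\<nu> * T) = ennreal (\<bar>\<nu>\<bar> ^ DIM('a)) *
     (\<integral>\<^sup>+\<xi>. indicator (- cball 0 (\<nu> * T)) (0 + \<nu> *\<^sub>R \<xi>) * ennreal (norm (fourier (dilate \<nu> \<phi>) (0 + \<nu> *\<^sub>R \<xi>))) \<partial>lborel)"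
    unfolding fourier_tail_def using \<nu>
    by (intro nn_integral_lborel_affine[of "\<lambda>\<xi>. indicator (- cball 0 (\<nu> * T)) \<xi> * ennreal (norm (fourier (dilate \<nu> \<phi>) \<xi>))"]) auto
  also have "(\<integral>\<^sup>+\<xi>. indicator (- cball 0 (\<nu> * T)) (0 + \<nu> *\<^sub>R \<xi>) * ennreal (norm (fourier (dilate \<nu> \<phi>) (0 + \<nu> *\<^sub>R \<xi>))) \<partial>lborel) = fourier_tail \<phi> T"
    unfolding fourier_tail_def fourier_dilate[OF \<nu> assms(2)] using \<nu>
    by (intro nn_integral_cong) (auto simp: indicator_def)
  finally show ?thesis using \<nu> by simp
qed

lemma mixturesE:
  assumes "f \<in> mixtures \<phi> m \<nu>"
  obtains w \<mu> where "f = (\<lambda>x. \<Sum>j=1..m. w j * dilate \<nu> \<phi> (x - \<mu> j))"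
    "\<And>j. j \<in> {1..m} \<Longrightarrow> 0 \<le> w j" "(\<Sum>j=1..m. w j) = 1"
  using assms by (auto simp: mixtures_def)

text \<open>The competitor is the mixture centred at the first \<open>m\<close> observations. It depends on the sample,
  which is harmless because the pathwise inequality holds for all competitors simultaneously. The
  frequency cutoff \<open>\<nu> * T\<close> scales with the kernel.\<close>

lemma (in iid_density) risk_bound:
  fixes \<phi> :: "'a \<Rightarrow> real"
  assumes \<phi>: "L2_fun \<phi>" "prob_density \<phi>" "continuous_on UNIV \<phi>" "\<And>x. \<phi> x \<le> B"
    and F\<phi>: "integrable lborel (fourier \<phi>)"
    and moment: "(\<integral>\<^sup>+ x. ennreal (norm x powr s * \<phi> x) \<partial>lborel) \<le> ennreal K"
    and f0: "L2_fun f0" and gap: "\<And>y. translation_gap f0 y \<le> ennreal (L * norm y powr (2 * s))" and L: "L \<ge> 0"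
    and est: "ls_estimator \<phi> \<Omega> X n m \<nu> \<epsilon> fhat"
    and pars: "1 \<le> m" "0 < \<nu>" "0 \<le> \<epsilon>" "1 \<le> n" "0 \<le> T" "0 \<le> \<tau>" "0 \<le> K"
    and tail: "fourier_tail \<phi> T \<le> ennreal (\<tau> / sqrt (real n))"
  shows "risk \<Omega> fhat f0 \<le> ennreal (6 * (\<integral>x. (\<phi> x)\<^sup>2 \<partial>lborel) * (\<nu> ^ DIM('a) / real m) + 6 * (L * K\<^sup>2) * \<nu> powr (- 2 * s)
     + 2 * \<epsilon> + (8 * unit_ball_vol DIM('a) * T ^ DIM('a) + 8 * \<tau>) * (\<nu> ^ DIM('a) / real n))"
proof -
  let ?d = "DIM('a)" and ?G = "\<integral>x. (\<phi> x)\<^sup>2 \<partial>lborel"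
  note \<nu> = \<open>0 < \<nu>\<close>
  have \<phi>b [measurable]: "\<phi> \<in> borel_measurable borel" using \<phi>(1) by (simp add: L2_fun_def)
  define k where "k = dilate \<nu> \<phi>"
  have k: "prob_density k" "continuous_on UNIV k"
    unfolding k_def using \<phi> by (auto intro: prob_density_dilate[OF \<nu>] continuous_dilate[OF \<nu>])
  have kb [measurable]: "k \<in> borel_measurable borel" and ki: "integrable lborel k" and k0: "\<And>x. 0 \<le> k x"
    using k by (auto simp: prob_density_def)
  have kB: "k x \<le> \<nu> ^ ?d * B" for x unfolding k_def by (rule dilate_le[OF \<nu> \<phi>(4)])
  have Fk: "integrable lborel (fourier k)"
    using integrable_lborel_affine_iff[of "fourier \<phi>" "inverse \<nu>" 0] F\<phi> \<nu>
    by (simp add: k_def fourier_dilate[OF \<nu> \<phi>b, abs_def])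
  define f where "f \<omega> = (\<lambda>x. \<Sum>j=1..m. 1 / real m * k (x - X j \<omega>))" for \<omega>
  have f_mix: "f \<omega> \<in> mixtures \<phi> m \<nu>" for \<omega>
    unfolding mixtures_def f_def k_def using pars by (auto intro!: exI[of _ "\<lambda>_. 1 / real m"] exI[of _ "\<lambda>j. X j \<omega>"])
  have like: "kernel_like k (\<nu> ^ ?d * B) g" if "g \<in> mixtures \<phi> m \<nu>" for g
  proof -
    from that obtain w \<mu> where g: "g = (\<lambda>x. \<Sum>j=1..m. w j * k (x - \<mu> j))"
      and w: "\<And>j. j \<in> {1..m} \<Longrightarrow> 0 \<le> w j" "(\<Sum>j=1..m. w j) = 1"
      unfolding k_def by (elim mixturesE) blast
    show ?thesis unfolding g by (rule mixture_kernel_like[OF k(2,1) kB w])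
  qed
  define R where "R = \<nu> * T"
  have pathwise: "L2_dist_sq (fhat \<omega>) f0 \<le> 3 * L2_dist_sq (f \<omega>) f0 + 2 * ennreal \<epsilon> + 8 * low_freq n R \<omega> + 8 * high_freq k n R \<omega>"
    if \<omega>: "\<omega> \<in> space \<Omega>" for \<omega>
  proof (rule pathwise_risk_inequality[OF ki Fk like[OF f_mix] like f0 \<omega> _ \<open>0 \<le> \<epsilon>\<close>])
    show "fhat \<omega> \<in> mixtures \<phi> m \<nu>" using est \<omega> by (simp add: ls_estimator_def)
    show "ls_criterion n (\<lambda>i. X i \<omega>) (fhat \<omega>) \<le> ls_criterion n (\<lambda>i. X i \<omega>) (f \<omega>) + \<epsilon>"
      by (rule ls_criterion_near_minimal[OF like _ f_mix \<open>1 \<le> n\<close>]) (use est \<omega> in \<open>auto simp: ls_estimator_def\<close>)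
  qed (use pars in auto)
  have [measurable]: "X i \<in> borel_measurable \<Omega>" if "i \<in> {1..m}" for i
    using that by (intro X_measurable) simp
  have [measurable]: "(\<lambda>\<omega>. L2_dist_sq (f \<omega>) f0) \<in> borel_measurable \<Omega>"
    unfolding L2_dist_sq_def f_def by measurable
  have [measurable]: "high_freq k n R \<in> borel_measurable \<Omega>" by (rule high_freq_measurable[OF kb])
  let ?b = "L * (\<nu> powr (- s) * K)\<^sup>2" and ?v = "\<nu> ^ ?d * ?G / real m"
  let ?h = "\<nu> ^ ?d * (\<tau> / sqrt n) * (1 / sqrt n)"
  let ?A = "\<integral>\<^sup>+\<omega>. L2_dist_sq (f \<omega>) f0 \<partial>\<Omega>"
  have "risk \<Omega> fhat f0 \<le> (\<integral>\<^sup>+\<omega>. 3 * L2_dist_sq (f \<omega>) f0 + 2 * ennreal \<epsilon> + 8 * low_freq n R \<omega> + 8 * high_freq k n R \<omega> \<partial>\<Omega>)"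
    unfolding risk_def by (intro nn_integral_mono pathwise)
  also have "\<dots> = 3 * ?A + 2 * ennreal \<epsilon> +
      8 * (\<integral>\<^sup>+\<omega>. low_freq n R \<omega> \<partial>\<Omega>) + 8 * (\<integral>\<^sup>+\<omega>. high_freq k n R \<omega> \<partial>\<Omega>)"
    by (simp add: nn_integral_add nn_integral_cmult emeasure_space_1)
  also have "\<dots> \<le> 3 * ennreal (2 * ?v + 2 * ?b) + 2 * ennreal \<epsilon> +
      8 * ennreal (unit_ball_vol ?d * R ^ ?d / n) + 8 * ennreal ?h"
  proof (intro add_mono mult_left_mono order_refl)
    let ?B = "\<integral>\<^sup>+x. ennreal (((\<integral>y. f0 y * k (x - y) \<partial>lborel) - f0 x)\<^sup>2) \<partial>lborel"
    let ?m = "\<integral>\<^sup>+y. ennreal (norm y powr s * k y) \<partial>lborel"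
    have "?m \<le> ennreal (\<nu> powr (- s)) * ennreal K"
      unfolding k_def moment_dilate[OF \<nu> \<phi>b] by (intro mult_left_mono moment) simp
    also have "\<dots> = ennreal (\<nu> powr (- s) * K)" using pars by (simp add: ennreal_mult)
    finally have "?m\<^sup>2 \<le> (ennreal (\<nu> powr (- s) * K))\<^sup>2"
      by (rule power_mono) simp
    hence "?B \<le> ennreal L * (ennreal (\<nu> powr (- s) * K))\<^sup>2"
      by (intro order_trans[OF bias_bound[OF k(1) kB gap L]] mult_left_mono) auto
    also have "\<dots> = ennreal ?b"
    proof -
      have "0 \<le> \<nu> powr (- s) * K" using pars by simp
      thus ?thesis by (simp only: ennreal_power ennreal_mult[OF L zero_le_power2])
    qed
    finally have bias: "?B \<le> ennreal ?b" .
    have "?A \<le> 2 * ennreal ((\<integral>x. (k x)\<^sup>2 \<partial>lborel) / real m) + 2 * ennreal ?b"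
      unfolding f_def
    proof (rule random_mixture_bound[OF kb _ _ \<open>1 \<le> m\<close> bias])
      show "\<bar>k x\<bar> \<le> \<nu> ^ ?d * B" for x using kB k0 by simp
      show "integrable lborel (\<lambda>x. (k x)\<^sup>2)" unfolding k_def by (rule integrable_dilate_sq[OF \<nu> \<phi>(1)])
    qed
    also have "\<dots> = ennreal (2 * ?v + 2 * ?b)"
    proof -
      have "2 * ennreal u + 2 * ennreal v = ennreal (2 * u + 2 * v)" if "0 \<le> u" "0 \<le> v" for u v
        using that by (simp add: ennreal_plus ennreal_mult)
      thus ?thesis unfolding k_def integral_dilate_sq[OF \<nu> \<phi>(1)] using \<nu> L by simp
    qed
    finally show "?A \<le> ennreal (2 * ?v + 2 * ?b)" .
    show "(\<integral>\<^sup>+\<omega>. low_freq n R \<omega> \<partial>\<Omega>) \<le> ennreal (unit_ball_vol ?d * R ^ ?d / n)"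
      using pars by (intro expected_low_freq) (auto simp: R_def)
    have "(\<integral>\<^sup>+\<omega>. high_freq k n R \<omega> \<partial>\<Omega>) \<le> fourier_tail k R * ennreal (1 / sqrt n)"
      unfolding fourier_tail_def by (rule expected_high_freq[OF \<open>1 \<le> n\<close> kb])
    also have "\<dots> \<le> (ennreal (\<nu> ^ ?d) * ennreal (\<tau> / sqrt n)) * ennreal (1 / sqrt n)"
      unfolding R_def k_def fourier_tail_dilate[OF \<nu> \<phi>b] by (intro mult_right_mono mult_left_mono tail) auto
    also have "\<dots> = ennreal ?h"
    proof -
      have "0 \<le> \<nu> ^ ?d" "0 \<le> \<tau> / sqrt n" "0 \<le> 1 / sqrt n" using pars by simp_all
      thus ?thesis by (simp only: ennreal_mult mult_nonneg_nonneg)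
    qed
    finally show "(\<integral>\<^sup>+\<omega>. high_freq k n R \<omega> \<partial>\<Omega>) \<le> ennreal ?h" .
  qed auto
  also have "\<dots> = ennreal (3 * (2 * ?v + 2 * ?b) + 2 * \<epsilon> +
      8 * (unit_ball_vol ?d * R ^ ?d / n) + 8 * ?h)"
  proof -
    have "0 \<le> 2 * ?v + 2 * ?b" "0 \<le> unit_ball_vol ?d * R ^ ?d / n"
      "0 \<le> \<nu> ^ ?d * (\<tau> / sqrt n) * (1 / sqrt n)"
      using pars L by (auto simp: R_def)
    thus ?thesis using \<open>0 \<le> \<epsilon>\<close> by (simp only: ennreal_plus ennreal_mult ennreal_numeral zero_le_numeral add_nonneg_nonneg mult_nonneg_nonneg)
  qed
  also have "3 * (2 * ?v + 2 * ?b) + 2 * \<epsilon> +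
      8 * (unit_ball_vol ?d * R ^ ?d / n) + 8 * ?h =
      6 * ?G * (\<nu> ^ ?d / real m) + 6 * (L * K\<^sup>2) * \<nu> powr (- 2 * s)
     + 2 * \<epsilon> + (8 * unit_ball_vol ?d * T ^ ?d + 8 * \<tau>) * (\<nu> ^ ?d / real n)"
  proof -
    have e1: "(\<nu> powr (- s) * K)\<^sup>2 = \<nu> powr (- 2 * s) * K\<^sup>2"
      by (simp add: power_mult_distrib power2_eq_square powr_add[symmetric])
    have e2: "\<nu> ^ ?d * (\<tau> / sqrt n) * (1 / sqrt n) = \<tau> * (\<nu> ^ ?d / n)"
      using pars by (simp add: field_simps)
    have e3: "unit_ball_vol ?d * R ^ ?d / n = unit_ball_vol ?d * T ^ ?d * (\<nu> ^ ?d / n)"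
      by (simp add: R_def power_mult_distrib)
    show ?thesis unfolding e1 e2 e3 by (simp add: algebra_simps)
  qed
  finally show ?thesis .
qed

section \<open>Rates\<close>

text \<open>The function is dominated by a multiple of the product of \<open>1 / (1 + x\<^sup>2)\<close> over the coordinates, because
  \<open>(1 + |\<xi>|\<^sup>2) ^ d\<close> times it is bounded.\<close>

lemma integrable_exp_norm_powr:
  fixes c \<beta> :: real
  assumes c: "c > 0" and \<beta>: "\<beta> > 0"
  shows "integrable lborel (\<lambda>\<xi>::'a::euclidean_space. exp (- c * norm \<xi> powr \<beta>))"
proof -
  let ?d = "DIM('a)"
  have "((\<lambda>t::real. (1 + t\<^sup>2) ^ ?d * exp (- c * t powr \<beta>)) \<longlongrightarrow> 0) at_top"
    using c \<beta> by real_asymp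
  hence "eventually (\<lambda>t::real. (1 + t\<^sup>2) ^ ?d * exp (- c * t powr \<beta>) < 1) at_top"
    by (rule order_tendstoD) simp
  then obtain T where T: "\<And>t. t \<ge> T \<Longrightarrow> (1 + t\<^sup>2) ^ ?d * exp (- c * t powr \<beta>) < 1"
    by (auto simp: eventually_at_top_linorder)
  define K where "K = 1 + (1 + T\<^sup>2) ^ ?d"
  have K: "(1 + t\<^sup>2) ^ ?d * exp (- c * t powr \<beta>) \<le> K" if t: "t \<ge> 0" for t
  proof (cases "t \<ge> T")
    case True
    have "0 \<le> (1 + T\<^sup>2) ^ ?d" by simp
    thus ?thesis using T[OF True] unfolding K_def by linarith
  next
    case False
    have "(1 + t\<^sup>2) ^ ?d * exp (- c * t powr \<beta>) \<le> (1 + t\<^sup>2) ^ ?d * 1"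
      using c by (intro mult_left_mono) auto
    also have "\<dots> \<le> (1 + T\<^sup>2) ^ ?d"
      using False t by (auto intro!: power_mono)
    finally show ?thesis by (simp add: K_def)
  qed
  have le: "exp (- c * norm \<xi> powr \<beta>) \<le> K * (\<Prod>b\<in>Basis. inverse (1 + (\<xi> \<bullet> b)\<^sup>2))" for \<xi> :: 'a
  proof -
    have pos: "0 < 1 + (norm \<xi>)\<^sup>2" by (simp add: add_pos_nonneg)
    have "inverse (1 + (norm \<xi>)\<^sup>2) ^ ?d = (\<Prod>b\<in>(Basis::'a set). inverse (1 + (norm \<xi>)\<^sup>2))" by simp
    also have "\<dots> \<le> (\<Prod>b\<in>Basis. inverse (1 + (\<xi> \<bullet> b)\<^sup>2))"
    proof (intro prod_mono conjI le_imp_inverse_le)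
      fix b :: 'a assume b: "b \<in> Basis"
      show "1 + (\<xi> \<bullet> b)\<^sup>2 \<le> 1 + (norm \<xi>)\<^sup>2"
        using Basis_le_norm[OF b, of \<xi>] by (simp add: abs_le_square_iff[symmetric])
    qed (auto simp: add_pos_nonneg)
    finally have *: "inverse (1 + (norm \<xi>)\<^sup>2) ^ ?d \<le> (\<Prod>b\<in>Basis. inverse (1 + (\<xi> \<bullet> b)\<^sup>2))" .
    have "exp (- c * norm \<xi> powr \<beta>) = ((1 + (norm \<xi>)\<^sup>2) ^ ?d * exp (- c * norm \<xi> powr \<beta>)) * inverse (1 + (norm \<xi>)\<^sup>2) ^ ?d"
      using pos by (simp add: power_inverse field_simps)
    also have "\<dots> \<le> K * (\<Prod>b\<in>Basis. inverse (1 + (\<xi> \<bullet> b)\<^sup>2))"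
      using pos by (intro mult_mono K *) (auto simp: K_def)
    finally show ?thesis .
  qed
  have K0: "K \<ge> 0" by (simp add: K_def)
  have "set_integrable lborel UNIV (\<lambda>x::real. inverse (1 + x^2))"
    using integrable_inverse_1_plus_square by simp
  hence 1: "(\<integral>\<^sup>+x. ennreal (inverse (1 + x\<^sup>2)) \<partial>(lborel :: real measure)) < \<infinity>"
    by (simp add: set_integrable_def integrable_iff_bounded)
  have "(\<integral>\<^sup>+\<xi>. ennreal (norm (exp (- c * norm (\<xi>::'a) powr \<beta>))) \<partial>lborel) \<le>
      (\<integral>\<^sup>+\<xi>. ennreal K * (\<Prod>b\<in>Basis. ennreal (inverse (1 + ((\<xi>::'a) \<bullet> b)\<^sup>2))) \<partial>lborel)"
  proof (intro nn_integral_mono)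
    fix \<xi> :: 'a
    have "ennreal (exp (- c * norm \<xi> powr \<beta>)) \<le> ennreal (K * (\<Prod>b\<in>Basis. inverse (1 + (\<xi> \<bullet> b)\<^sup>2)))"
      by (intro ennreal_leI le)
    also have "\<dots> = ennreal K * (\<Prod>b\<in>Basis. ennreal (inverse (1 + (\<xi> \<bullet> b)\<^sup>2)))"
      using K0 by (subst prod_ennreal) (auto simp: ennreal_mult prod_nonneg)
    finally show "ennreal (norm (exp (- c * norm \<xi> powr \<beta>))) \<le> ennreal K * (\<Prod>b\<in>Basis. ennreal (inverse (1 + (\<xi> \<bullet> b)\<^sup>2)))"
      by simp
  qed
  also have "\<dots> = ennreal K * (\<integral>\<^sup>+\<xi>. (\<Prod>b\<in>Basis. ennreal (inverse (1 + ((\<xi>::'a) \<bullet> b)\<^sup>2))) \<partial>lborel)"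
    by (rule nn_integral_cmult) measurable
  also have "(\<integral>\<^sup>+\<xi>. (\<Prod>b\<in>Basis. ennreal (inverse (1 + ((\<xi>::'a) \<bullet> b)\<^sup>2))) \<partial>lborel) =
     (\<Prod>b\<in>(Basis::'a set). \<integral>\<^sup>+x. ennreal (inverse (1 + x\<^sup>2)) \<partial>lborel)"
    by (rule nn_integral_lborel_prod) auto
  also have "ennreal K * \<dots> < \<infinity>"
    using 1 by (auto simp: ennreal_mult_less_top power_less_top_ennreal)
  finally show ?thesis by (intro integrableI_bounded) auto
qed

lemma fourier_tail_le:
  fixes \<phi> :: "'a::euclidean_space \<Rightarrow> real"
  assumes decay: "\<And>\<xi>. norm (fourier \<phi> \<xi>) \<le> C * exp (- c * norm \<xi> powr \<beta>)"
    and pos: "0 < c" "0 < C" "0 < \<beta>" and T: "0 \<le> T"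
  shows "fourier_tail \<phi> T \<le> ennreal (exp (- (c / 2) * T powr \<beta>) *
    (C * (\<integral>\<xi>. exp (- (c / 2) * norm (\<xi>::'a) powr \<beta>) \<partial>lborel)))"
proof -
  have int: "integrable lborel (\<lambda>\<xi>::'a. exp (- (c / 2) * norm \<xi> powr \<beta>))"
    using pos by (intro integrable_exp_norm_powr) auto
  have "fourier_tail \<phi> T \<le> (\<integral>\<^sup>+\<xi>. ennreal (exp (- (c / 2) * T powr \<beta>) * (C * exp (- (c / 2) * norm (\<xi>::'a) powr \<beta>))) \<partial>lborel)"
    unfolding fourier_tail_def
  proof (intro nn_integral_mono)
    fix \<xi> :: 'a
    show "indicator (- cball 0 T) \<xi> * ennreal (norm (fourier \<phi> \<xi>)) \<le>
      ennreal (exp (- (c / 2) * T powr \<beta>) * (C * exp (- (c / 2) * norm \<xi> powr \<beta>)))"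
    proof (cases "norm \<xi> \<le> T")
      case False
      have "norm (fourier \<phi> \<xi>) \<le> C * exp (- c * norm \<xi> powr \<beta>)" by (rule decay)
      also have "\<dots> = exp (- (c / 2) * norm \<xi> powr \<beta>) * (C * exp (- (c / 2) * norm \<xi> powr \<beta>))"
        by (simp add: exp_add[symmetric] mult.left_commute[of _ C])
      also have "\<dots> \<le> exp (- (c / 2) * T powr \<beta>) * (C * exp (- (c / 2) * norm \<xi> powr \<beta>))"
        using False pos T by (intro mult_right_mono) (auto intro!: powr_mono2)
      finally show ?thesis using False by (simp add: ennreal_leI)
    qed simp
  qed
  also have "\<dots> = ennreal (\<integral>\<xi>. exp (- (c / 2) * T powr \<beta>) * (C * exp (- (c / 2) * norm (\<xi>::'a) powr \<beta>)) \<partial>lborel)"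
    using int pos by (intro nn_integral_eq_integral) auto
  also have "(\<integral>\<xi>. exp (- (c / 2) * T powr \<beta>) * (C * exp (- (c / 2) * norm (\<xi>::'a) powr \<beta>)) \<partial>lborel) =
    exp (- (c / 2) * T powr \<beta>) * (C * (\<integral>\<xi>. exp (- (c / 2) * norm (\<xi>::'a) powr \<beta>) \<partial>lborel))"
    by (simp only: integral_mult_right_zero)
  finally show ?thesis .
qed

text \<open>The cutoff solves \<open>c * T powr \<beta> = 1 + ln n\<close>. Half of the exponent then yields the factor
  \<open>1 / sqrt n\<close>, and the other half keeps the integral finite.\<close>

lemma fourier_tail_log_cutoff:
  fixes \<phi> :: "'a::euclidean_space \<Rightarrow> real"
  assumes decay: "\<And>\<xi>. norm (fourier \<phi> \<xi>) \<le> C * exp (- c * norm \<xi> powr \<beta>)"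
    and pos: "0 < c" "0 < C" "0 < \<beta>"
  shows "\<exists>W. \<forall>n\<ge>3::nat. \<exists>T\<ge>0. \<exists>\<tau>\<ge>0. fourier_tail \<phi> T \<le> ennreal (\<tau> / sqrt (real n)) \<and>
    T ^ DIM('a) + \<tau> \<le> W * (1 + ln (real n)) powr (DIM('a) / \<beta>)"
proof -
  let ?d = "DIM('a)"
  define \<tau>0 where "\<tau>0 = C * (\<integral>\<xi>. exp (- (c / 2) * norm (\<xi>::'a) powr \<beta>) \<partial>lborel)"
  have \<tau>0: "\<tau>0 \<ge> 0" using pos by (simp add: \<tau>0_def)
  show ?thesis
  proof (rule exI[of _ "(1 / c) powr (?d / \<beta>) + \<tau>0"], intro allI impI)
    fix n :: nat assume n: "n \<ge> 3"
    define l where "l = 1 + ln (real n)"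
    have l: "l \<ge> 1" using n by (simp add: l_def)
    define T where "T = (l / c) powr (1 / \<beta>)"
    have T0: "T > 0" using l pos by (simp add: T_def)
    have "T powr \<beta> = l / c" using l pos by (simp add: T_def powr_powr)
    hence "exp (- (c / 2) * T powr \<beta>) = exp (- (1 / 2) * l)" using pos by simp
    also have "\<dots> \<le> exp (- (1 / 2) * ln n)" by (simp add: l_def)
    also have "\<dots> = 1 / sqrt n"
      using n by (simp add: powr_half_sqrt[symmetric] powr_def exp_minus inverse_eq_divide)
    finally have e: "exp (- (c / 2) * T powr \<beta>) \<le> 1 / sqrt n" .
    have "fourier_tail \<phi> T \<le> ennreal (exp (- (c / 2) * T powr \<beta>) * \<tau>0)"
      unfolding \<tau>0_def using T0 by (intro fourier_tail_le[OF decay pos]) simp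
    also have "\<dots> \<le> ennreal (1 / sqrt n * \<tau>0)" by (intro ennreal_leI mult_right_mono e \<tau>0)
    finally have tail: "fourier_tail \<phi> T \<le> ennreal (\<tau>0 / sqrt n)" by simp
    have "T ^ ?d = (l / c) powr (?d / \<beta>)"
      using T0 by (simp add: T_def powr_powr flip: powr_realpow)
    also have "\<dots> = (1 / c) powr (?d / \<beta>) * l powr (?d / \<beta>)"
      using l pos by (simp add: powr_mult[symmetric])
    finally have "T ^ ?d = (1 / c) powr (?d / \<beta>) * l powr (?d / \<beta>)" .
    moreover have "\<tau>0 \<le> \<tau>0 * l powr (?d / \<beta>)"
      using \<tau>0 l pos ge_one_powr_ge_zero[of l "?d / \<beta>"] by (simp add: mult_left_mono mult_le_cancel_left1)
    ultimately have "T ^ ?d + \<tau>0 \<le> ((1 / c) powr (?d / \<beta>) + \<tau>0) * l powr (?d / \<beta>)"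
      by (simp add: distrib_right)
    hence "\<exists>\<tau>\<ge>0. fourier_tail \<phi> T \<le> ennreal (\<tau> / sqrt (real n)) \<and>
        T ^ ?d + \<tau> \<le> ((1 / c) powr (?d / \<beta>) + \<tau>0) * (1 + ln (real n)) powr (?d / \<beta>)"
      using \<tau>0 tail unfolding l_def by blast
    thus "\<exists>T\<ge>0. \<exists>\<tau>\<ge>0. fourier_tail \<phi> T \<le> ennreal (\<tau> / sqrt (real n)) \<and>
        T ^ ?d + \<tau> \<le> ((1 / c) powr (?d / \<beta>) + \<tau>0) * (1 + ln (real n)) powr (?d / \<beta>)"
      using less_imp_le[OF T0] by blast
  qed
qed

lemma fourier_tail_band_limited:
  assumes "closure {\<xi>. fourier \<phi> \<xi> \<noteq> 0} \<subseteq> cball 0 R"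
  shows "fourier_tail \<phi> R = 0"
proof -
  have eq: "indicator (- cball 0 R) \<xi> * ennreal (norm (fourier \<phi> \<xi>)) = 0" for \<xi>
    using assms closure_subset[of "{\<xi>. fourier \<phi> \<xi> \<noteq> 0}"] by (auto simp: indicator_def)
  show ?thesis unfolding fourier_tail_def eq by simp
qed

text \<open>With \<open>r = n / \<Lambda> n\<close> as effective sample size, the choice of \<open>\<nu>\<close> gives all three error terms the order
  \<open>(1 / r) powr (2 * s / (2 * s + d))\<close>.\<close>

lemma tuned_terms:
  fixes d :: nat and s r M N :: real
  assumes s: "s > 0" and r: "r > 0" and M: "M > 0" and N: "N > 0"
  defines "\<nu> \<equiv> N * r powr (1 / (2 * s + d))" and "x \<equiv> (1 / r) powr (2 * s / (2 * s + d))"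
  shows "\<nu> ^ d / nat \<lceil>M * r\<rceil> \<le> N ^ d / M * x" and "\<nu> powr (- 2 * s) = N powr (- 2 * s) * x"
    and "\<nu> ^ d * (1 / r) = N ^ d * x"
proof -
  have sd: "2 * s + d > 0" using s by simp
  have x: "x = r powr (- (2 * s / (2 * s + d)))"
    using r by (simp add: x_def powr_minus_divide powr_divide)
  have \<nu>d: "\<nu> ^ d = N ^ d * r powr (d / (2 * s + d))"
    using r by (simp add: \<nu>_def power_mult_distrib powr_powr flip: powr_realpow)
  have "r powr (d / (2 * s + d)) * (1 / r) = r powr (d / (2 * s + d) - 1)"
    using r by (simp add: powr_diff)
  also have "d / (2 * s + d) - 1 = - (2 * s / (2 * s + d))" using sd by (simp add: field_simps)
  finally have e: "r powr (d / (2 * s + d)) * (1 / r) = x" by (simp add: x)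
  show 3: "\<nu> ^ d * (1 / r) = N ^ d * x" unfolding \<nu>d mult.assoc e ..
  have "\<nu> ^ d / nat \<lceil>M * r\<rceil> \<le> \<nu> ^ d / (M * r)"
  proof (rule divide_left_mono)
    show "M * r \<le> real (nat \<lceil>M * r\<rceil>)" by linarith
    show "0 \<le> \<nu> ^ d" using N by (simp add: \<nu>_def)
    have "0 < M * r" using M r by simp
    moreover from this have "0 < real (nat \<lceil>M * r\<rceil>)" by linarith
    ultimately show "0 < real (nat \<lceil>M * r\<rceil>) * (M * r)" by simp
  qed
  also have "\<dots> = N ^ d / M * x" using 3 M by (simp add: field_simps)
  finally show "\<nu> ^ d / nat \<lceil>M * r\<rceil> \<le> N ^ d / M * x" .
  show "\<nu> powr (- 2 * s) = N powr (- 2 * s) * x"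
    using N r by (simp add: \<nu>_def powr_mult powr_powr x)
qed

text \<open>The factor \<open>\<Lambda> n\<close> is the cost of localization in frequency: a power of \<open>1 + ln n\<close> for exponential
  decay of the transform, and a constant for band-limited kernels.\<close>

lemma uniform_risk_bound:
  fixes \<phi> f0 :: "'a::euclidean_space \<Rightarrow> real" and \<Lambda> :: "nat \<Rightarrow> real"
  assumes s: "0 < s"
    and \<phi>: "L2_fun \<phi>" "prob_density \<phi>" "continuous_on UNIV \<phi>" "\<And>x. \<bar>\<phi> x\<bar> \<le> B"
    and F\<phi>: "integrable lborel (fourier \<phi>)"
    and moment: "(\<integral>\<^sup>+ x. ennreal (norm x powr s * \<phi> x) \<partial>lborel) \<le> ennreal K1"
    and f0: "sobolev s f0" "prob_density f0"
    and tail: "\<exists>W. \<forall>n\<ge>3. \<exists>T\<ge>0. \<exists>\<tau>\<ge>0. fourier_tail \<phi> T \<le> ennreal (\<tau> / sqrt (real n)) \<and>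
      T ^ DIM('a) + \<tau> \<le> W * \<Lambda> n"
    and \<Lambda>: "\<And>n. n \<ge> 3 \<Longrightarrow> 0 < \<Lambda> n"
  shows "\<exists>C>0. \<forall>(\<Omega> :: 'w measure) X m \<nu> \<epsilon> fhat. ls_setup \<phi> f0 \<Omega> X m \<nu> \<epsilon> fhat \<longrightarrow>
       (\<forall>n\<ge>3. risk \<Omega> (fhat n) f0 \<le> ennreal (C *
          (\<nu> n ^ DIM('a) / real (m n) + \<nu> n powr (- 2 * s) + \<nu> n ^ DIM('a) * (\<Lambda> n / real n) + \<epsilon> n)))"
proof -
  let ?d = "DIM('a)"
  \<comment> \<open>\<open>K1\<close> may be negative, in which case its image in the extended reals is 0.\<close>
  define K where "K = max K1 0"
  have K: "K \<ge> 0" "(\<integral>\<^sup>+ x. ennreal (norm x powr s * \<phi> x) \<partial>lborel) \<le> ennreal K"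
    using order_trans[OF moment ennreal_leI[of K1 K]] by (auto simp: K_def)
  have f0_int: "integrable lborel f0" and f0_L2: "L2_fun f0"
    using f0 by (auto simp: prob_density_def sobolev_def)
  obtain L where L: "L \<ge> 0" "\<And>y. translation_gap f0 y \<le> ennreal (L * norm y powr (2 * s))"
    using sobolev_translation_gap[OF s f0(1) f0_int] by blast
  obtain W where W: "\<And>n. n \<ge> 3 \<Longrightarrow> \<exists>T\<ge>0. \<exists>\<tau>\<ge>0. fourier_tail \<phi> T \<le> ennreal (\<tau> / sqrt (real n)) \<and>
      T ^ ?d + \<tau> \<le> W * \<Lambda> n" using tail by blast
  define G where "G = (\<integral>x. (\<phi> x)\<^sup>2 \<partial>lborel)"
  \<comment> \<open>The maximum with 1 lets one factor serve both \<open>T ^ d\<close> and \<open>\<tau>\<close>.\<close>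
  define V where "V = 8 * max (unit_ball_vol ?d) 1 * \<bar>W\<bar>"
  define C where "C = 6 * G + 6 * (L * K\<^sup>2) + 2 + V"
  have nn: "0 \<le> G" "0 \<le> L * K\<^sup>2" "0 \<le> V" using L by (simp_all add: G_def V_def)
  show ?thesis
  proof (rule exI[of _ C], intro conjI allI impI)
    show "C > 0" using nn by (simp add: C_def)
    fix \<Omega> :: "'w measure" and X m \<nu> \<epsilon> fhat and n :: nat
    assume model: "ls_setup \<phi> f0 \<Omega> X m \<nu> \<epsilon> fhat" and n: "n \<ge> 3"
    interpret iid_density \<Omega> X f0
      using model f0 by unfold_locales (auto simp: ls_setup_def)
    from model n have pars: "1 \<le> m n" "0 < \<nu> n" "0 \<le> \<epsilon> n" "ls_estimator \<phi> \<Omega> X n (m n) (\<nu> n) (\<epsilon> n) (fhat n)"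
      by (auto simp: ls_setup_def)
    obtain T \<tau> where T: "T \<ge> 0" "\<tau> \<ge> 0" "fourier_tail \<phi> T \<le> ennreal (\<tau> / sqrt (real n))" "T ^ ?d + \<tau> \<le> W * \<Lambda> n"
      using W[OF n] by blast
    have \<phi>B: "\<phi> x \<le> B" for x using \<phi>(4)[of x] by linarith
    have "risk \<Omega> (fhat n) f0 \<le> ennreal (6 * G * (\<nu> n ^ ?d / real (m n)) + 6 * (L * K\<^sup>2) * \<nu> n powr (- 2 * s)
       + 2 * \<epsilon> n + (8 * unit_ball_vol ?d * T ^ ?d + 8 * \<tau>) * (\<nu> n ^ ?d / real n))"
      unfolding G_def
      by (rule risk_bound[OF \<phi>(1-3) \<phi>B F\<phi> K(2) f0_L2 L(2,1) pars(4,1,2,3) _ T(1,2) K(1) T(3)]) (use n in simp)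
    also have "\<dots> \<le> ennreal (C * (\<nu> n ^ ?d / real (m n) + \<nu> n powr (- 2 * s) + \<nu> n ^ ?d * (\<Lambda> n / real n) + \<epsilon> n))"
    proof (rule ennreal_leI)
      let ?a = "\<nu> n ^ ?d / real (m n)" and ?b = "\<nu> n powr (- 2 * s)" and ?u = "\<nu> n ^ ?d * (\<Lambda> n / real n)"
      have u0: "0 \<le> ?u" "0 \<le> ?a" using pars \<Lambda>[OF n] by auto
      have "8 * unit_ball_vol ?d * T ^ ?d + 8 * \<tau> \<le> 8 * max (unit_ball_vol ?d) 1 * T ^ ?d + 8 * max (unit_ball_vol ?d) 1 * \<tau>"
        using T by (intro add_mono mult_right_mono) auto
      also have "\<dots> = 8 * max (unit_ball_vol ?d) 1 * (T ^ ?d + \<tau>)" by (simp add: distrib_left)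
      also have "\<dots> \<le> 8 * max (unit_ball_vol ?d) 1 * (\<bar>W\<bar> * \<Lambda> n)"
        using T(4) \<Lambda>[OF n] by (intro mult_left_mono order_trans[OF T(4)] mult_right_mono) auto
      finally have "8 * unit_ball_vol ?d * T ^ ?d + 8 * \<tau> \<le> V * \<Lambda> n" by (simp add: V_def mult.assoc)
      hence "(8 * unit_ball_vol ?d * T ^ ?d + 8 * \<tau>) * (\<nu> n ^ ?d / real n) \<le> (V * \<Lambda> n) * (\<nu> n ^ ?d / real n)"
        using pars by (intro mult_right_mono) auto
      also have "\<dots> = V * ?u" by simp
      also have "\<dots> \<le> C * ?u" using nn u0 by (intro mult_right_mono) (auto simp: C_def)
      finally have 1: "(8 * unit_ball_vol ?d * T ^ ?d + 8 * \<tau>) * (\<nu> n ^ ?d / real n) \<le> C * ?u" .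
      have 2: "6 * G * ?a \<le> C * ?a" using nn u0 by (intro mult_right_mono) (auto simp: C_def)
      have 3: "6 * (L * K\<^sup>2) * ?b \<le> C * ?b" using nn by (intro mult_right_mono) (auto simp: C_def)
      have 4: "2 * \<epsilon> n \<le> C * \<epsilon> n" using nn pars by (intro mult_right_mono) (auto simp: C_def)
      show "6 * G * ?a + 6 * (L * K\<^sup>2) * ?b + 2 * \<epsilon> n + (8 * unit_ball_vol ?d * T ^ ?d + 8 * \<tau>) * (\<nu> n ^ ?d / real n)
          \<le> C * (?a + ?b + ?u + \<epsilon> n)"
        using 1 2 3 4 unfolding distrib_left by linarith
    qed
    finally show "risk \<Omega> (fhat n) f0 \<le> ennreal (C * (\<nu> n ^ ?d / real (m n) + \<nu> n powr (- 2 * s) + \<nu> n ^ ?d * (\<Lambda> n / real n) + \<epsilon> n))" .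
  qed
qed

text \<open>The tuned bound is derived from the form with \<open>\<nu> ^ d\<close>: the maximum in \<open>sup_bound\<close> brings in the
  term \<open>\<Lambda> n / n\<close> times the supremum of \<open>f0\<close>, which would have to be compared with the rate separately.\<close>

lemma risk_rates:
  fixes \<phi> f0 :: "'a::euclidean_space \<Rightarrow> real" and \<Lambda> :: "nat \<Rightarrow> real"
  assumes s: "0 < s"
    and \<phi>: "L2_fun \<phi>" "prob_density \<phi>" "continuous_on UNIV \<phi>" "\<And>x. \<bar>\<phi> x\<bar> \<le> B"
    and F\<phi>: "integrable lborel (fourier \<phi>)"
    and moment: "(\<integral>\<^sup>+ x. ennreal (norm x powr s * \<phi> x) \<partial>lborel) \<le> ennreal K1"
    and f0: "sobolev s f0" "prob_density f0"
    and tail: "\<exists>W. \<forall>n\<ge>3. \<exists>T\<ge>0. \<exists>\<tau>\<ge>0. fourier_tail \<phi> T \<le> ennreal (\<tau> / sqrt (real n)) \<and>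
      T ^ DIM('a) + \<tau> \<le> W * \<Lambda> n"
    and \<Lambda>: "\<And>n. n \<ge> 3 \<Longrightarrow> 0 < \<Lambda> n"
  shows "\<exists>C'>0. \<forall>(\<Omega> :: 'w measure) X m \<nu> \<epsilon> fhat.
       ls_setup \<phi> f0 \<Omega> X m \<nu> \<epsilon> fhat \<longrightarrow>
       (\<forall>n\<ge>3. risk \<Omega> (fhat n) f0 \<le> ennreal (C' *
          (\<nu> n ^ DIM('a) / real (m n) + \<nu> n powr (- 2 * s)
           + sup_bound f0 \<phi> (\<nu> n) * (\<Lambda> n / real n) + \<epsilon> n)))" (is ?general)
    and "\<forall>M>0. \<forall>N>0. \<forall>A>0. \<exists>C'>0. \<forall>(\<Omega> :: 'w measure) X m \<nu> \<epsilon> fhat.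
       ls_setup \<phi> f0 \<Omega> X m \<nu> \<epsilon> fhat \<longrightarrow>
       (\<forall>n\<ge>3. m n = nat \<lceil>M * (real n / \<Lambda> n)\<rceil> \<and>
          \<nu> n = N * (real n / \<Lambda> n) powr (1 / (2 * s + DIM('a))) \<and>
          \<epsilon> n \<le> A * (\<Lambda> n / real n) powr (2 * s / (2 * s + DIM('a)))) \<longrightarrow>
       (\<forall>n\<ge>3. risk \<Omega> (fhat n) f0 \<le> ennreal (C' * (\<Lambda> n / real n) powr (2 * s / (2 * s + DIM('a)))))" (is ?tuned)
proof -
  let ?d = "DIM('a)"
  obtain C where C: "C > 0" and bound: "\<forall>(\<Omega> :: 'w measure) X m \<nu> \<epsilon> fhat. ls_setup \<phi> f0 \<Omega> X m \<nu> \<epsilon> fhat \<longrightarrow>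
       (\<forall>n\<ge>3. risk \<Omega> (fhat n) f0 \<le> ennreal (C *
          (\<nu> n ^ ?d / real (m n) + \<nu> n powr (- 2 * s) + \<nu> n ^ ?d * (\<Lambda> n / real n) + \<epsilon> n)))"
    using uniform_risk_bound[OF s \<phi> F\<phi> moment f0 tail \<Lambda>, where 'w='w] by blast
  show ?general
  proof -
    obtain x where x: "\<phi> x > 0" using prob_density_pos_somewhere[OF \<phi>(2)] .
    define C' where "C' = C * (1 + 1 / \<phi> x)"
    have C': "C' > 0" "C \<le> C'" "C / \<phi> x \<le> C'" using C x by (auto simp: C'_def algebra_simps intro!: add_pos_pos)
    show ?thesis
    proof (intro exI[of _ C'] conjI allI impI C'(1))
      fix \<Omega> :: "'w measure" and X m \<nu> \<epsilon> fhat and n :: nat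
      assume model: "ls_setup \<phi> f0 \<Omega> X m \<nu> \<epsilon> fhat" and n: "3 \<le> n"
      from model n have pars: "1 \<le> m n" "0 < \<nu> n" "0 \<le> \<epsilon> n" by (auto simp: ls_setup_def)
      let ?a = "\<nu> n ^ ?d / real (m n)" and ?b = "\<nu> n powr (- 2 * s)" and ?S = "sup_bound f0 \<phi> (\<nu> n)" and ?l = "\<Lambda> n / real n"
      have l: "0 \<le> ?l" using \<Lambda>[OF n] by simp
      have S: "\<nu> n ^ ?d * \<phi> x \<le> ?S" by (rule sup_bound_ge[OF pars(2) \<phi>(3,4)])
      have "0 < \<nu> n ^ ?d * \<phi> x" using pars x by simp
      hence S0: "0 \<le> ?S" using S by linarith
      have "C * (\<nu> n ^ ?d * ?l) = (C / \<phi> x) * ((\<nu> n ^ ?d * \<phi> x) * ?l)" using x by simp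
      also have "\<dots> \<le> C' * (?S * ?l)"
      proof (intro mult_mono mult_right_mono S C'(3) l)
        show "0 \<le> (\<nu> n ^ ?d * \<phi> x) * ?l"
          using pars x l by (intro mult_nonneg_nonneg) auto
      qed (use C' S0 in auto)
      finally have 1: "C * (\<nu> n ^ ?d * ?l) \<le> C' * (?S * ?l)" .
      have 2: "C * ?a \<le> C' * ?a" "C * ?b \<le> C' * ?b" "C * \<epsilon> n \<le> C' * \<epsilon> n"
        by (rule mult_right_mono[OF C'(2)]; use pars in simp)+
      have "C * (?a + ?b + \<nu> n ^ ?d * ?l + \<epsilon> n) \<le> C' * (?a + ?b + ?S * ?l + \<epsilon> n)"
        using 1 2 unfolding distrib_left by linarith
      with bound[rule_format, OF model n] show "risk \<Omega> (fhat n) f0 \<le> ennreal (C' * (?a + ?b + ?S * ?l + \<epsilon> n))"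
        by (meson ennreal_leI order_trans)
    qed
  qed
  show ?tuned
  proof (intro allI impI)
    fix M N A :: real assume MNA: "0 < M" "0 < N" "0 < A"
    define C' where "C' = C * (N ^ ?d / M + N powr (- 2 * s) + N ^ ?d + A)"
    have "C' > 0" using C MNA by (auto simp: C'_def intro!: mult_pos_pos add_pos_pos)
    thus "\<exists>C'>0. \<forall>(\<Omega> :: 'w measure) X m \<nu> \<epsilon> fhat.
       ls_setup \<phi> f0 \<Omega> X m \<nu> \<epsilon> fhat \<longrightarrow>
       (\<forall>n\<ge>3. m n = nat \<lceil>M * (real n / \<Lambda> n)\<rceil> \<and>
          \<nu> n = N * (real n / \<Lambda> n) powr (1 / (2 * s + DIM('a))) \<and>
          \<epsilon> n \<le> A * (\<Lambda> n / real n) powr (2 * s / (2 * s + DIM('a)))) \<longrightarrow>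
       (\<forall>n\<ge>3. risk \<Omega> (fhat n) f0 \<le> ennreal (C' * (\<Lambda> n / real n) powr (2 * s / (2 * s + DIM('a)))))"
    proof (intro exI[of _ C'] conjI allI impI)
      fix \<Omega> :: "'w measure" and X m \<nu> \<epsilon> fhat and n :: nat
      assume model: "ls_setup \<phi> f0 \<Omega> X m \<nu> \<epsilon> fhat" and n: "3 \<le> n"
        and "\<forall>n\<ge>3. m n = nat \<lceil>M * (real n / \<Lambda> n)\<rceil> \<and>
          \<nu> n = N * (real n / \<Lambda> n) powr (1 / (2 * s + ?d)) \<and>
          \<epsilon> n \<le> A * (\<Lambda> n / real n) powr (2 * s / (2 * s + ?d))"
      hence tuning: "m n = nat \<lceil>M * (real n / \<Lambda> n)\<rceil>" "\<nu> n = N * (real n / \<Lambda> n) powr (1 / (2 * s + ?d))"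
          "\<epsilon> n \<le> A * (\<Lambda> n / real n) powr (2 * s / (2 * s + ?d))" by auto
      define r where "r = real n / \<Lambda> n"
      have r: "r > 0" and r': "\<Lambda> n / real n = 1 / r" using \<Lambda>[OF n] n by (auto simp: r_def)
      note terms = tuned_terms[OF s r MNA(1,2), of ?d]
      let ?x = "(1 / r) powr (2 * s / (2 * s + ?d))"
      have "\<nu> n ^ ?d / real (m n) + \<nu> n powr (- 2 * s) + \<nu> n ^ ?d * (\<Lambda> n / real n) + \<epsilon> n \<le>
          N ^ ?d / M * ?x + N powr (- 2 * s) * ?x + N ^ ?d * ?x + A * ?x"
        unfolding tuning(1,2) r_def[symmetric] r'
        by (intro add_mono terms(1) eq_refl[OF terms(2)] eq_refl[OF terms(3)] tuning(3)[unfolded r'])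
      hence "C * (\<nu> n ^ ?d / real (m n) + \<nu> n powr (- 2 * s) + \<nu> n ^ ?d * (\<Lambda> n / real n) + \<epsilon> n) \<le>
          C * (N ^ ?d / M * ?x + N powr (- 2 * s) * ?x + N ^ ?d * ?x + A * ?x)"
        using C by (intro mult_left_mono) auto
      also have "\<dots> = C' * ?x" unfolding C'_def by (simp only: distrib_right distrib_left mult.assoc)
      finally show "risk \<Omega> (fhat n) f0 \<le> ennreal (C' * (\<Lambda> n / real n) powr (2 * s / (2 * s + ?d)))"
        using bound[rule_format, OF model n] unfolding r' by (meson ennreal_leI order_trans)
    qed
  qed
qed

theorem theorem9:
  fixes \<phi> f0 :: "'a::euclidean_space \<Rightarrow> real"
    and s c C \<beta> K1 :: real
  assumes "0 < s" and "s \<le> 1"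
    and "L2_fun \<phi>" and "Linf_fun \<phi>" and "prob_density \<phi>"
    and "0 < c" and "0 < C" and "0 < \<beta>"
    and "\<And>\<xi>. norm (fourier \<phi> \<xi>) \<le> C * exp (- c * norm \<xi> powr \<beta>)"
    and "continuous_on UNIV \<phi>"
    and "(\<integral>\<^sup>+ x. ennreal (norm x powr s * \<phi> x) \<partial>lborel) \<le> ennreal K1"
    and "sobolev s f0" and "Linf_fun f0" and "prob_density f0"
  shows
   "(\<exists>C'>0. \<forall>(\<Omega> :: 'w measure) X m \<nu> \<epsilon> fhat.
       ls_setup \<phi> f0 \<Omega> X m \<nu> \<epsilon> fhat \<longrightarrow>
       (\<forall>n\<ge>3. risk \<Omega> (fhat n) f0 \<le> ennreal (C' *
          (\<nu> n ^ DIM('a) / real (m n) + \<nu> n powr (- 2 * s)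
           + sup_bound f0 \<phi> (\<nu> n) * ((1 + ln (real n)) powr (DIM('a) / \<beta>) / real n)
           + \<epsilon> n))))
    \<and>
    (\<forall>M>0. \<forall>N>0. \<forall>A>0. \<exists>C'>0. \<forall>(\<Omega> :: 'w measure) X m \<nu> \<epsilon> fhat.
       ls_setup \<phi> f0 \<Omega> X m \<nu> \<epsilon> fhat \<longrightarrow>
       (\<forall>n\<ge>3.
          m n = nat \<lceil>M * (real n / (1 + ln (real n)) powr (DIM('a) / \<beta>))\<rceil> \<and>
          \<nu> n = N * (real n / (1 + ln (real n)) powr (DIM('a) / \<beta>))
                  powr (1 / (2 * s + DIM('a))) \<and>
          \<epsilon> n \<le> A * ((1 + ln (real n)) powr (DIM('a) / \<beta>) / real n)
                  powr (2 * s / (2 * s + DIM('a)))) \<longrightarrow>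
       (\<forall>n\<ge>3. risk \<Omega> (fhat n) f0 \<le> ennreal (C' *
          ((1 + ln (real n)) powr (DIM('a) / \<beta>) / real n)
            powr (2 * s / (2 * s + DIM('a))))))
    \<and>
    (\<forall>R0>0. closure {\<xi>. fourier \<phi> \<xi> \<noteq> 0} \<subseteq> cball 0 R0 \<longrightarrow>
      (\<exists>C'>0. \<forall>(\<Omega> :: 'w measure) X m \<nu> \<epsilon> fhat.
         ls_setup \<phi> f0 \<Omega> X m \<nu> \<epsilon> fhat \<longrightarrow>
         (\<forall>n\<ge>3. risk \<Omega> (fhat n) f0 \<le> ennreal (C' *
            (\<nu> n ^ DIM('a) / real (m n) + \<nu> n powr (- 2 * s)
             + sup_bound f0 \<phi> (\<nu> n) * (1 / real n)
             + \<epsilon> n))))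
      \<and>
      (\<forall>M>0. \<forall>N>0. \<forall>A>0. \<exists>C'>0. \<forall>(\<Omega> :: 'w measure) X m \<nu> \<epsilon> fhat.
         ls_setup \<phi> f0 \<Omega> X m \<nu> \<epsilon> fhat \<longrightarrow>
         (\<forall>n\<ge>3.
            m n = nat \<lceil>M * real n\<rceil> \<and>
            \<nu> n = N * real n powr (1 / (2 * s + DIM('a))) \<and>
            \<epsilon> n \<le> A * real n powr (- (2 * s / (2 * s + DIM('a))))) \<longrightarrow>
         (\<forall>n\<ge>3. risk \<Omega> (fhat n) f0 \<le> ennreal (C' *
            real n powr (- (2 * s / (2 * s + DIM('a))))))))"
proof -
  note cont = \<open>continuous_on UNIV \<phi>\<close>
  obtain B where B: "\<And>x. \<bar>\<phi> x\<bar> \<le> B"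
    using Linf_fun_continuous_bounded[OF cont \<open>Linf_fun \<phi>\<close>] by blast
  have F\<phi>: "integrable lborel (fourier \<phi>)"
  proof (rule Bochner_Integration.integrable_bound)
    show "integrable lborel (\<lambda>\<xi>. C * exp (- c * norm \<xi> powr \<beta>))"
      using assms(6,8) by (intro integrable_mult_right integrable_exp_norm_powr)
    have [measurable]: "\<phi> \<in> borel_measurable borel" by (rule borel_measurable_continuous_onI[OF cont])
    show "fourier \<phi> \<in> borel_measurable lborel" by measurable
    show "AE \<xi> in lborel. norm (fourier \<phi> \<xi>) \<le> norm (C * exp (- c * norm \<xi> powr \<beta>))"
      by (intro AE_I2 order_trans[OF assms(9)]) simp
  qed
  note rates = risk_rates[OF assms(1,3,5) cont B F\<phi> assms(11,12,14)]
  have log: "0 < (1 + ln (real n)) powr (DIM('a) / \<beta>)" if "n \<ge> 3" for n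
  proof -
    have "0 \<le> ln (real n)" using that by simp
    hence "0 < 1 + ln (real n)" by linarith
    thus ?thesis by simp
  qed
  note exp_rates = rates[OF fourier_tail_log_cutoff[OF assms(9,6,7,8)] log]
  have band: "\<exists>W. \<forall>n\<ge>3::nat. \<exists>T\<ge>0. \<exists>\<tau>\<ge>0. fourier_tail \<phi> T \<le> ennreal (\<tau> / sqrt (real n)) \<and>
      T ^ DIM('a) + \<tau> \<le> W * (\<lambda>_. 1) n"
    if "R0 > 0" "closure {\<xi>. fourier \<phi> \<xi> \<noteq> 0} \<subseteq> cball 0 R0" for R0
  proof (rule exI[of _ "R0 ^ DIM('a)"], intro allI impI)
    fix n :: nat
    have "fourier_tail \<phi> R0 \<le> ennreal (0 / sqrt (real n)) \<and> R0 ^ DIM('a) + 0 \<le> R0 ^ DIM('a) * (\<lambda>_. 1) n"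
      using fourier_tail_band_limited[OF that(2)] by simp
    thus "\<exists>T\<ge>0. \<exists>\<tau>\<ge>0. fourier_tail \<phi> T \<le> ennreal (\<tau> / sqrt (real n)) \<and>
        T ^ DIM('a) + \<tau> \<le> R0 ^ DIM('a) * (\<lambda>_. 1) n"
      using less_imp_le[OF that(1)] by blast
  qed
  have inv: "(1 / real n) powr a = real n powr (- a)" for n :: nat and a
    by (simp add: powr_divide powr_minus_divide)
  note band_rates = rates[OF band zero_less_one, unfolded div_by_1 inv]
  show ?thesis
    by (intro conjI allI impI) (rule exp_rates exp_rates(2)[rule_format] band_rates band_rates(2)[rule_format]; assumption?)+
qed

end
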